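(* Let $3/2<\beta\le\beta^*$. The dynamical systems $(\Omega\times S_\beta,\mathcal A\times\mathcal S,\nu_\beta,K_\beta)$ and $(\Upsilon,\mathcal B,\mathbb P,\sigma')$ are isomorphic, where $\nu_\beta(A)=\mathbb P(\varphi(Z\cap A))$ for $A\in\mathcal A\times\mathcal S$. Moreover, $\nu_\beta$ is the unique $K_\beta$-invariant measure of maximal entropy.
   Context: $\beta^*\approx1.5437$ is the real root of $x^3-2x^2+2x=2$. $\vec q_0=(0,0)$, $\vec q_1=(1,0)$, $\vec q_2=(0,1)$, $f_i(\vec z)=(\vec z+\vec q_i)/\beta$, $S_\beta$ the attractor of this IFS with Borel $\sigma$-algebra $\mathcal S$. $H=\{(x,y):x<\frac1\beta,\ y<\frac1\beta,\ x+y>\frac{1}{\beta(\beta-1)}\}$; $\tilde E_0=([0,\frac1\beta)\times[0,\frac1\beta))\setminus H$; $\tilde E_1=\{0\le y<\frac1\beta,\ \frac{1}{\beta(\beta-1)}<x+y\le\frac1{\beta-1}\}\setminus H$; $\tilde E_2=\{0\le x<\frac1\beta,\ \frac{1}{\beta(\beta-1)}<x+y\le\frac1{\beta-1}\}\setminus H$; $\tilde C_{01}=\{x\ge\frac1\beta,\ y\ge0,\ x+y\le\frac{1}{\beta(\beta-1)}\}$; $\tilde C_{12}=\{x\ge\frac1\beta,\ y\ge\frac1\beta,\ x+y\le\frac1{\beta-1}\}$; $\tilde C_{02}=\{x\ge0,\ y\ge\frac1\beta,\ x+y\le\frac{1}{\beta(\beta-1)}\}$. For $\{i,j,k\}=\{0,1,2\}$,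 $E_i=\bigl(\tilde E_i\cup\bigcup_{n\ge1}f_jf_i^n(H)\cup\bigcup_{n\ge1}f_kf_i^n(H)\bigr)\setminus\bigcup_{n\ge0}f_i^n(H)$; for $ij\in\{01,12,02\}$, $C_{ij}=\tilde C_{ij}\setminus\bigl(\bigcup_{n\ge1}f_if_j^n(H)\cup\bigcup_{n\ge1}f_jf_i^n(H)\bigr)$; $C=C_{01}\cup C_{12}\cup C_{02}$. $\Omega=\{0,1\}^{\mathbb N}$, $\Upsilon=\{0,1,2\}^{\mathbb N}$ with product $\sigma$-algebras $\mathcal A,\mathcal B$, left shifts $\sigma,\sigma'$; $\mathbb P$ is the uniform product measure on $\Upsilon$. $K_\beta:\Omega\times S_\beta\to\Omega\times S_\beta$: $K_\beta(\omega,\vec z)=(\omega,\beta\vec z-\vec q_i)$ if $\vec z\in E_i$; $(\sigma\omega,\beta\vec z-\vec q_i)$ if $\omega_1=0$, $\vec z\in C_{ij}$; $(\sigma\omega,\beta\vec z-\vec q_j)$ if $\omega_1=1$, $\vec z\in C_{ij}$. The digit $d_1(\omega,\vec z)$ is the vector subtracted, $d_n=d_1\circ K_\beta^{n-1}$. $\varphi:\Omega\times S_\beta\to\Upsilon$, $\varphi(\omega,\vec z)=(b_1,b_2,\ldots)$ where $d_n(\omega,\vec z)=\vec q_{b_n}$. $Z=\{(\omega,\vec z):K_\beta^n(\omega,\vec z)\in\Omega\times C\text{ for infinitely many }n\}$. *)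

theory Defs
  imports "HOL-Probability.Probability"
begin

definition beta_star :: real where
  "beta_star = (THE x::real. x^3 - 2*x^2 + 2*x = 2)"

definition qv :: "nat \<Rightarrow> real \<times> real" where
  "qv i = (if i = 0 then (0,0) else if i = 1 then (1,0) else (0,1))"

definition fmap :: "real \<Rightarrow> nat \<Rightarrow> real \<times> real \<Rightarrow> real \<times> real" where
  "fmap \<beta> i z = (1/\<beta>) *\<^sub>R (z + qv i)"

definition S_attr :: "real \<Rightarrow> (real \<times> real) set" where
  "S_attr \<beta> = (THE S. compact S \<and> S \<noteq> {} \<and> S = (\<Union>i\<in>{0,1,2::nat}. fmap \<beta> i ` S))"

definition Hset :: "real \<Rightarrow> (real \<times> real) set" where
  "Hset \<beta> = {(x,y). x < 1/\<beta> \<and> y < 1/\<beta> \<and> x + y > 1/(\<beta>*(\<beta>-1))}"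

definition Et :: "real \<Rightarrow> nat \<Rightarrow> (real \<times> real) set" where
  "Et \<beta> i =
    (if i = 0 then {(x,y). 0 \<le> x \<and> x < 1/\<beta> \<and> 0 \<le> y \<and> y < 1/\<beta>}
     else if i = 1 then {(x,y). 0 \<le> y \<and> y < 1/\<beta> \<and> 1/(\<beta>*(\<beta>-1)) < x + y \<and> x + y \<le> 1/(\<beta>-1)}
     else {(x,y). 0 \<le> x \<and> x < 1/\<beta> \<and> 1/(\<beta>*(\<beta>-1)) < x + y \<and> x + y \<le> 1/(\<beta>-1)})
    - Hset \<beta>"

text \<open>Ct beta i j for ij in {01,12,02}.\<close>
definition Ct :: "real \<Rightarrow> nat \<Rightarrow> nat \<Rightarrow> (real \<times> real) set" where
  "Ct \<beta> i j =
    (if (i,j) = (0,1) then {(x,y). x \<ge> 1/\<beta> \<and> y \<ge> 0 \<and> x + y \<le> 1/(\<beta>*(\<beta>-1))}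
     else if (i,j) = (1,2) then {(x,y). x \<ge> 1/\<beta> \<and> y \<ge> 1/\<beta> \<and> x + y \<le> 1/(\<beta>-1)}
     else {(x,y). x \<ge> 0 \<and> y \<ge> 1/\<beta> \<and> x + y \<le> 1/(\<beta>*(\<beta>-1))})"

definition Eset :: "real \<Rightarrow> nat \<Rightarrow> (real \<times> real) set" where
  "Eset \<beta> i =
    (Et \<beta> i \<union> (\<Union>j\<in>{0,1,2::nat} - {i}. \<Union>n\<in>{1..}. fmap \<beta> j ` ((fmap \<beta> i ^^ n) ` Hset \<beta>)))
    - (\<Union>n. (fmap \<beta> i ^^ n) ` Hset \<beta>)"

definition Cset :: "real \<Rightarrow> nat \<Rightarrow> nat \<Rightarrow> (real \<times> real) set" where
  "Cset \<beta> i j = Ct \<beta> i j -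
    ((\<Union>n\<in>{1..}. fmap \<beta> i ` ((fmap \<beta> j ^^ n) ` Hset \<beta>)) \<union>
     (\<Union>n\<in>{1..}. fmap \<beta> j ` ((fmap \<beta> i ^^ n) ` Hset \<beta>)))"

definition Call :: "real \<Rightarrow> (real \<times> real) set" where
  "Call \<beta> = Cset \<beta> 0 1 \<union> Cset \<beta> 1 2 \<union> Cset \<beta> 0 2"

text \<open>Sequences are indexed from 0: omega 0 is the paper's omega_1.\<close>
definition Omega_M :: "(nat \<Rightarrow> nat) measure" where
  "Omega_M = (\<Pi>\<^sub>M n\<in>UNIV. count_space {0,1::nat})"

definition Ups_P :: "(nat \<Rightarrow> nat) measure" where
  "Ups_P = (\<Pi>\<^sub>M n\<in>UNIV. uniform_count_measure {0,1,2::nat})"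

definition shift :: "(nat \<Rightarrow> nat) \<Rightarrow> (nat \<Rightarrow> nat)" where
  "shift w = (\<lambda>n. w (Suc n))"

text \<open>Measurable space (Omega x S_beta, A x S); only its sigma-algebra is used.\<close>
definition XM :: "real \<Rightarrow> ((nat \<Rightarrow> nat) \<times> (real \<times> real)) measure" where
  "XM \<beta> = Omega_M \<Otimes>\<^sub>M restrict_space borel (S_attr \<beta>)"

text \<open>Index of the digit subtracted (d_1 = qv (kdig ...)).  The cases are tried in the
 order E0, E1, E2, C01, C12, C02; points in none of them get digit 0 (irrelevant default).\<close>
definition kdig :: "real \<Rightarrow> (nat \<Rightarrow> nat) \<times> (real \<times> real) \<Rightarrow> nat" where
  "kdig \<beta> p = (let w = fst p; z = snd p in
     if z \<in> Eset \<beta> 0 then 0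
     else if z \<in> Eset \<beta> 1 then 1
     else if z \<in> Eset \<beta> 2 then 2
     else if z \<in> Cset \<beta> 0 1 then (if w 0 = 0 then 0 else 1)
     else if z \<in> Cset \<beta> 1 2 then (if w 0 = 0 then 1 else 2)
     else if z \<in> Cset \<beta> 0 2 then (if w 0 = 0 then 0 else 2)
     else 0)"

definition Kmap :: "real \<Rightarrow> (nat \<Rightarrow> nat) \<times> (real \<times> real) \<Rightarrow> (nat \<Rightarrow> nat) \<times> (real \<times> real)" where
  "Kmap \<beta> p = (let w = fst p; z = snd p in
     ((if z \<notin> Eset \<beta> 0 \<and> z \<notin> Eset \<beta> 1 \<and> z \<notin> Eset \<beta> 2 \<and> z \<in> Call \<beta> then shift w else w),
      \<beta> *\<^sub>R z - qv (kdig \<beta> p)))"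

definition phi :: "real \<Rightarrow> (nat \<Rightarrow> nat) \<times> (real \<times> real) \<Rightarrow> (nat \<Rightarrow> nat)" where
  "phi \<beta> p = (\<lambda>n. kdig \<beta> ((Kmap \<beta> ^^ n) p))"

definition Zset :: "real \<Rightarrow> ((nat \<Rightarrow> nat) \<times> (real \<times> real)) set" where
  "Zset \<beta> = {p \<in> space Omega_M \<times> S_attr \<beta>.
               infinite {n. (Kmap \<beta> ^^ n) p \<in> space Omega_M \<times> Call \<beta>}}"

definition nu :: "real \<Rightarrow> ((nat \<Rightarrow> nat) \<times> (real \<times> real)) measure" where
  "nu \<beta> = measure_of (space (XM \<beta>)) (sets (XM \<beta>))
            (\<lambda>A. emeasure Ups_P (phi \<beta> ` (Zset \<beta> \<inter> A)))"

definition isomorphic_sys :: "'a measure \<Rightarrow> ('a \<Rightarrow> 'a) \<Rightarrow> 'b measure \<Rightarrow> ('b \<Rightarrow> 'b) \<Rightarrow> bool" where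
  "isomorphic_sys M T M' T' \<longleftrightarrow>
    (\<exists>N N' \<psi>. N \<in> sets M \<and> emeasure M N = 0 \<and> N' \<in> sets M' \<and> emeasure M' N' = 0 \<and>
      (\<forall>x \<in> space M - N. T x \<in> space M - N) \<and>
      (\<forall>y \<in> space M' - N'. T' y \<in> space M' - N') \<and>
      bij_betw \<psi> (space M - N) (space M' - N') \<and>
      \<psi> \<in> measurable (restrict_space M (space M - N)) M' \<and>
      the_inv_into (space M - N) \<psi> \<in> measurable (restrict_space M' (space M' - N')) M \<and>
      (\<forall>B \<in> sets M'. emeasure M (\<psi> -` B \<inter> (space M - N)) = emeasure M' B) \<and>
      (\<forall>x \<in> space M - N. \<psi> (T x) = T' (\<psi> x)))"

definition invariant_prob :: "'a measure \<Rightarrow> ('a \<Rightarrow> 'a) \<Rightarrow> 'a measure \<Rightarrow> bool" where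
  "invariant_prob M T \<mu> \<longleftrightarrow> sets \<mu> = sets M \<and> prob_space \<mu> \<and> T \<in> measurable M M \<and>
     (\<forall>A \<in> sets M. emeasure \<mu> (T -` A \<inter> space M) = emeasure \<mu> A)"

definition fin_partition :: "'a measure \<Rightarrow> 'a set set \<Rightarrow> bool" where
  "fin_partition M P \<longleftrightarrow> finite P \<and> P \<subseteq> sets M \<and> disjoint P \<and> \<Union>P = space M"

definition part_entropy :: "'a measure \<Rightarrow> 'a set set \<Rightarrow> real" where
  "part_entropy \<mu> P = - (\<Sum>A\<in>P. measure \<mu> A * ln (measure \<mu> A))"

definition refine :: "'a measure \<Rightarrow> ('a \<Rightarrow> 'a) \<Rightarrow> 'a set set \<Rightarrow> nat \<Rightarrow> 'a set set" where
  "refine M T P n = {space M \<inter> (\<Inter>i<n. (T ^^ i) -` a i) | a. \<forall>i<n. a i \<in> P}"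

definition ks_entropy :: "'a measure \<Rightarrow> ('a \<Rightarrow> 'a) \<Rightarrow> ereal" where
  "ks_entropy \<mu> T = (SUP P \<in> {P. fin_partition \<mu> P}.
      ereal (lim (\<lambda>n. part_entropy \<mu> (refine \<mu> T P n) / real n)))"

end

theory Submission
  imports Defs
begin

text \<open>In barycentric coordinates \<open>u\<^sub>0, u\<^sub>1, u\<^sub>2\<close> of the big triangle, the map \<open>f\<^sub>i\<close> scales
  all coordinates by \<open>1/\<beta>\<close> and then adds \<open>1/\<beta>\<close> to \<open>u\<^sub>i\<close>, and the central hole is
  \<open>H = {u\<^sub>0, u\<^sub>1, u\<^sub>2 < 1/\<beta>}\<close>. For \<open>3/2 < \<beta> \<le> \<beta>*\<close> the attractor \<open>S\<close> is the triangle minus the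
  holes \<open>f\<^sub>i\<^sup>n(H)\<close>; on it \<open>E\<^sub>i\<close> consists of the points lying in \<open>f\<^sub>i(S)\<close> only and \<open>C\<^sub>i\<^sub>j\<close> is
  \<open>f\<^sub>i(S) \<inter> f\<^sub>j(S)\<close>. Hence a point can use exactly the digits compatible with its position, and
  the coin sequence can be read off the digits as long as the switch region is visited infinitely
  often. The switch region contains a relatively open set, so almost every digit sequence visits it
  infinitely often and the coding map is an isomorphism onto the full shift.

  For an invariant measure, the coins and the finer structure of phase space are approximated in
  measure by finitely many digits and coins. Since an approximation error that is rare costs little
  entropy per step, every finite partition has entropy at most that of the digit partition, which is
  at most \<open>ln 3\<close>. Equality forces all digit words of equal length to be equally likely, that is,
  the digits are distributed like the uniform product measure, which determines the measure.\<close>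

section \<open>Entropy of finite-valued observables\<close>

text \<open>The digit partition need not generate: where the switch region is visited only finitely
  often, infinitely many coins never influence the digits. The usual generator argument therefore
  breaks down, and unread coins have to be charged differently. The map is followed backwards: the
  first \<open>m\<close> coins and digits at time \<open>i\<close> are determined by the digit and
  the coin (if any) used at time \<open>i\<close> and by the first \<open>m\<close> coins and digits
  at time \<open>i + 1\<close>. Unread coins are thus paid for once, at the end of the orbit
  segment, and not at each step. The coin that is tossed is a function of the infinite digit
  sequence, hence of a finite digit window up to a rare error. On the geometric side, \<beta> > 3/2
  makes three coordinates \<open>\<ge> 1/\<beta>\<close> impossible, so at most two digits compete.
  The bound \<open>\<beta> \<le> beta_star\<close> keeps each hole
  \<open>f\<^sub>j(f\<^sub>i\<^sup>n(H))\<close> with \<open>i \<noteq> j\<close>,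
  \<open>n \<ge> 1\<close> inside the \<open>f\<^sub>i\<close>-image of the triangle. Such holes for
  exchanged digits are disjoint, so a point lost by one map is still reached by the other.\<close>

definition sentropy :: "'a measure \<Rightarrow> ('a \<Rightarrow> 'b) \<Rightarrow> real" where
  "sentropy M f = - (\<Sum>v\<in>f ` space M. measure M (f -` {v} \<inter> space M) * ln (measure M (f -` {v} \<inter> space M)))"

definition itin :: "('a \<Rightarrow> 'a) \<Rightarrow> ('a \<Rightarrow> 'b) \<Rightarrow> nat \<Rightarrow> 'a \<Rightarrow> 'b list" where
  "itin T f n x = map (\<lambda>i. f ((T ^^ i) x)) [0..<n]"

lemma itin_Suc: "itin T f (Suc n) x = itin T f n x @ [f ((T ^^ n) x)]"
  by (simp add: itin_def)

lemma itin_add: "itin T f (m + n) x = itin T f m x @ itin T f n ((T ^^ m) x)"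
proof (induction n)
  case (Suc n)
  have "(T ^^ (m + n)) x = (T ^^ n) ((T ^^ m) x)"
    by (metis add.commute comp_apply funpow_add)
  then show ?case using Suc by (simp add: itin_Suc)
qed (simp add: itin_def)

lemma itin_eq_iff: "itin T f n x = itin T f n y \<longleftrightarrow> (\<forall>i<n. f ((T ^^ i) x) = f ((T ^^ i) y))"
  by (auto simp: itin_def)

lemma sentropy_cong:
  assumes "\<And>x. x \<in> space M \<Longrightarrow> f x = g x"
  shows "sentropy M f = sentropy M g"
proof -
  have "f -` {v} \<inter> space M = g -` {v} \<inter> space M" for v
    using assms by auto
  moreover have "f ` space M = g ` space M"
    using assms by auto
  ultimately show ?thesis by (simp add: sentropy_def)
qed

context prob_space
begin

lemma information_space_exp: "information_space M (exp 1)"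
  by unfold_locales simp

lemma sentropy_eq_entropy:
  assumes "simple_function M f"
  shows "sentropy M f = entropy (exp 1) (count_space (f ` space M)) f"
proof -
  interpret information_space M "exp 1" by (rule information_space_exp)
  show ?thesis
    using entropy_simple_distributed[OF simple_distributedI[OF assms measure_nonneg refl]]
    by (simp add: sentropy_def log_def)
qed

lemma sentropy_Pair_le:
  assumes "simple_function M f" "simple_function M g"
  shows "sentropy M (\<lambda>x. (f x, g x)) \<le> sentropy M f + sentropy M g"
proof -
  interpret information_space M "exp 1" by (rule information_space_exp)
  show ?thesis
    using entropy_chain_rule[OF assms] conditional_entropy_less_eq_entropy[OF assms(2,1)]
      assms simple_function_Pair[OF assms]
    by (simp add: sentropy_eq_entropy)
qed

text \<open>By \<open>det\<close>, \<open>f\<close> factors through \<open>g\<close> on the space,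
  and applying a function cannot increase entropy.\<close>

lemma sentropy_mono:
  assumes f: "simple_function M f" and g: "simple_function M g"
    and det: "\<And>x y. \<lbrakk>x \<in> space M; y \<in> space M; g x = g y\<rbrakk> \<Longrightarrow> f x = f y"
  shows "sentropy M f \<le> sentropy M g"
proof -
  interpret information_space M "exp 1" by (rule information_space_exp)
  define u where "u v = f (SOME x. x \<in> space M \<and> g x = v)" for v
  have u: "u (g x) = f x" if x: "x \<in> space M" for x
  proof -
    define y where "y = (SOME y. y \<in> space M \<and> g y = g x)"
    have "y \<in> space M \<and> g y = g x"
      unfolding y_def by (rule someI[of _ x]) (simp add: x)
    then have "f y = f x" using det x by blast
    then show ?thesis by (simp add: u_def y_def)
  qed
  have "sentropy M f = sentropy M (u \<circ> g)"
    by (rule sentropy_cong) (simp add: u)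
  also have "\<dots> \<le> sentropy M g"
    using entropy_data_processing[OF g, of u] g by (simp add: sentropy_eq_entropy)
  finally show ?thesis .
qed

lemma sentropy_le_card:
  assumes "simple_function M f" "f ` space M \<subseteq> R" "finite R"
  shows "sentropy M f \<le> ln (card R)"
proof -
  interpret information_space M "exp 1" by (rule information_space_exp)
  have "sentropy M f \<le> ln (card (f ` space M))"
    using entropy_le_card[OF simple_distributedI[OF assms(1) measure_nonneg refl]] assms(1)
    by (simp add: sentropy_eq_entropy log_def)
  also have "\<dots> \<le> ln (card R)"
    using assms card_mono[of R "f ` space M"] not_empty
    by (subst ln_le_cancel_iff) (auto simp: card_gt_0_iff intro: finite_subset)
  finally show ?thesis .
qed

text \<open>The summand \<open>p ln (pN) - p + 1/N\<close> is nonnegative and vanishes only for \<open>p = 1/N\<close>.\<close>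
lemma uniform_if_sentropy_max:
  assumes f: "simple_function M f" and R: "f ` space M \<subseteq> R" "finite R"
    and max: "ln (card R) \<le> sentropy M f" and v: "v \<in> R"
  shows "prob (f -` {v} \<inter> space M) = 1 / card R"
proof -
  define p where "p v = prob (f -` {v} \<inter> space M)" for v
  define N where "N = real (card R)"
  have N: "N > 0" using R v by (auto simp: N_def card_gt_0_iff)
  have p0: "p v \<ge> 0" for v by (simp add: p_def)
  have p_out: "p v = 0" if "v \<notin> f ` space M" for v
  proof -
    have "f -` {v} \<inter> space M = {}" using that by auto
    then show ?thesis by (simp add: p_def)
  qed
  have sum1: "(\<Sum>v\<in>R. p v) = 1"
  proof -
    have "(\<Sum>v\<in>R. p v) = (\<Sum>v\<in>f ` space M. p v)"
      by (rule sum.mono_neutral_right) (use R p_out in auto)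
    also have "\<dots> = 1"
      using simple_distributed_sum_space[OF simple_distributedI[OF f measure_nonneg refl]]
      by (simp add: p_def)
    finally show ?thesis .
  qed
  have ent: "sentropy M f = - (\<Sum>v\<in>R. p v * ln (p v))"
    unfolding sentropy_def p_def[symmetric]
    by (subst sum.mono_neutral_left[of R "f ` space M"]) (use R p_out in auto)
  define g where "g v = p v * ln (p v) + p v * ln N - p v + 1 / N" for v
  have gpos: "g v \<ge> 0 \<and> (g v = 0 \<longrightarrow> p v = 1 / N)" for v
  proof (cases "p v = 0")
    case True
    then show ?thesis using N by (simp add: g_def)
  next
    case False
    then have p: "p v > 0" using p0[of v] by linarith
    define t where "t = 1 / (p v * N)"
    have t: "t > 0" using p N by (simp add: t_def)
    have lnt: "ln t = - ln (p v) - ln N"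
      using p N by (simp add: t_def ln_div ln_mult)
    have g_eq: "g v = p v * (t - 1 - ln t)"
      unfolding g_def lnt using p N by (simp add: t_def field_simps)
    have "ln t \<le> t - 1" using ln_le_minus_one[OF t] .
    moreover have "t = 1" if "ln t = t - 1" using ln_eq_minus_one[OF t that] .
    moreover have "t = 1 \<longrightarrow> p v = 1 / N" using p N by (auto simp: t_def field_simps)
    ultimately show ?thesis
      using p by (auto simp: g_eq)
  qed
  have "(\<Sum>v\<in>R. g v) = - sentropy M f + ln N * (\<Sum>v\<in>R. p v) - (\<Sum>v\<in>R. p v) + 1"
    using N by (simp add: g_def ent sum.distrib sum_subtractf sum_distrib_left[symmetric]
        sum_distrib_right[symmetric] N_def)
  also have "\<dots> \<le> 0" using max by (simp add: sum1 N_def)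
  finally have "(\<Sum>v\<in>R. g v) = 0" using gpos by (meson order_antisym sum_nonneg)
  then have "g v = 0" using sum_nonneg_eq_0_iff[OF R(2), of g] gpos v by auto
  then show ?thesis using gpos[of v] by (simp add: p_def N_def)
qed

lemma sentropy_nonneg:
  assumes "simple_function M f"
  shows "sentropy M f \<ge> 0"
proof -
  have "measure M (f -` {v} \<inter> space M) * ln (measure M (f -` {v} \<inter> space M)) \<le> 0" for v
    by (cases "measure M (f -` {v} \<inter> space M) = 0")
       (auto intro!: mult_nonneg_nonpos simp: zero_less_measure_iff)
  then show ?thesis by (auto simp: sentropy_def intro!: sum_nonpos)
qed

end

section \<open>Block entropies along a measure-preserving map\<close>

locale measure_preserving_system = prob_space M for M :: "'a measure" +
  fixes T :: "'a \<Rightarrow> 'a"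
  assumes T_meas [measurable]: "T \<in> measurable M M"
    and T_inv: "A \<in> sets M \<Longrightarrow> measure M (T -` A \<inter> space M) = measure M A"
begin

lemma T_space: "x \<in> space M \<Longrightarrow> T x \<in> space M"
  using T_meas by (rule measurable_space)

lemma T_pow_meas [measurable]: "(T ^^ n) \<in> measurable M M"
  by (induction n) auto

lemma T_pow_space: "x \<in> space M \<Longrightarrow> (T ^^ n) x \<in> space M"
  using T_pow_meas by (rule measurable_space)

lemma simple_function_comp_T:
  assumes "simple_function M f"
  shows "simple_function M (\<lambda>x. f ((T ^^ n) x))"
  unfolding simple_function_def
proof safe
  have "(\<lambda>x. f ((T ^^ n) x)) ` space M \<subseteq> f ` space M" using T_pow_space by auto
  then show "finite ((\<lambda>x. f ((T ^^ n) x)) ` space M)"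
    using assms by (auto simp: simple_function_def intro: finite_subset)
  fix x assume "x \<in> space M"
  then have "f -` {f ((T ^^ n) x)} \<inter> space M \<in> sets M"
    using assms T_pow_space by (auto simp: simple_function_def)
  from measurable_sets[OF T_pow_meas this, of n]
  show "(\<lambda>x. f ((T ^^ n) x)) -` {f ((T ^^ n) x)} \<inter> space M \<in> sets M"
    by (rule back_subst[where P = "\<lambda>A. A \<in> sets M"]) (use T_pow_space in auto)
qed

text \<open>\<open>T\<close> may fail to be onto, so \<open>f \<circ> T\<close> may miss values of
  \<open>f\<close>; invariance gives those values probability zero, and they drop out of the
  sum.\<close>

lemma sentropy_comp_T1:
  assumes f: "simple_function M f"
  shows "sentropy M (\<lambda>x. f (T x)) = sentropy M f"
proof -
  have eq: "prob ((\<lambda>x. f (T x)) -` {v} \<inter> space M) = prob (f -` {v} \<inter> space M)" for v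
  proof -
    have "f -` {v} \<inter> space M \<in> sets M" by (rule simple_functionD[OF f])
    moreover have "T -` (f -` {v} \<inter> space M) \<inter> space M = (\<lambda>x. f (T x)) -` {v} \<inter> space M"
      using T_space by auto
    ultimately show ?thesis using T_inv by metis
  qed
  have out: "prob (f -` {v} \<inter> space M) = 0" if "v \<notin> (\<lambda>x. f (T x)) ` space M" for v
  proof -
    have "(\<lambda>x. f (T x)) -` {v} \<inter> space M = {}" using that by auto
    then show ?thesis using eq[of v] by simp
  qed
  have "(\<Sum>v\<in>(\<lambda>x. f (T x)) ` space M. prob (f -` {v} \<inter> space M) * ln (prob (f -` {v} \<inter> space M)))
    = (\<Sum>v\<in>f ` space M. prob (f -` {v} \<inter> space M) * ln (prob (f -` {v} \<inter> space M)))"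
  proof (rule sum.mono_neutral_left)
    show "finite (f ` space M)" using f by (simp add: simple_function_def)
    show "(\<lambda>x. f (T x)) ` space M \<subseteq> f ` space M" using T_space by blast
    show "\<forall>v\<in>f ` space M - (\<lambda>x. f (T x)) ` space M.
        prob (f -` {v} \<inter> space M) * ln (prob (f -` {v} \<inter> space M)) = 0"
      by (metis DiffD2 mult_zero_left out)
  qed
  then show ?thesis by (simp only: sentropy_def eq)
qed

lemma sentropy_comp_T:
  assumes f: "simple_function M f"
  shows "sentropy M (\<lambda>x. f ((T ^^ n) x)) = sentropy M f"
proof (induction n)
  case (Suc n)
  then show ?case
    using sentropy_comp_T1[OF simple_function_comp_T[OF f, of n]]
    by (simp add: funpow_swap1)
qed simp

lemma simple_function_itin:
  assumes "simple_function M f"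
  shows "simple_function M (itin T f n)"
proof (induction n)
  case (Suc n)
  have "simple_function M (\<lambda>x. (\<lambda>(l, a). l @ [a]) (itin T f n x, f ((T ^^ n) x)))"
    by (intro simple_function_compose1[where g = "\<lambda>(l, a). l @ [a]"] simple_function_Pair Suc
        simple_function_comp_T assms)
  then show ?case by (simp add: itin_Suc[abs_def])
qed (simp add: itin_def[abs_def])

text \<open>The orbit is cut at time \<open>m\<close>; by invariance the second block is distributed
  like one that starts at time 0.\<close>

lemma sentropy_itin_add:
  assumes f: "simple_function M f"
  shows "sentropy M (itin T f (m + n)) \<le> sentropy M (itin T f m) + sentropy M (itin T f n)"
proof -
  have "sentropy M (itin T f (m + n)) \<le> sentropy M (\<lambda>x. (itin T f m x, itin T f n ((T ^^ m) x)))"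
    by (intro sentropy_mono simple_function_Pair simple_function_itin simple_function_comp_T f)
       (auto simp: itin_add)
  also have "\<dots> \<le> sentropy M (itin T f m) + sentropy M (\<lambda>x. itin T f n ((T ^^ m) x))"
    by (intro sentropy_Pair_le simple_function_itin simple_function_comp_T f)
  also have "sentropy M (\<lambda>x. itin T f n ((T ^^ m) x)) = sentropy M (itin T f n)"
    by (intro sentropy_comp_T simple_function_itin f)
  finally show ?thesis .
qed

lemma sentropy_itin_0: "sentropy M (itin T f 0) = 0"
proof -
  have "itin T f 0 ` space M = {[]}" using not_empty by (auto simp: itin_def)
  moreover have "itin T f 0 -` {[]} \<inter> space M = space M" by (auto simp: itin_def)
  ultimately show ?thesis by (simp add: sentropy_def prob_space)
qed

lemma sentropy_itin_1:
  assumes f: "simple_function M f"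
  shows "sentropy M (itin T f 1) \<le> sentropy M f"
  by (intro sentropy_mono simple_function_itin f) (simp add: itin_def)

lemma sentropy_itin_le:
  assumes f: "simple_function M f"
  shows "sentropy M (itin T f n) \<le> n * sentropy M f"
proof (induction n)
  case (Suc n)
  then show ?case
    using sentropy_itin_add[OF f, of n 1] sentropy_itin_1[OF f] by (simp add: algebra_simps)
qed (simp add: sentropy_itin_0)

text \<open>If \<open>f\<close> can be recovered from \<open>g\<close> and \<open>e\<close>, the cost of coding
  an orbit segment of \<open>f\<close> is that of \<open>g\<close> plus \<open>sentropy M e\<close> per step.\<close>
lemma sentropy_itin_determined:
  assumes f: "simple_function M f" and g: "simple_function M g" and e: "simple_function M e"
    and det: "\<And>x y. \<lbrakk>x \<in> space M; y \<in> space M; g x = g y; e x = e y\<rbrakk> \<Longrightarrow> f x = f y"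
  shows "sentropy M (itin T f n) \<le> sentropy M (itin T g n) + n * sentropy M e"
proof -
  have "sentropy M (itin T f n) \<le> sentropy M (\<lambda>x. (itin T g n x, itin T e n x))"
  proof (intro sentropy_mono simple_function_Pair simple_function_itin f g e)
    fix x y assume "x \<in> space M" "y \<in> space M" "(itin T g n x, itin T e n x) = (itin T g n y, itin T e n y)"
    then show "itin T f n x = itin T f n y"
      by (auto simp: itin_eq_iff intro!: det T_pow_space)
  qed
  also have "\<dots> \<le> sentropy M (itin T g n) + sentropy M (itin T e n)"
    by (intro sentropy_Pair_le simple_function_itin g e)
  also have "sentropy M (itin T e n) \<le> n * sentropy M e"
    by (rule sentropy_itin_le[OF e])
  finally show ?thesis by simp
qed

end

text \<open>Fekete's lemma. The limit is the infimum of \<open>a n / n\<close>; this is kept as a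
  second conclusion, since the equality case of the entropy bound needs the estimate at every single
  \<open>n\<close>.\<close>

lemma subadditive_div_tendsto:
  fixes a :: "nat \<Rightarrow> real"
  assumes sub: "\<And>m n. a (m + n) \<le> a m + a n" and nonneg: "\<And>n. a n \<ge> 0"
  obtains L where "(\<lambda>n. a n / n) \<longlonglongrightarrow> L" "\<And>n. n > 0 \<Longrightarrow> L \<le> a n / n"
proof -
  define L where "L = (INF n\<in>{1..}. a n / real n)"
  have bdd: "bdd_below ((\<lambda>n. a n / real n) ` {1..})"
    by (rule bdd_belowI[of _ 0]) (auto simp: nonneg)
  have lower: "L \<le> a n / n" if "n > 0" for n
    unfolding L_def by (rule cINF_lower[OF bdd]) (use that in auto)
  have mult: "a (q * m) \<le> q * a m + a 0" for q m
  proof (induction q)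
    case (Suc q)
    have "a (Suc q * m) \<le> a m + a (q * m)" using sub[of m "q * m"] by simp
    then show ?case using Suc by (simp add: algebra_simps)
  qed simp
  have "(\<lambda>n. a n / n) \<longlonglongrightarrow> L"
  proof (rule LIMSEQ_I)
    fix e :: real assume e: "e > 0"
    obtain m where m: "m \<ge> 1" "a m / m < L + e / 2"
    proof -
      have "L < L + e / 2" using e by simp
      then show ?thesis
        using cINF_less_iff[of "{1..}" "\<lambda>n. a n / real n" "L + e / 2"] bdd that
        unfolding L_def by auto
    qed
    \<comment> \<open>\<open>B\<close> bounds the remainder block of length \<open>n mod m\<close>
      together with the \<open>a 0\<close> left over in \<open>mult\<close> from
      \<open>q = 0\<close>. It is negligible against \<open>n\<close> once
      \<open>n > B / (e/2)\<close>.\<close>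
    define B where "B = Max (a ` {..<m}) + a 0"
    have B: "a r + a 0 \<le> B" if "r < m" for r
      using that by (auto simp: B_def intro!: Max_ge)
    obtain n0 :: nat where n0: "B / (e / 2) < n0" using reals_Archimedean2 by blast
    have "norm (a n / n - L) < e" if n: "n \<ge> max 1 n0" for n
    proof -
      have "B / (e / 2) < n" using n n0 by linarith
      then have Bn: "B < e / 2 * n" using e by (simp add: field_simps)
      have "a n \<le> a (n div m * m) + a (n mod m)"
        using sub[of "n div m * m" "n mod m"] by simp
      also have "\<dots> \<le> (n div m) * a m + B"
        using mult[of "n div m" m] B[of "n mod m"] m by simp
      also have "(n div m) * a m = (n div m * m) * (a m / m)"
        using m by simp
      also have "\<dots> \<le> n * (a m / m)"
      proof (rule mult_right_mono)
        show "real (n div m * m) \<le> real n" by (simp only: of_nat_le_iff) (metis div_times_less_eq_dividend)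
      qed (use nonneg in auto)
      also have "n * (a m / m) + B < n * (L + e / 2) + e / 2 * n"
        using m Bn n by (intro add_le_less_mono mult_left_mono) auto
      finally have "a n < (L + e) * n" by (simp add: algebra_simps)
      then have "a n / n < L + e" using n by (simp add: field_simps)
      moreover have "L \<le> a n / n" using n by (intro lower) auto
      ultimately show ?thesis by (simp add: abs_if)
    qed
    then show "\<exists>n0. \<forall>n\<ge>n0. norm (a n / n - L) < e" by blast
  qed
  then show ?thesis using lower that by blast
qed

section \<open>Approximation by finite observations\<close>

text \<open>The unions of level sets of \<open>g\<close>, that is, the algebra generated by
  \<open>g\<close> when \<open>g\<close> takes finitely many values.\<close>

definition saturated :: "'a measure \<Rightarrow> ('a \<Rightarrow> 'b) \<Rightarrow> 'a set set" where
  "saturated M g = {C. C \<subseteq> space M \<and> (\<forall>x\<in>space M. \<forall>y\<in>space M. g x = g y \<longrightarrow> (x \<in> C \<longleftrightarrow> y \<in> C))}"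

text \<open>The closure of all these algebras, as \<open>m\<close> varies, for the distance given by
  the measure of the symmetric difference.\<close>

definition approximable :: "'a measure \<Rightarrow> (nat \<Rightarrow> 'a \<Rightarrow> 'b) \<Rightarrow> 'a set set" where
  "approximable M g = {A \<in> sets M. \<forall>e>0. \<exists>m. \<exists>C\<in>saturated M (g m). measure M ((A - C) \<union> (C - A)) < e}"

lemma saturated_sets:
  assumes g: "simple_function M g" and C: "C \<in> saturated M g"
  shows "C \<in> sets M"
proof -
  have "C = (\<Union>v\<in>g ` C. g -` {v} \<inter> space M)"
    using C by (auto simp: saturated_def)
  moreover have "(\<Union>v\<in>g ` C. g -` {v} \<inter> space M) \<in> sets M"
  proof (rule sets.finite_UN)
    have "g ` C \<subseteq> g ` space M" using C by (auto simp: saturated_def)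
    then show "finite (g ` C)" using g by (auto simp: simple_function_def intro: finite_subset)
  qed (use simple_functionD[OF g] in auto)
  ultimately show ?thesis by simp
qed

lemma saturated_Un: "C \<in> saturated M g \<Longrightarrow> D \<in> saturated M g \<Longrightarrow> C \<union> D \<in> saturated M g"
  unfolding saturated_def by blast

lemma saturated_Compl: "C \<in> saturated M g \<Longrightarrow> space M - C \<in> saturated M g"
  unfolding saturated_def by blast

text \<open>The bound \<open>ln x \<le> x\<close> at \<open>x = 1/sqrt p\<close>, doubled. It gives
  an explicit rate at which \<open>- p ln p\<close> tends to 0 with \<open>p\<close>.\<close>

lemma neg_mult_ln_le_sqrt:
  assumes "p \<ge> (0::real)"
  shows "- (p * ln p) \<le> 2 * sqrt p"
proof (cases "p = 0")
  case False
  then have p: "p > 0" using assms by simp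
  then have "ln (1 / sqrt p) \<le> 1 / sqrt p" using ln_bound[of "1 / sqrt p"] by simp
  then have "- ln p \<le> 2 / sqrt p"
    using p by (simp add: ln_div ln_sqrt)
  then have "p * - ln p \<le> p * (2 / sqrt p)"
    using p by (intro mult_left_mono) auto
  also have "p * (2 / sqrt p) = 2 * sqrt p"
    using real_div_sqrt[of p] p by (metis times_divide_eq_right mult.commute order_less_imp_le)
  finally show ?thesis by simp
qed simp

text \<open>The observable reports \<open>f\<close> on the rare event \<open>bad\<close> and is
  silent elsewhere. Each reported value costs at most \<open>2 sqrt p \<le> 2 t\<close>, which is
  why \<open>bad\<close> is measured by \<open>t\<^sup>2\<close>; silence has probability close to 1
  and costs at most \<open>1 - p \<le> t\<^sup>2 \<le> t\<close>.\<close>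

lemma (in prob_space) sentropy_rare:
  assumes f: "simple_function M f" and bad: "bad \<in> sets M" "prob bad \<le> t\<^sup>2" "0 \<le> t" "t \<le> 1"
  shows "sentropy M (\<lambda>x. if x \<in> bad then Some (f x) else None) \<le> t * (1 + 2 * card (f ` space M))"
    (is "sentropy M ?e \<le> _")
proof -
  define p where "p v = prob (?e -` {v} \<inter> space M)" for v
  let ?R = "Some ` f ` space M"
  have fin: "finite (f ` space M)" using f by (simp add: simple_function_def)
  have terms: "- (p v * ln (p v)) \<ge> 0" for v
    by (cases "p v = 0") (auto simp: p_def mult_le_0_iff zero_less_measure_iff)
  have "sentropy M ?e = (\<Sum>v\<in>?e ` space M. - (p v * ln (p v)))"
    by (simp add: sentropy_def p_def sum_negf)
  also have "\<dots> \<le> (\<Sum>v\<in>insert None ?R. - (p v * ln (p v)))"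
    by (rule sum_mono2) (use fin terms in auto)
  also have "\<dots> = - (p None * ln (p None)) + (\<Sum>v\<in>?R. - (p v * ln (p v)))"
    using fin by (subst sum.insert) auto
  also have "- (p None * ln (p None)) \<le> t"
  proof -
    have "?e -` {None} \<inter> space M = space M - bad" by (auto split: if_splits)
    then have pN: "p None = 1 - prob bad" unfolding p_def using prob_compl[OF bad(1)] by simp
    have "- (p None * ln (p None)) \<le> 1 - p None"
    proof (cases "p None = 0")
      case False
      then have "p None > 0" by (simp add: p_def zero_less_measure_iff)
      then have "ln (1 / p None) \<le> 1 / p None - 1" by (intro ln_le_minus_one) simp
      then have "- ln (p None) \<le> 1 / p None - 1" using \<open>p None > 0\<close> by (simp add: ln_div)
      then have "p None * - ln (p None) \<le> p None * (1 / p None - 1)"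
        using \<open>p None > 0\<close> by (intro mult_left_mono) auto
      then show ?thesis using \<open>p None > 0\<close> by (simp add: algebra_simps)
    qed simp
    also have "\<dots> \<le> t\<^sup>2" using pN bad by simp
    also have "\<dots> \<le> t" using bad by (simp add: power2_eq_square mult_left_le)
    finally show ?thesis .
  qed
  also have "(\<Sum>v\<in>?R. - (p v * ln (p v))) \<le> (\<Sum>v\<in>?R. 2 * t)"
  proof (rule sum_mono)
    fix v assume "v \<in> ?R"
    then have "p v \<le> prob bad"
      unfolding p_def by (intro finite_measure_mono) (use bad in \<open>auto split: if_splits\<close>)
    then have "sqrt (p v) \<le> t" using bad by (intro real_le_lsqrt) auto
    then show "- (p v * ln (p v)) \<le> 2 * t"
      using neg_mult_ln_le_sqrt[of "p v"] by (simp add: p_def)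
  qed
  also have "(\<Sum>v\<in>?R. 2 * t) = 2 * t * card (f ` space M)"
    using card_image[of Some "f ` space M"] by simp
  finally show ?thesis by (simp add: algebra_simps)
qed

locale observation = prob_space M for M :: "'a measure" +
  fixes g :: "nat \<Rightarrow> 'a \<Rightarrow> 'b"
  assumes sf_g: "simple_function M (g m)"
    and finer: "\<lbrakk>m \<le> n; x \<in> space M; y \<in> space M; g n x = g n y\<rbrakk> \<Longrightarrow> g m x = g m y"
begin

lemma saturated_mono: "m \<le> n \<Longrightarrow> saturated M (g m) \<subseteq> saturated M (g n)"
  unfolding saturated_def using finer by blast

lemma saturated_approximable:
  assumes "C \<in> saturated M (g m)"
  shows "C \<in> approximable M g"
  using assms saturated_sets[OF sf_g assms]
  by (auto simp: approximable_def intro!: exI[of _ m] bexI[of _ C])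

lemma approximableE:
  assumes "A \<in> approximable M g" "e > 0"
  obtains m C where "C \<in> saturated M (g m)" "prob ((A - C) \<union> (C - A)) < e"
  using assms unfolding approximable_def by blast

lemma approximable_Un:
  assumes A: "A \<in> approximable M g" and B: "B \<in> approximable M g"
  shows "A \<union> B \<in> approximable M g"
  unfolding approximable_def
proof safe
  have meas: "A \<in> sets M" "B \<in> sets M" using A B by (auto simp: approximable_def)
  then show "A \<union> B \<in> sets M" by simp
  fix e :: real assume "e > 0"
  then have e2: "e / 2 > 0" by simp
  obtain m C where C: "C \<in> saturated M (g m)" "prob ((A - C) \<union> (C - A)) < e / 2"
    using approximableE[OF A e2] .
  obtain n D where D: "D \<in> saturated M (g n)" "prob ((B - D) \<union> (D - B)) < e / 2"
    using approximableE[OF B e2] .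
  have CD: "C \<union> D \<in> saturated M (g (max m n))"
    by (rule saturated_Un) (use C D saturated_mono[of m "max m n"] saturated_mono[of n "max m n"] in auto)
  have sets: "C \<in> sets M" "D \<in> sets M" using C D saturated_sets[OF sf_g] by auto
  have "prob ((A \<union> B - (C \<union> D)) \<union> (C \<union> D - (A \<union> B))) \<le>
      prob (((A - C) \<union> (C - A)) \<union> ((B - D) \<union> (D - B)))"
    by (rule finite_measure_mono) (use meas sets in auto)
  also have "\<dots> \<le> prob ((A - C) \<union> (C - A)) + prob ((B - D) \<union> (D - B))"
    by (rule measure_Un_le) (use meas sets in auto)
  also have "\<dots> < e" using C D by simp
  finally show "\<exists>m. \<exists>E\<in>saturated M (g m). prob ((A \<union> B - E) \<union> (E - (A \<union> B))) < e"
    using CD by blast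
qed

lemma approximable_UN_lessThan:
  "(\<And>i. A i \<in> approximable M g) \<Longrightarrow> (\<Union>i<n. A i) \<in> approximable M g" for n :: nat
proof (induction n)
  case 0
  have "{} \<in> saturated M (g 0)" by (simp add: saturated_def)
  then show ?case using saturated_approximable by auto
next
  case (Suc n)
  then show ?case using approximable_Un[of "\<Union>i<n. A i" "A n"] by (simp add: lessThan_Suc Un_commute)
qed

text \<open>For countable unions, continuity from below replaces the union by a finite one up to
  \<open>e/2\<close>, and finitely many approximating sets share a common level \<open>m\<close>.
  Hence everything measurable with respect to the whole sequence of observations is approximable by
  finitely many of them.\<close>

lemma sigma_algebra_approximable: "sigma_algebra (space M) (approximable M g)"
  unfolding sigma_algebra_iff2
proof (intro conjI ballI allI impI)
  show "approximable M g \<subseteq> Pow (space M)"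
    using sets.sets_into_space by (auto simp: approximable_def)
  show "{} \<in> approximable M g"
    using approximable_UN_lessThan[of "\<lambda>_. {}" 0] saturated_approximable[of "{}" 0] by (simp add: saturated_def)
next
  fix A assume A: "A \<in> approximable M g"
  show "space M - A \<in> approximable M g"
    unfolding approximable_def
  proof safe
    show "space M - A \<in> sets M" using A by (auto simp: approximable_def)
    fix e :: real assume "e > 0"
    then obtain m C where C: "C \<in> saturated M (g m)" "prob ((A - C) \<union> (C - A)) < e"
      using approximableE[OF A] by blast
    have "A \<subseteq> space M" using A sets.sets_into_space by (auto simp: approximable_def)
    moreover have "C \<subseteq> space M" using C by (simp add: saturated_def)
    ultimately have "(space M - A - (space M - C)) \<union> (space M - C - (space M - A)) = (A - C) \<union> (C - A)"
      by blast
    then have "prob ((space M - A - (space M - C)) \<union> (space M - C - (space M - A))) < e"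
      using C(2) by simp
    then show "\<exists>m. \<exists>E\<in>saturated M (g m). prob ((space M - A - E) \<union> (E - (space M - A))) < e"
      using saturated_Compl[OF C(1)] by blast
  qed
next
  fix A :: "nat \<Rightarrow> 'a set" assume A: "range A \<subseteq> approximable M g"
  then have meas [measurable]: "A i \<in> sets M" for i by (auto simp: approximable_def)
  show "(\<Union>i. A i) \<in> approximable M g"
    unfolding approximable_def
  proof safe
    show "(\<Union>i. A i) \<in> sets M" by simp
    fix e :: real assume e: "e > 0"
    have "(\<lambda>n. prob (\<Union>i<n. A i)) \<longlonglongrightarrow> prob (\<Union>n. \<Union>i<n. A i)"
      by (rule finite_Lim_measure_incseq) (force simp: incseq_def intro: order_less_le_trans)+
    moreover have "(\<Union>n. \<Union>i<n. A i) = (\<Union>i. A i)" by auto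
    ultimately have "\<forall>\<^sub>F n in sequentially. dist (prob (\<Union>i<n. A i)) (prob (\<Union>i. A i)) < e / 2"
      using e by (auto dest: tendstoD[where e = "e / 2"])
    then obtain n where n: "dist (prob (\<Union>i<n. A i)) (prob (\<Union>i. A i)) < e / 2"
      by (auto simp: eventually_sequentially)
    let ?B = "\<Union>i<n. A i"
    have "?B \<in> approximable M g" using A by (intro approximable_UN_lessThan) auto
    then obtain m C where C: "C \<in> saturated M (g m)" "prob ((?B - C) \<union> (C - ?B)) < e / 2"
      by (rule approximableE[of ?B "e / 2"]) (use e in auto)
    have [measurable]: "C \<in> sets M" using C saturated_sets[OF sf_g] by auto
    have "prob (((\<Union>i. A i) - C) \<union> (C - (\<Union>i. A i))) \<le> prob (((\<Union>i. A i) - ?B) \<union> ((?B - C) \<union> (C - ?B)))"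
      by (rule finite_measure_mono) auto
    also have "\<dots> \<le> prob ((\<Union>i. A i) - ?B) + prob ((?B - C) \<union> (C - ?B))"
      by (rule measure_Un_le) auto
    also have "prob ((\<Union>i. A i) - ?B) = prob (\<Union>i. A i) - prob ?B"
      by (rule finite_measure_Diff) auto
    also have "\<dots> < e / 2" using n abs_ge_minus_self[of "prob ?B - prob (\<Union>i. A i)"]
      unfolding dist_real_def by linarith
    finally have "prob (((\<Union>i. A i) - C) \<union> (C - (\<Union>i. A i))) < e" using C(2) by simp
    then show "\<exists>m. \<exists>E\<in>saturated M (g m). prob (((\<Union>i. A i) - E) \<union> (E - (\<Union>i. A i))) < e"
      using C(1) by blast
  qed
qed

text \<open>Each level set of \<open>f\<close> is replaced by a set that \<open>g m\<close> decides.
  Where the replacement errs, which is rare, the correction \<open>e\<close> transmits the value of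
  \<open>f\<close> itself; elsewhere \<open>e\<close> is \<open>None\<close> and \<open>g m\<close>
  suffices.\<close>

lemma approximable_code:
  assumes f: "simple_function M f"
    and appr: "\<And>v. v \<in> f ` space M \<Longrightarrow> f -` {v} \<inter> space M \<in> approximable M g"
    and eps: "eps > 0"
  obtains m and e :: "'a \<Rightarrow> 'c option" where "simple_function M e" "sentropy M e \<le> eps"
    "\<And>x y. \<lbrakk>x \<in> space M; y \<in> space M; g m x = g m y; e x = e y\<rbrakk> \<Longrightarrow> f x = (f y :: 'c)"
proof -
  let ?R = "f ` space M"
  have fin: "finite ?R" using f by (simp add: simple_function_def)
  have ne: "?R \<noteq> {}" using not_empty by simp
  define N where "N = real (card ?R)"
  have N: "N > 0" using fin ne by (simp add: N_def card_gt_0_iff)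
  \<comment> \<open>Makes the cost \<open>t * (1 + 2 * N)\<close> from \<open>sentropy_rare\<close>
    at most \<open>eps\<close>. Each of the \<open>N\<close> level sets may then contribute an error
    of \<open>t\<^sup>2 / N\<close>.\<close>
  define t where "t = min 1 (eps / (1 + 2 * N))"
  have t: "0 < t" "t \<le> 1" using eps N by (auto simp: t_def)
  have teps: "t * (1 + 2 * N) \<le> eps"
  proof -
    have "t \<le> eps / (1 + 2 * N)" by (simp add: t_def)
    then show ?thesis using N by (simp add: pos_le_divide_eq)
  qed
  have "\<exists>m. \<exists>C\<in>saturated M (g m). prob ((f -` {v} \<inter> space M - C) \<union> (C - f -` {v} \<inter> space M)) < t\<^sup>2 / N"
    if "v \<in> ?R" for v
    using appr[OF that] t N unfolding approximable_def by simp
  then obtain mm CC where C: "\<And>v. v \<in> ?R \<Longrightarrow> CC v \<in> saturated M (g (mm v))"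
    "\<And>v. v \<in> ?R \<Longrightarrow> prob ((f -` {v} \<inter> space M - CC v) \<union> (CC v - f -` {v} \<inter> space M)) < t\<^sup>2 / N"
    by metis
  define m where "m = Max (mm ` ?R)"
  have Cm: "CC v \<in> saturated M (g m)" if "v \<in> ?R" for v
    using C(1)[OF that] saturated_mono[of "mm v" m] that fin by (auto simp: m_def)
  define bad where "bad = (\<Union>v\<in>?R. (f -` {v} \<inter> space M - CC v) \<union> (CC v - f -` {v} \<inter> space M))"
  have fv: "f -` {v} \<inter> space M \<in> sets M" for v by (rule simple_functionD[OF f])
  have sd: "(f -` {v} \<inter> space M - CC v) \<union> (CC v - f -` {v} \<inter> space M) \<in> sets M" if "v \<in> ?R" for v
    using fv saturated_sets[OF sf_g Cm[OF that]] by auto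
  have bad_meas: "bad \<in> sets M"
    unfolding bad_def by (rule sets.finite_UN) (use fin sd in auto)
  have "prob bad \<le> (\<Sum>v\<in>?R. prob ((f -` {v} \<inter> space M - CC v) \<union> (CC v - f -` {v} \<inter> space M)))"
    unfolding bad_def by (rule finite_measure_subadditive_finite) (use fin sd in auto)
  also have "\<dots> \<le> (\<Sum>v\<in>?R. t\<^sup>2 / N)"
    by (rule sum_mono) (use C(2) in \<open>simp add: less_imp_le\<close>)
  also have "\<dots> = t\<^sup>2" using N by (simp add: N_def)
  finally have bad_small: "prob bad \<le> t\<^sup>2" .
  define e where "e x = (if x \<in> bad then Some (f x) else None)" for x
  have "simple_function M e"
  proof -
    have "simple_function M (\<lambda>x. Some (f x))"
      using simple_function_compose1[OF f, of Some] by simp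
    moreover have "bad = bad \<inter> space M" using sets.sets_into_space[OF bad_meas] by auto
    ultimately show ?thesis
      unfolding e_def[abs_def] using bad_meas by (intro simple_function_If_set) auto
  qed
  moreover have "sentropy M e \<le> eps"
    using sentropy_rare[OF f bad_meas bad_small] t teps
    by (simp add: e_def[abs_def] N_def)
  moreover have "f x = f y" if xy: "x \<in> space M" "y \<in> space M" "g m x = g m y" "e x = e y" for x y
  proof (cases "x \<in> bad")
    case True
    then show ?thesis using xy(4) by (auto simp: e_def split: if_splits)
  next
    case False
    then have "y \<notin> bad" using xy(4) by (auto simp: e_def split: if_splits)
    have fx: "f x \<in> ?R" using xy(1) by blast
    have "x \<in> CC (f x)" using False xy(1) fx unfolding bad_def by blast
    then have "y \<in> CC (f x)" using Cm[OF fx] xy(1-3) unfolding saturated_def by blast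
    then have "y \<in> f -` {f x}" using \<open>y \<notin> bad\<close> fx unfolding bad_def by blast
    then show ?thesis by simp
  qed
  ultimately show thesis using that by blast
qed

end

section \<open>Entropy rate and Kolmogorov-Sinai entropy\<close>

context measure_preserving_system
begin

definition entropy_rate :: "('a \<Rightarrow> 'b) \<Rightarrow> real" where
  "entropy_rate f = lim (\<lambda>n. sentropy M (itin T f n) / n)"

lemma entropy_rate:
  assumes "simple_function M f"
  shows "(\<lambda>n. sentropy M (itin T f n) / n) \<longlonglongrightarrow> entropy_rate f"
    and "n > 0 \<Longrightarrow> entropy_rate f \<le> sentropy M (itin T f n) / n"
proof -
  obtain L where L: "(\<lambda>n. sentropy M (itin T f n) / n) \<longlonglongrightarrow> L"
      "\<And>n. n > 0 \<Longrightarrow> L \<le> sentropy M (itin T f n) / n"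
    using subadditive_div_tendsto[of "\<lambda>n. sentropy M (itin T f n)"]
      sentropy_itin_add[OF assms] sentropy_nonneg[OF simple_function_itin[OF assms]]
    by blast
  have "entropy_rate f = L" unfolding entropy_rate_def by (rule limI[OF L(1)])
  then show "(\<lambda>n. sentropy M (itin T f n) / n) \<longlonglongrightarrow> entropy_rate f"
    and "n > 0 \<Longrightarrow> entropy_rate f \<le> sentropy M (itin T f n) / n"
    using L by auto
qed

text \<open>Only costs linear in \<open>n\<close> survive division by \<open>n\<close>; the constant
  \<open>c\<close> may depend on \<open>e\<close>, and \<open>e\<close> is arbitrary.\<close>

lemma entropy_rate_le:
  assumes f: "simple_function M f" and d: "simple_function M d"
    and le: "\<And>e :: real. e > 0 \<Longrightarrow> \<exists>c. \<forall>n. sentropy M (itin T f n) \<le> sentropy M (itin T d n) + real n * e + c"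
  shows "entropy_rate f \<le> entropy_rate d"
proof (rule field_le_epsilon)
  fix e :: real assume "e > 0"
  from le[OF this] obtain c where
    c: "\<And>n. sentropy M (itin T f n) \<le> sentropy M (itin T d n) + real n * e + c" by blast
  show "entropy_rate f \<le> entropy_rate d + e"
  proof (rule LIMSEQ_le[OF entropy_rate(1)[OF f]])
    have "(\<lambda>n. sentropy M (itin T d n) / n + e + c / n) \<longlonglongrightarrow> entropy_rate d + e + 0"
      by (intro tendsto_add entropy_rate(1)[OF d] tendsto_const lim_const_over_n)
    then show "(\<lambda>n. sentropy M (itin T d n) / n + e + c / n) \<longlonglongrightarrow> entropy_rate d + e" by simp
    show "\<exists>N. \<forall>n\<ge>N. sentropy M (itin T f n) / n \<le> sentropy M (itin T d n) / n + e + c / n"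
    proof (intro exI[of _ 1] allI impI)
      fix n :: nat assume "n \<ge> 1"
      then have "sentropy M (itin T f n) / n \<le> (sentropy M (itin T d n) + n * e + c) / n"
        using c[of n] by (intro divide_right_mono) auto
      then show "sentropy M (itin T f n) / n \<le> sentropy M (itin T d n) / n + e + c / n"
        using \<open>n \<ge> 1\<close> by (simp add: add_divide_distrib)
    qed
  qed
qed

text \<open>Passes between partitions and observables: \<open>label\<close> says that
  \<open>f\<close> names the cells of \<open>P\<close>, so the nonempty cells of the refinement are
  the level sets of the itinerary.\<close>

lemma part_entropy_refine:
  assumes P: "fin_partition M P" and f: "simple_function M f"
    and label: "\<And>x y. x \<in> space M \<Longrightarrow> y \<in> space M \<Longrightarrow> f x = f y \<longleftrightarrow> (\<forall>A\<in>P. x \<in> A \<longleftrightarrow> y \<in> A)"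
  shows "part_entropy M (refine M T P n) = sentropy M (itin T f n)"
proof -
  let ?F = "itin T f n"
  have atom: "y \<in> A \<longleftrightarrow> f y = f x" if "A \<in> P" "x \<in> A" "y \<in> space M" for A x y
  proof
    have x: "x \<in> space M" using that P by (auto simp: fin_partition_def)
    show "y \<in> A" if "f y = f x" using label[OF x \<open>y \<in> space M\<close>] that \<open>A \<in> P\<close> \<open>x \<in> A\<close> by auto
    assume "y \<in> A"
    then have "x \<in> B \<longleftrightarrow> y \<in> B" if "B \<in> P" for B
      using P \<open>A \<in> P\<close> \<open>x \<in> A\<close> that by (auto simp: fin_partition_def disjoint_def)
    then show "f y = f x" using label[OF x \<open>y \<in> space M\<close>] by auto
  qed
  have cyl: "space M \<inter> (\<Inter>i<n. (T ^^ i) -` a i) = ?F -` {?F x} \<inter> space M"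
    if "x \<in> space M" "\<And>i. i < n \<Longrightarrow> a i \<in> P \<and> (T ^^ i) x \<in> a i" for x a
  proof -
    have "y \<in> space M \<Longrightarrow> (\<forall>i<n. (T ^^ i) y \<in> a i) \<longleftrightarrow> ?F y = ?F x" for y
      unfolding itin_eq_iff using that atom T_pow_space by metis
    then show ?thesis by auto
  qed
  \<comment> \<open>Incompatible choices of cells put the empty set into \<open>refine\<close>; its
    term \<open>0 * ln 0\<close> is 0.\<close>
  have eq: "refine M T P n - {{}} = (\<lambda>v. ?F -` {v} \<inter> space M) ` (?F ` space M)"
  proof (intro equalityI subsetI)
    fix B assume "B \<in> refine M T P n - {{}}"
    then obtain a x where a: "B = space M \<inter> (\<Inter>i<n. (T ^^ i) -` a i)" "\<forall>i<n. a i \<in> P" "x \<in> B"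
      by (auto simp: refine_def)
    then have "B = ?F -` {?F x} \<inter> space M" using cyl[of x a] by auto
    then show "B \<in> (\<lambda>v. ?F -` {v} \<inter> space M) ` (?F ` space M)" using a by blast
  next
    fix B assume "B \<in> (\<lambda>v. ?F -` {v} \<inter> space M) ` (?F ` space M)"
    then obtain x where x: "x \<in> space M" and B: "B = ?F -` {?F x} \<inter> space M" by auto
    have "\<exists>A\<in>P. (T ^^ i) x \<in> A" for i
      using P T_pow_space[OF x, of i] by (auto simp: fin_partition_def)
    then obtain a where "\<And>i. a i \<in> P \<and> (T ^^ i) x \<in> a i" by metis
    note a = this
    have "B = space M \<inter> (\<Inter>i<n. (T ^^ i) -` a i)"
      unfolding B by (rule cyl[OF x, symmetric]) (simp add: a)
    moreover have "\<forall>i<n. a i \<in> P" by (simp add: a)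
    ultimately have "B \<in> refine M T P n"
      unfolding refine_def mem_Collect_eq by (intro exI[of _ a] conjI)
    then show "B \<in> refine M T P n - {{}}" using x B by blast
  qed
  have fin: "finite (?F ` space M)"
    using simple_function_itin[OF f] by (simp add: simple_function_def)
  have "part_entropy M (refine M T P n) = part_entropy M (refine M T P n - {{}})"
  proof -
    have "finite (refine M T P n)" using fin eq by (metis finite_Diff_insert finite.emptyI finite_imageI finite_Diff2)
    then show ?thesis
      unfolding part_entropy_def by (subst sum.mono_neutral_right[of _ "refine M T P n - {{}}"]) auto
  qed
  also have "\<dots> = sentropy M ?F"
  proof -
    have "inj_on (\<lambda>v. ?F -` {v} \<inter> space M) (?F ` space M)"
      by (rule inj_onI) blast
    then show ?thesis
      unfolding eq part_entropy_def sentropy_def by (simp add: sum.reindex)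
  qed
  finally show ?thesis .
qed

text \<open>A partition becomes an observable by labelling a point with the set of cells that
  contain it, which explains the value type \<open>'a set set\<close>.\<close>

lemma ks_entropy_le:
  assumes "\<And>f :: 'a \<Rightarrow> 'a set set. simple_function M f \<Longrightarrow> entropy_rate f \<le> c"
  shows "ks_entropy M T \<le> ereal c"
  unfolding ks_entropy_def
proof (rule SUP_least)
  fix P assume "P \<in> {P. fin_partition M P}"
  then have P: "fin_partition M P" by simp
  define f where "f x = {A\<in>P. x \<in> A}" for x
  have f: "simple_function M f"
    unfolding simple_function_def
  proof safe
    have "f ` space M \<subseteq> Pow P" by (auto simp: f_def)
    then show "finite (f ` space M)" using P by (auto simp: fin_partition_def intro: finite_subset)
    fix x assume "x \<in> space M"
    then obtain A where A: "A \<in> P" "x \<in> A" using P by (auto simp: fin_partition_def)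
    have "f y = {A}" if "y \<in> A" for y
      using P A that by (auto simp: f_def fin_partition_def disjoint_def)
    then have "f -` {f x} \<inter> space M = A"
      using A P by (auto simp: f_def fin_partition_def)
    then show "f -` {f x} \<inter> space M \<in> sets M" using A P by (auto simp: fin_partition_def)
  qed
  have "part_entropy M (refine M T P n) = sentropy M (itin T f n)" for n
    by (rule part_entropy_refine[OF P f]) (auto simp: f_def)
  then show "ereal (lim (\<lambda>n. part_entropy M (refine M T P n) / n)) \<le> ereal c"
    using assms[OF f] by (simp add: entropy_rate_def)
qed

lemma entropy_rate_le_ks_entropy:
  assumes f: "simple_function M f"
  shows "ereal (entropy_rate f) \<le> ks_entropy M T"
proof -
  define P where "P = (\<lambda>v. f -` {v} \<inter> space M) ` (f ` space M)"
  have P: "fin_partition M P"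
    using f by (auto simp: P_def fin_partition_def disjoint_def simple_function_def)
  have "part_entropy M (refine M T P n) = sentropy M (itin T f n)" for n
    by (rule part_entropy_refine[OF P f]) (auto simp: P_def)
  then have "ereal (entropy_rate f) = ereal (lim (\<lambda>n. part_entropy M (refine M T P n) / n))"
    by (simp add: entropy_rate_def)
  also have "\<dots> \<le> ks_entropy M T"
    unfolding ks_entropy_def by (rule SUP_upper) (simp add: P)
  finally show ?thesis .
qed

end

section \<open>Geometry of the fat gasket\<close>

text \<open>The difference quotient is half a sum of three squares, not all zero. Monotonicity makes
  the root unique and turns \<open>\<beta> \<le> beta_star\<close> into an inequality for the
  cubic.\<close>

lemma beta_cubic_mono:
  fixes x y :: real
  assumes "x < y"
  shows "x^3 - 2*x^2 + 2*x < y^3 - 2*y^2 + 2*y"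
proof -
  have "2 * (y^3 - 2*y^2 + 2*y - (x^3 - 2*x^2 + 2*x)) = (y - x) * ((x + y - 2)^2 + x^2 + y^2)"
    by (simp add: power2_eq_square power3_eq_cube algebra_simps)
  moreover have "(x + y - 2)^2 + x^2 + y^2 > 0"
  proof (cases "x = 0")
    case True
    then have "y^2 > 0" using assms by simp
    then show ?thesis by (smt (verit) zero_le_power2)
  next
    case False
    then have "x^2 > 0" by simp
    then show ?thesis by (smt (verit) zero_le_power2)
  qed
  ultimately have "2 * (y^3 - 2*y^2 + 2*y - (x^3 - 2*x^2 + 2*x)) > 0"
    using assms by (simp only: mult_pos_pos diff_gt_0_iff_gt)
  then show ?thesis by (metis diff_gt_0_iff_gt zero_less_mult_pos zero_less_numeral)
qed

lemma beta_star_root: "beta_star^3 - 2*beta_star^2 + 2*beta_star = 2"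
proof -
  have "\<exists>x::real. 1 \<le> x \<and> x \<le> 2 \<and> x^3 - 2*x^2 + 2*x = 2"
    by (rule IVT') (auto intro!: continuous_intros)
  then obtain x :: real where x: "x^3 - 2*x^2 + 2*x = 2" by blast
  have "\<exists>!x::real. x^3 - 2*x^2 + 2*x = 2"
  proof (rule ex1I[where a = x])
    show "x^3 - 2*x^2 + 2*x = 2" by (rule x)
    fix y :: real assume "y^3 - 2*y^2 + 2*y = 2"
    then show "y = x" using x beta_cubic_mono[of x y] beta_cubic_mono[of y x]
      by (cases x y rule: linorder_cases) auto
  qed
  then show ?thesis unfolding beta_star_def by (rule theI')
qed

text \<open>Barycentric coordinates scaled to have sum \<open>1/(\<beta>-1)\<close>. They make the
  three digits interchangeable, and inside the triangle the polygons \<open>Hset\<close>,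
  \<open>Et\<close> and \<open>Ct\<close> become comparisons of coordinates with
  \<open>1/\<beta>\<close>.\<close>

definition bary :: "real \<Rightarrow> nat \<Rightarrow> real \<times> real \<Rightarrow> real" where
  "bary \<beta> k z = (if k = 0 then 1 / (\<beta> - 1) - fst z - snd z else if k = 1 then fst z else snd z)"

abbreviation dig3 :: "nat set" where "dig3 \<equiv> {0, 1, 2}"

definition hole :: "real \<Rightarrow> nat \<Rightarrow> nat \<Rightarrow> (real \<times> real) set" where
  "hole \<beta> i n = (fmap \<beta> i ^^ n) ` Hset \<beta>"

definition triangle :: "real \<Rightarrow> (real \<times> real) set" where
  "triangle \<beta> = {z. \<forall>k\<in>dig3. bary \<beta> k z \<ge> 0}"

text \<open>Only the holes along constant words are removed. The image of
  \<open>hole \<beta> i n\<close> under \<open>fmap \<beta> j\<close> with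
  \<open>j \<noteq> i\<close>, \<open>n \<ge> 1\<close> leaves no gap, since the image of the gasket
  under \<open>fmap \<beta> i\<close> covers it.\<close>

definition gasket :: "real \<Rightarrow> (real \<times> real) set" where
  "gasket \<beta> = triangle \<beta> - (\<Union>i\<in>dig3. \<Union>n. hole \<beta> i n)"

section \<open>Inequalities that follow from the bounds on \<beta>\<close>

locale fat_gasket =
  fixes \<beta> :: real
  assumes beta_gt: "3/2 < \<beta>" and beta_le: "\<beta> \<le> beta_star"
begin

abbreviation "bc \<equiv> bary \<beta>"
abbreviation "f \<equiv> fmap \<beta>"

lemma beta_cubic: "\<beta>^3 - 2*\<beta>^2 + 2*\<beta> \<le> 2"
  using beta_cubic_mono[of \<beta> beta_star] beta_star_root beta_le by (cases "\<beta> = beta_star") auto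

text \<open>The cubic exceeds 2 at 31/20 already; this is a rational substitute for
  \<open>beta_star\<close>, close enough for \<open>height_ge4\<close> and
  \<open>beta_sq_lt\<close>.\<close>

lemma beta_lt: "\<beta> < 31/20"
proof (rule ccontr)
  assume "\<not> \<beta> < 31/20"
  then have "31/20 = \<beta> \<or> 31/20 < \<beta>" by linarith
  then have "(31/20)^3 - 2*(31/20)^2 + 2*(31/20) \<le> \<beta>^3 - 2*\<beta>^2 + 2*\<beta>"
    using beta_cubic_mono[of "31/20" \<beta>] by fastforce
  then show False using beta_cubic by (simp add: power2_eq_square power3_eq_cube)
qed

lemma beta_pos: "\<beta> > 0" "\<beta> > 1" "\<beta> - 1 > 0" "\<beta> \<noteq> 0"
  using beta_gt by auto

text \<open>\<open>1/(\<beta>-1) - 2/\<beta>\<close> is the largest value of the third coordinate on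
  the overlap of two image triangles, and the lower bound for each coordinate on the hole
  \<open>H\<close>. The inequality is the defining cubic after clearing denominators, with equality
  at \<open>beta_star\<close>.\<close>

lemma height_ge: "2 / \<beta>^3 \<le> 1 / (\<beta> - 1) - 2 / \<beta>"
proof -
  have "2 * (\<beta>^2 + 1) * (\<beta> - 1) \<le> \<beta>^3"
    using beta_cubic by (simp add: power2_eq_square power3_eq_cube algebra_simps)
  then have "2 * (\<beta>^2 + 1) / \<beta>^3 \<le> 1 / (\<beta> - 1)"
    using beta_pos by (simp add: pos_divide_le_eq pos_le_divide_eq)
  moreover have "2 * (\<beta>^2 + 1) / \<beta>^3 = 2 / \<beta> + 2 / \<beta>^3"
    using beta_pos by (simp add: field_simps power2_eq_square power3_eq_cube)
  ultimately show ?thesis by simp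
qed

lemma height_ge_sq: "1 / \<beta>^2 \<le> 1 / (\<beta> - 1) - 2 / \<beta>"
proof -
  have "1 / \<beta>^2 \<le> 2 / \<beta>^3"
    using beta_pos beta_lt by (simp add: field_simps power2_eq_square power3_eq_cube)
  then show ?thesis using height_ge by linarith
qed

lemma height_pos: "1 / (\<beta> - 1) - 2 / \<beta> > 0"
proof -
  have "1 / \<beta>^2 > 0" using beta_pos by simp
  then show ?thesis using height_ge_sq by linarith
qed

text \<open>Equivalent to \<open>\<beta> > 3/2\<close>: three coordinates
  \<open>\<ge> 1/\<beta>\<close> would exceed the total \<open>1/(\<beta>-1)\<close>.\<close>

lemma side_lt: "1 / (\<beta> - 1) < 3 / \<beta>"
  using beta_gt by (simp add: field_simps)

lemma beta_sq_lt: "\<beta>^2 < 3"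
proof -
  have "\<beta> * \<beta> < (31/20) * (31/20)" using beta_lt beta_pos by (intro mult_strict_mono) auto
  then show ?thesis by (simp add: power2_eq_square)
qed

lemma height_ge4: "3 / \<beta>^4 \<le> 1 / (\<beta> - 1) - 2 / \<beta>"
proof -
  have "3 * (\<beta> - 1) \<le> (2 - \<beta>) * \<beta>^3"
  proof -
    \<comment> \<open>With \<open>\<beta> = 3/2 + t\<close> the cube is
      \<open>27/8 + 27/4 t + 9/2 t\<^sup>2 + t\<^sup>3\<close>. Dropping the last two terms turns
      the product into \<open>27/16 - 27/4 t\<^sup>2\<close>, and \<open>t \<le> 1/20\<close> leaves
      enough room.\<close>
    define t where "t = \<beta> - 3/2"
    have t: "0 \<le> t" "t \<le> 1/20" and b: "\<beta> = 3/2 + t"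
      using beta_gt beta_lt by (auto simp: t_def)
    have tt: "t * t \<le> t * (1/20)" using t by (intro mult_left_mono) auto
    have "(1/2 - t) * (27/8 + 27/4 * t) \<le> (1/2 - t) * (27/8 + 27/4 * t + (9/2 * t^2 + t^3))"
      using t by (intro mult_left_mono) auto
    also have "\<dots> = (2 - \<beta>) * \<beta>^3"
      unfolding b by (simp add: power2_eq_square power3_eq_cube field_simps)
    also have "(1/2 - t) * (27/8 + 27/4 * t) = 27/16 - 27/4 * (t * t)"
      by (simp add: field_simps)
    finally have "27/16 - 27/4 * (t * t) \<le> (2 - \<beta>) * \<beta>^3" .
    then show ?thesis using tt t unfolding b by simp
  qed
  then have "3 / \<beta>^3 \<le> (2 - \<beta>) / (\<beta> - 1)"
    using beta_pos by (simp add: pos_divide_le_eq pos_le_divide_eq)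
  then have "3 / \<beta>^3 / \<beta> \<le> (2 - \<beta>) / (\<beta> - 1) / \<beta>"
    using beta_pos by (intro divide_right_mono) auto
  also have "(2 - \<beta>) / (\<beta> - 1) / \<beta> = 1 / (\<beta> - 1) - 2 / \<beta>"
    using beta_pos by (simp add: field_simps)
  finally show ?thesis by (simp add: power_Suc2[symmetric] eval_nat_numeral)
qed

section \<open>The three maps and the holes in barycentric coordinates\<close>

lemma bary_fmap:
  assumes "i \<in> dig3" "k \<in> dig3"
  shows "bc k (f i z) = (if k = i then (bc k z + 1) / \<beta> else bc k z / \<beta>)"
  using assms beta_pos by (auto simp: bary_def fmap_def qv_def field_simps)

lemma third:
  assumes "i \<in> dig3" "j \<in> dig3" "i \<noteq> j"
  obtains k where "k \<in> dig3" "k \<noteq> i" "k \<noteq> j" "dig3 = {i, j, k}"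
    "\<And>z. bc i z + bc j z + bc k z = 1 / (\<beta> - 1)"
proof -
  have "3 - i - j \<in> dig3 \<and> 3 - i - j \<noteq> i \<and> 3 - i - j \<noteq> j \<and> dig3 = {i, j, 3 - i - j}
    \<and> (\<forall>z. bc i z + bc j z + bc (3 - i - j) z = 1 / (\<beta> - 1))"
    using assms by (auto simp: bary_def)
  then show thesis
    by (elim conjE, intro that[of "3 - i - j"]) (assumption | erule spec)+
qed

lemma not_triple:
  assumes "i \<in> dig3" "j \<in> dig3" "k \<in> dig3" "i \<noteq> j" "i \<noteq> k" "j \<noteq> k"
    "1 / \<beta> \<le> bc i z" "1 / \<beta> \<le> bc j z"
  shows "bc k z < 1 / \<beta>"
proof -
  obtain l where l: "dig3 = {i, j, l}" "bc i z + bc j z + bc l z = 1 / (\<beta> - 1)"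
    using third[OF assms(1,2,4)] by metis
  have "k = l" using l(1) assms by auto
  then show ?thesis using l(2) assms side_lt by simp
qed

lemma fmap_image_iff: "z \<in> f i ` A \<longleftrightarrow> \<beta> *\<^sub>R z - qv i \<in> A"
proof
  assume "z \<in> f i ` A"
  then show "\<beta> *\<^sub>R z - qv i \<in> A" using beta_pos by (auto simp: fmap_def)
next
  assume A: "\<beta> *\<^sub>R z - qv i \<in> A"
  have "z = f i (\<beta> *\<^sub>R z - qv i)" using beta_pos by (simp add: fmap_def)
  then show "z \<in> f i ` A" using A by blast
qed

lemma fmap_inverse: "\<beta> *\<^sub>R f i z - qv i = z"
  using beta_pos by (simp add: fmap_def)

lemma inj_fmap: "f i z = f i w \<longleftrightarrow> z = w"
  by (metis fmap_inverse)

lemma Hset_iff: "z \<in> Hset \<beta> \<longleftrightarrow> (\<forall>k\<in>dig3. bc k z < 1 / \<beta>)"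
proof -
  have "1 / (\<beta> * (\<beta> - 1)) = 1 / (\<beta> - 1) - 1 / \<beta>" using beta_pos by (simp add: field_simps)
  then show ?thesis by (auto simp: Hset_def bary_def case_prod_beta)
qed

lemma Hset_lower:
  assumes z: "z \<in> Hset \<beta>" and "k \<in> dig3"
  shows "1 / (\<beta> - 1) - 2 / \<beta> < bc k z"
proof -
  have "\<exists>i\<in>dig3. \<exists>j\<in>dig3. i \<noteq> j \<and> k \<noteq> i \<and> k \<noteq> j" using assms(2) by auto
  then obtain i j where ij: "i \<in> dig3" "j \<in> dig3" "i \<noteq> j" "k \<noteq> i" "k \<noteq> j" by blast
  then obtain l where l: "dig3 = {i, j, l}" "bc i z + bc j z + bc l z = 1 / (\<beta> - 1)"
    using third[OF ij(1-3)] by metis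
  have "k = l" using l(1) ij assms by auto
  moreover have "bc i z < 1 / \<beta>" "bc j z < 1 / \<beta>" using z ij by (auto simp: Hset_iff)
  ultimately show ?thesis using l(2) by simp
qed

lemma hole_0: "hole \<beta> i 0 = Hset \<beta>"
  by (simp add: hole_def)

lemma hole_Suc: "hole \<beta> i (Suc n) = f i ` hole \<beta> i n"
  by (simp add: hole_def image_comp)

lemma hole_bary:
  assumes "z \<in> hole \<beta> i n" "i \<in> dig3" "k \<in> dig3" "k \<noteq> i"
  shows "(1 / (\<beta> - 1) - 2 / \<beta>) / \<beta>^n < bc k z" "bc k z < 1 / \<beta>^(n+1)"
proof -
  have "(1 / (\<beta> - 1) - 2 / \<beta>) / \<beta>^n < bc k z \<and> bc k z < 1 / \<beta>^(n+1)"
    using assms(1)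
  proof (induction n arbitrary: z)
    case 0
    then have z: "z \<in> Hset \<beta>" by (simp add: hole_0)
    then have "bc k z < 1 / \<beta>" using assms(3) Hset_iff by blast
    then show ?case using Hset_lower[OF z assms(3)] by simp
  next
    case (Suc n)
    then obtain w where w: "w \<in> hole \<beta> i n" "z = f i w" by (auto simp: hole_Suc)
    have "bc k z = bc k w / \<beta>" using assms w by (simp add: bary_fmap)
    moreover have "(1 / (\<beta> - 1) - 2 / \<beta>) / \<beta>^n / \<beta> < bc k w / \<beta> \<and> bc k w / \<beta> < 1 / \<beta>^(n+1) / \<beta>"
      using Suc.IH[OF w(1)] beta_pos(1) divide_strict_right_mono by blast
    ultimately show ?case by (simp add: mult.commute)
  qed
  then show "(1 / (\<beta> - 1) - 2 / \<beta>) / \<beta>^n < bc k z" "bc k z < 1 / \<beta>^(n+1)" by auto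
qed

lemma inverse_power_mono: "m \<le> n \<Longrightarrow> 1 / \<beta>^n \<le> 1 / \<beta>^m"
  using beta_pos by (intro divide_left_mono power_increasing) auto

lemma fmap_hole_bary:
  assumes z: "z \<in> f j ` hole \<beta> i n" and ijk: "i \<in> dig3" "j \<in> dig3" "k \<in> dig3" "i \<noteq> j" "k \<noteq> i" "k \<noteq> j"
  shows "(1 / (\<beta> - 1) - 2 / \<beta>) / \<beta>^(n+1) < bc k z" "bc k z < 1 / \<beta>^(n+2)"
    "1 / \<beta> + (1 / (\<beta> - 1) - 2 / \<beta>) / \<beta>^(n+1) < bc j z" "bc j z < 1 / \<beta> + 1 / \<beta>^(n+2)"
proof -
  obtain w where w: "w \<in> hole \<beta> i n" "z = f j w" using z by auto
  have k: "bc k z = bc k w / \<beta>" using ijk w by (simp add: bary_fmap)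
  have j: "bc j z = 1 / \<beta> + bc j w / \<beta>" using ijk w by (simp add: bary_fmap add_divide_distrib)
  have "(1 / (\<beta> - 1) - 2 / \<beta>) / \<beta>^n / \<beta> < bc l w / \<beta> \<and> bc l w / \<beta> < 1 / \<beta>^(n+1) / \<beta>"
    if "l \<in> dig3" "l \<noteq> i" for l
    using hole_bary[OF w(1) ijk(1) that] beta_pos(1) divide_strict_right_mono by blast
  from this[OF ijk(3,5)] this[OF ijk(2)] ijk
  show "(1 / (\<beta> - 1) - 2 / \<beta>) / \<beta>^(n+1) < bc k z" "bc k z < 1 / \<beta>^(n+2)"
    "1 / \<beta> + (1 / (\<beta> - 1) - 2 / \<beta>) / \<beta>^(n+1) < bc j z" "bc j z < 1 / \<beta> + 1 / \<beta>^(n+2)"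
    unfolding k j by (simp_all add: mult.commute)
qed

text \<open>Here the bound on \<open>\<beta>\<close> is sharp: for \<open>\<beta> > beta_star\<close> the hole \<open>f\<^sub>j(f\<^sub>i(H))\<close> sticks out of
  \<open>f\<^sub>i\<close> of the triangle.\<close>
lemma fmap_hole_overlap:
  assumes z: "z \<in> f j ` hole \<beta> i n" and ij: "i \<in> dig3" "j \<in> dig3" "i \<noteq> j" and n: "n \<ge> 1"
  shows "1 / \<beta> \<le> bc i z"
proof -
  obtain k where k: "k \<in> dig3" "k \<noteq> i" "k \<noteq> j" "bc i z + bc j z + bc k z = 1 / (\<beta> - 1)"
    using third[OF ij] by metis
  have "1 / \<beta>^(n+2) \<le> 1 / \<beta>^3" using n by (intro inverse_power_mono) simp
  then show ?thesis
    using fmap_hole_bary(2,4)[OF z ij(1,2) k(1) ij(3) k(2,3)] k(4) height_ge by simp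
qed

text \<open>Let \<open>h = 1/(\<beta>-1) - 2/\<beta>\<close>. Coordinate \<open>k\<close> of a
  common point lies between \<open>h/\<beta>^(l+1)\<close> and \<open>1/\<beta>^(l+2)\<close> for
  \<open>l = n\<close> and for \<open>l = m\<close>. As \<open>h \<ge> 1/\<beta>^2\<close>, the
  intervals for different \<open>l\<close> are disjoint. For \<open>m = n\<close> the bounds of all
  three coordinates are added and compared with their known sum.\<close>

lemma fmap_holes_disjoint:
  assumes ij: "i \<in> dig3" "j \<in> dig3" "i \<noteq> j" and mn: "n \<ge> 1"
    and z: "z \<in> f j ` hole \<beta> i n" "z \<in> f i ` hole \<beta> j m"
  shows False
proof -
  define h where "h = 1 / (\<beta> - 1) - 2 / \<beta>"
  obtain k where k: "k \<in> dig3" "k \<noteq> i" "k \<noteq> j" "bc i z + bc j z + bc k z = 1 / (\<beta> - 1)"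
    using third[OF ij] by metis
  have ji: "j \<noteq> i" using ij by simp
  note bj = fmap_hole_bary[OF z(1) ij(1,2) k(1) ij(3) k(2,3), folded h_def]
  note bi = fmap_hole_bary[OF z(2) ij(2,1) k(1) ji k(3,2), folded h_def]
  have *: False if "a < b" "h / \<beta>^(a+1) < bc k z" "bc k z < 1 / \<beta>^(b+2)" for a b
  proof -
    have "1 / \<beta>^(b+2) \<le> 1 / \<beta>^(a+3)" using that by (intro inverse_power_mono) simp
    also have "1 / \<beta>^(a+3) = 1 / \<beta>^2 / \<beta>^(a+1)"
      by (simp add: power_add eval_nat_numeral)
    also have "\<dots> \<le> h / \<beta>^(a+1)"
      using height_ge_sq beta_pos by (intro divide_right_mono) (auto simp: h_def)
    finally show False using that by linarith
  qed
  consider "m < n" | "n < m" | "n = m" by linarith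
  then show False
  proof cases
    case 3
    have upper: "h < 3 * (1 / \<beta>^(n+2))" and lower: "3 * (h / \<beta>^(n+1)) < h"
    proof -
      have "bc i z + bc j z + bc k z = h + (1 / \<beta> + 1 / \<beta>)" using k(4) by (simp add: h_def)
      then show "h < 3 * (1 / \<beta>^(n+2))" "3 * (h / \<beta>^(n+1)) < h"
        using bi bj unfolding 3 by linarith+
    qed
    \<comment> \<open>Level 1 fails by the lower bounds, from which \<open>3/\<beta>^2 < 1\<close>
      would follow; higher levels fail by the upper bounds, through
      \<open>3/\<beta>^4 \<le> h\<close>.\<close>
    show False
    proof (cases "n = 1")
      case True
      have "3 * h < h * \<beta>^2"
        using lower beta_pos True by (simp add: field_simps power2_eq_square)
      moreover have "h * \<beta>^2 < h * 3"
        using beta_sq_lt height_pos by (intro mult_strict_left_mono) (auto simp: h_def)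
      ultimately show False by simp
    next
      case False
      then have "1 / \<beta>^(n+2) \<le> 1 / \<beta>^4" using mn by (intro inverse_power_mono) simp
      then show False using upper height_ge4 by (simp add: h_def)
    qed
  qed (use *[of m n] *[of n m] bi bj in auto)
qed

section \<open>Self-similarity of the gasket\<close>

lemma fmap_triangle: "z \<in> triangle \<beta> \<Longrightarrow> i \<in> dig3 \<Longrightarrow> f i z \<in> triangle \<beta>"
  unfolding triangle_def using beta_pos bary_fmap[of i _ z] by (auto split: if_splits)

lemma fmap_image_triangle:
  assumes "i \<in> dig3"
  shows "z \<in> f i ` triangle \<beta> \<longleftrightarrow> z \<in> triangle \<beta> \<and> 1 / \<beta> \<le> bc i z"
proof
  assume "z \<in> f i ` triangle \<beta>"
  then obtain w where w: "w \<in> triangle \<beta>" "z = f i w" by auto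
  have "bc i w \<ge> 0" using w assms unfolding triangle_def by blast
  then have "1 / \<beta> \<le> bc i z" using assms w beta_pos by (simp add: bary_fmap divide_right_mono)
  then show "z \<in> triangle \<beta> \<and> 1 / \<beta> \<le> bc i z" using w fmap_triangle assms by simp
next
  assume z: "z \<in> triangle \<beta> \<and> 1 / \<beta> \<le> bc i z"
  define w where "w = \<beta> *\<^sub>R z - qv i"
  have zw: "z = f i w" using beta_pos by (simp add: fmap_def w_def)
  have "bc k w \<ge> 0" if "k \<in> dig3" for k
  proof -
    have "bc k (f i w) \<ge> 0" using z that by (auto simp: zw triangle_def)
    moreover have "1 / \<beta> \<le> bc i (f i w)" using z zw by simp
    ultimately show ?thesis
      using beta_pos assms that by (auto simp: bary_fmap zero_le_divide_iff divide_le_cancel split: if_splits)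
  qed
  then show "z \<in> f i ` triangle \<beta>" using zw by (auto simp: triangle_def)
qed

text \<open>The \<open>f j\<close>-images of \<open>hole \<beta> j n\<close> and of \<open>H\<close>
  itself are holes of the gasket, so a gasket point avoids them anyway; only holes with mixed digits
  remain to be excluded.\<close>

lemma gasket_fmap_iff:
  assumes z: "z \<in> gasket \<beta>" and j: "j \<in> dig3"
  shows "z \<in> f j ` gasket \<beta> \<longleftrightarrow> 1 / \<beta> \<le> bc j z \<and> (\<forall>i\<in>dig3 - {j}. \<forall>n\<ge>1. z \<notin> f j ` hole \<beta> i n)"
proof -
  have tri: "z \<in> triangle \<beta>" and nh: "\<And>i n. i \<in> dig3 \<Longrightarrow> z \<notin> hole \<beta> i n"
    using z unfolding gasket_def by blast+
  have "z \<in> f j ` gasket \<beta> \<longleftrightarrow> z \<in> f j ` triangle \<beta> \<and> (\<forall>i\<in>dig3. \<forall>n. z \<notin> f j ` hole \<beta> i n)"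
    by (auto simp: fmap_image_iff gasket_def)
  also have "\<dots> \<longleftrightarrow> 1 / \<beta> \<le> bc j z \<and> (\<forall>i\<in>dig3. \<forall>n. z \<notin> f j ` hole \<beta> i n)"
    using tri by (simp add: fmap_image_triangle[OF j])
  also have "(\<forall>i\<in>dig3. \<forall>n. z \<notin> f j ` hole \<beta> i n) \<longleftrightarrow> (\<forall>i\<in>dig3 - {j}. \<forall>n\<ge>1. z \<notin> f j ` hole \<beta> i n)"
    (is "?L \<longleftrightarrow> ?R")
  proof
    assume R: ?R
    show ?L
    proof (intro ballI allI)
      fix i n assume i: "i \<in> dig3"
      show "z \<notin> f j ` hole \<beta> i n"
      proof (cases "i = j \<or> n = 0")
        case True
        then have "f j ` hole \<beta> i n = hole \<beta> j (Suc n)" by (auto simp: hole_Suc hole_0)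
        then show ?thesis using nh[OF j] by simp
      next
        case False
        then show ?thesis using R i by auto
      qed
    qed
  qed blast
  finally show ?thesis .
qed

lemma
  assumes "z \<in> f j ` gasket \<beta>"
  shows gasket_fmap_bary: "z \<in> gasket \<beta> \<Longrightarrow> j \<in> dig3 \<Longrightarrow> 1 / \<beta> \<le> bc j z"
    and gasket_fmap_hole: "i \<in> dig3 \<Longrightarrow> z \<notin> f j ` hole \<beta> i n"
proof -
  show "1 / \<beta> \<le> bc j z" if "z \<in> gasket \<beta>" "j \<in> dig3"
    using assms gasket_fmap_iff[OF that] by (elim iffD1[THEN conjunct1])
  show "z \<notin> f j ` hole \<beta> i n" if "i \<in> dig3"
    using assms that unfolding fmap_image_iff gasket_def by blast
qed

lemma not_gasket_fmapE:
  assumes z: "z \<in> gasket \<beta>" and j: "j \<in> dig3" "1 / \<beta> \<le> bc j z" "z \<notin> f j ` gasket \<beta>"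
  obtains i n where "i \<in> dig3" "i \<noteq> j" "n \<ge> 1" "z \<in> f j ` hole \<beta> i n" "1 / \<beta> \<le> bc i z"
proof -
  have "\<not> (\<forall>i\<in>dig3 - {j}. \<forall>n\<ge>1. z \<notin> f j ` hole \<beta> i n)"
    using gasket_fmap_iff[OF z j(1)] j(2,3) by (simp only: simp_thms)
  then obtain i n where "i \<in> dig3 - {j}" and i': "n \<ge> 1" "z \<in> f j ` hole \<beta> i n" by meson
  then have i: "i \<in> dig3" "i \<noteq> j" "n \<ge> 1" "z \<in> f j ` hole \<beta> i n" by (simp_all only: Diff_iff) simp
  show thesis using that[OF i fmap_hole_overlap[OF i(4,1) j(1) i(2,3)]] .
qed

text \<open>A gasket point misses \<open>H\<close>, so some coordinate \<open>i\<close> is at least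
  \<open>1/\<beta>\<close>. If \<open>f i\<close> of the gasket misses the point, it lies in the
  \<open>f i\<close>-image of some \<open>hole \<beta> l n\<close>, and then coordinate
  \<open>l\<close> is large too; if \<open>f l\<close> of the gasket also misses it, it lies in the
  \<open>f l\<close>-image of some \<open>hole \<beta> k m\<close>. Three large coordinates being
  impossible, \<open>k = i\<close>, and two opposite mixed holes would meet.\<close>

lemma gasket_self_similar: "gasket \<beta> = (\<Union>i\<in>dig3. f i ` gasket \<beta>)"
proof (intro equalityI subsetI)
  fix z assume z: "z \<in> gasket \<beta>"
  show "z \<in> (\<Union>i\<in>dig3. f i ` gasket \<beta>)"
  proof (rule ccontr)
    assume neg: "z \<notin> (\<Union>i\<in>dig3. f i ` gasket \<beta>)"
    have nf: "z \<notin> f j ` gasket \<beta>" if "j \<in> dig3" for j using neg that by blast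
    have "z \<notin> hole \<beta> 0 0" using z unfolding gasket_def by blast
    then have "z \<notin> Hset \<beta>" by (simp add: hole_0)
    then obtain i where i: "i \<in> dig3" "1 / \<beta> \<le> bc i z" by (auto simp: Hset_iff not_less)
    obtain l n where l: "l \<in> dig3" "l \<noteq> i" "n \<ge> 1" "z \<in> f i ` hole \<beta> l n" "1 / \<beta> \<le> bc l z"
      using not_gasket_fmapE[OF z i nf[OF i(1)]] .
    obtain k m where k: "k \<in> dig3" "k \<noteq> l" "m \<ge> 1" "z \<in> f l ` hole \<beta> k m" "1 / \<beta> \<le> bc k z"
      using not_gasket_fmapE[OF z l(1,5) nf[OF l(1)]] .
    have "k = i"
      using not_triple[OF i(1) l(1) k(1) l(2)[symmetric] _ k(2)[symmetric] i(2) l(5)] k(5) by linarith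
    then show False using fmap_holes_disjoint[OF l(1) i(1) l(2,3,4)] k by simp
  qed
next
  fix z assume "z \<in> (\<Union>i\<in>dig3. f i ` gasket \<beta>)"
  then obtain i w where w: "i \<in> dig3" "w \<in> gasket \<beta>" "z = f i w" by blast
  have "z \<in> f i ` triangle \<beta>" using w by (auto simp: gasket_def)
  then have tri: "z \<in> triangle \<beta>" "1 / \<beta> \<le> bc i z" using fmap_image_triangle[OF w(1)] by auto
  have "z \<notin> hole \<beta> j n" if j: "j \<in> dig3" for j n
  proof
    assume h: "z \<in> hole \<beta> j n"
    show False
    proof (cases "j = i")
      case True
      show False
      proof (cases n)
        case 0
        then show False using h tri w(1) by (auto simp: hole_0 Hset_iff)
      next
        case (Suc m)
        then have "w \<in> hole \<beta> i m" using h True w(3) by (auto simp: hole_Suc inj_fmap)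
        then show False using w by (auto simp: gasket_def)
      qed
    next
      case False
      then have "bc i z < 1 / \<beta>^(n+1)" using hole_bary(2)[OF h j w(1)] by simp
      also have "\<dots> \<le> 1 / \<beta>^1" by (rule inverse_power_mono) simp
      finally show False using tri by simp
    qed
  qed
  then show "z \<in> gasket \<beta>" using tri by (simp add: gasket_def)
qed

section \<open>The regions \<open>Eset\<close> and \<open>Cset\<close> on the gasket\<close>

lemma inner_side: "1 / (\<beta> * (\<beta> - 1)) = 1 / (\<beta> - 1) - 1 / \<beta>"
  using beta_pos by (simp add: field_simps)

lemma triangleD:
  assumes "(x, y) \<in> triangle \<beta>"
  shows "0 \<le> x" "0 \<le> y" "x + y \<le> 1 / (\<beta> - 1)"
  using assms by (simp_all add: triangle_def bary_def)

lemma gasket_cover: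
  assumes "z \<in> gasket \<beta>"
  obtains i where "i \<in> dig3" "z \<in> f i ` gasket \<beta>"
proof -
  have "z \<in> (\<Union>i\<in>dig3. f i ` gasket \<beta>)" using assms by (subst (asm) gasket_self_similar)
  then show thesis using that by blast
qed

lemma Et_iff:
  assumes z: "z \<in> triangle \<beta>" and i: "i \<in> dig3"
  shows "z \<in> Et \<beta> i \<longleftrightarrow> (\<forall>j\<in>dig3 - {i}. bc j z < 1 / \<beta>) \<and> z \<notin> Hset \<beta>"
proof -
  obtain x y where xy: "z = (x, y)" by (cases z)
  note tri = triangleD[OF z[unfolded xy]]
  have *: "1 / (\<beta> - 1) - x - y < 1 / \<beta> \<longleftrightarrow> 1 / (\<beta> - 1) - 1 / \<beta> < x + y" by linarith
  have sets: "(\<forall>j\<in>dig3 - {0}. P j) \<longleftrightarrow> P 1 \<and> P 2" "(\<forall>j\<in>dig3 - {1}. P j) \<longleftrightarrow> P 0 \<and> P 2"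
    "(\<forall>j\<in>dig3 - {2}. P j) \<longleftrightarrow> P 0 \<and> P 1" for P by auto
  have b: "bc 0 z = 1 / (\<beta> - 1) - x - y" "bc 1 z = x" "bc 2 z = y" by (simp_all add: bary_def xy)
  consider "i = 0" | "i = 1" | "i = 2" using i by auto
  then show ?thesis
  proof cases
    case 1
    then show ?thesis using tri unfolding 1 sets b by (simp add: Et_def xy)
  next
    case 2
    then show ?thesis using tri unfolding 2 sets b * by (auto simp: Et_def xy inner_side)
  next
    case 3
    then show ?thesis using tri unfolding 3 sets b * by (auto simp: Et_def xy inner_side)
  qed
qed

lemma Ct_iff:
  assumes z: "z \<in> triangle \<beta>" and ij: "(i, j) \<in> {(0,1), (1,2), (0,2)}"
  shows "z \<in> Ct \<beta> i j \<longleftrightarrow> 1 / \<beta> \<le> bc i z \<and> 1 / \<beta> \<le> bc j z"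
proof -
  obtain x y where xy: "z = (x, y)" by (cases z)
  note tri = triangleD[OF z[unfolded xy]]
  have *: "1 / \<beta> \<le> 1 / (\<beta> - 1) - x - y \<longleftrightarrow> x + y \<le> 1 / (\<beta> - 1) - 1 / \<beta>" by linarith
  consider "i = 0 \<and> j = 1" | "i = 1 \<and> j = 2" | "i = 0 \<and> j = 2" using ij by auto
  then show ?thesis
    by cases (use tri in \<open>simp_all add: xy Ct_def bary_def inner_side * conj_ac\<close>)
qed

text \<open>The holes adjoined in the definition of \<open>Eset\<close> lie in the overlap of the
  image triangles of \<open>i\<close> and \<open>j\<close>, but \<open>f j\<close> of the gasket
  misses them: digit \<open>j\<close> would lead into a hole, and \<open>i\<close> is the only
  choice left.\<close>

lemma Eset_iff:
  assumes z: "z \<in> gasket \<beta>" and i: "i \<in> dig3"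
  shows "z \<in> Eset \<beta> i \<longleftrightarrow> z \<in> f i ` gasket \<beta> \<and> (\<forall>j\<in>dig3 - {i}. z \<notin> f j ` gasket \<beta>)"
proof
  have tri: "z \<in> triangle \<beta>" and nh: "\<And>i n. i \<in> dig3 \<Longrightarrow> z \<notin> hole \<beta> i n"
    using z unfolding gasket_def by blast+
  have E: "z \<in> Eset \<beta> i \<longleftrightarrow> z \<in> Et \<beta> i \<or> (\<exists>j\<in>dig3 - {i}. \<exists>n\<ge>1. z \<in> f j ` hole \<beta> i n)"
    using nh[OF i] unfolding Eset_def hole_def[symmetric] by (simp only: Diff_iff Un_iff UN_iff Bex_def atLeast_iff) blast
  {
    assume "z \<in> Eset \<beta> i"
    then consider "z \<in> Et \<beta> i" | j n where "j \<in> dig3" "j \<noteq> i" "n \<ge> 1" "z \<in> f j ` hole \<beta> i n"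
      using E by blast
    then have others: "z \<notin> f k ` gasket \<beta>" if k: "k \<in> dig3 - {i}" for k
    proof cases
      case 1
      then have "bc k z < 1 / \<beta>" using Et_iff[OF tri i] k by blast
      then show ?thesis using gasket_fmap_bary[of z k] z k by force
    next
      case (2 j n)
      show ?thesis
      proof (cases "k = j")
        case True
        then show ?thesis using gasket_fmap_hole[of z j i n] 2 i by metis
      next
        case False
        have kd: "k \<in> dig3" "i \<noteq> k" using k by auto
        have "1 / \<beta> \<le> bc i z" by (rule fmap_hole_overlap[OF 2(4) i 2(1) 2(2)[symmetric] 2(3)])
        moreover have "1 / \<beta> \<le> bc j z"
        proof -
          obtain l where l: "l \<in> dig3" "l \<noteq> i" "l \<noteq> j" using third[OF i 2(1)] 2(2) by metis
          have "(1 / (\<beta> - 1) - 2 / \<beta>) / \<beta>^(n+1) > 0" using height_pos beta_pos by simp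
          then show ?thesis
            using fmap_hole_bary(3)[OF 2(4) i 2(1) l(1) 2(2)[symmetric] l(2,3)] by linarith
        qed
        ultimately have "bc k z < 1 / \<beta>"
          by (rule not_triple[OF i 2(1) kd(1) 2(2)[symmetric] kd(2) False[symmetric]])
        then show ?thesis using gasket_fmap_bary[of z k] z kd by force
      qed
    qed
    moreover obtain l where "l \<in> dig3" "z \<in> f l ` gasket \<beta>" using gasket_cover[OF z] by blast
    ultimately show "z \<in> f i ` gasket \<beta> \<and> (\<forall>j\<in>dig3 - {i}. z \<notin> f j ` gasket \<beta>)"
      by blast
  }
  {
    assume R: "z \<in> f i ` gasket \<beta> \<and> (\<forall>j\<in>dig3 - {i}. z \<notin> f j ` gasket \<beta>)"
    have bi: "1 / \<beta> \<le> bc i z" using R gasket_fmap_bary z i by blast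
    show "z \<in> Eset \<beta> i"
    proof (cases "\<forall>j\<in>dig3 - {i}. bc j z < 1 / \<beta>")
      case True
      then have "z \<in> Et \<beta> i" using Et_iff[OF tri i] nh[OF i, of 0] unfolding hole_0 by blast
      then show ?thesis using E by blast
    next
      case False
      then obtain j where j: "j \<in> dig3" "j \<noteq> i" "1 / \<beta> \<le> bc j z"
        by (metis DiffE insertI1 not_less)
      then have "z \<notin> f j ` gasket \<beta>" using R by blast
      then obtain m n where m: "m \<in> dig3" "m \<noteq> j" "n \<ge> 1" "z \<in> f j ` hole \<beta> m n" "1 / \<beta> \<le> bc m z"
        using not_gasket_fmapE[OF z j(1,3)] by metis
      have "m = i"
        using not_triple[OF i j(1) m(1) j(2)[symmetric] _ m(2)[symmetric] bi j(3)] m(5) by linarith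
      moreover have "j \<in> dig3 - {i}" using j by simp
      ultimately show ?thesis using E m(3,4) by metis
    qed
  }
qed

text \<open>On the overlap of the image triangles of \<open>i\<close> and \<open>j\<close>, a mixed
  hole that involves the third digit would make a third coordinate large. Thus the two families
  removed in \<open>Cset\<close> are the only obstructions.\<close>

lemma Cset_iff:
  assumes z: "z \<in> gasket \<beta>" and ij: "(i, j) \<in> {(0,1), (1,2), (0,2)}"
  shows "z \<in> Cset \<beta> i j \<longleftrightarrow> z \<in> f i ` gasket \<beta> \<and> z \<in> f j ` gasket \<beta>"
proof -
  have tri: "z \<in> triangle \<beta>" using z by (auto simp: gasket_def)
  have i: "i \<in> dig3" and j: "j \<in> dig3" and ne: "i \<noteq> j" using ij by auto
  have C: "z \<in> Cset \<beta> i j \<longleftrightarrow> 1 / \<beta> \<le> bc i z \<and> 1 / \<beta> \<le> bc j z \<and>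
      (\<forall>n\<ge>1. z \<notin> f i ` hole \<beta> j n) \<and> (\<forall>n\<ge>1. z \<notin> f j ` hole \<beta> i n)"
  proof -
    have "x \<in> A - ((\<Union>n\<in>{1..}. P n) \<union> (\<Union>n\<in>{1..}. Q n)) \<longleftrightarrow>
        x \<in> A \<and> (\<forall>n\<ge>1. x \<notin> P n) \<and> (\<forall>n\<ge>1. x \<notin> Q n)"
      for x :: "real \<times> real" and A and P Q :: "nat \<Rightarrow> (real \<times> real) set" by auto
    then show ?thesis unfolding Cset_def hole_def Ct_iff[OF tri ij] by (simp only: conj_assoc Ct_iff[OF tri ij])
  qed
  have third_out: "z \<notin> f a ` hole \<beta> k n"
    if "a \<in> dig3" "b \<in> dig3" "a \<noteq> b" "1 / \<beta> \<le> bc a z" "1 / \<beta> \<le> bc b z" "k \<in> dig3" "k \<noteq> a" "k \<noteq> b" "n \<ge> 1"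
    for a b k n
  proof
    assume "z \<in> f a ` hole \<beta> k n"
    then have "1 / \<beta> \<le> bc k z" by (rule fmap_hole_overlap[OF _ that(6,1,7,9)])
    moreover have "bc k z < 1 / \<beta>"
      by (rule not_triple[OF that(1,2,6,3) that(7,8)[symmetric] that(4,5)])
    ultimately show False by linarith
  qed
  have mem: "z \<in> f a ` gasket \<beta>"
    if "a \<in> dig3" "b \<in> dig3" "a \<noteq> b" "1 / \<beta> \<le> bc a z" "1 / \<beta> \<le> bc b z"
      "\<forall>n\<ge>1. z \<notin> f a ` hole \<beta> b n" for a b
    unfolding gasket_fmap_iff[OF z that(1)]
  proof (intro conjI ballI allI impI that(4))
    fix k and n :: nat assume "k \<in> dig3 - {a}" "1 \<le> n"
    then show "z \<notin> f a ` hole \<beta> k n"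
      using that(6) third_out[OF that(1-5), of k n] by (cases "k = b") blast+
  qed
  show ?thesis
  proof
    assume "z \<in> Cset \<beta> i j"
    then show "z \<in> f i ` gasket \<beta> \<and> z \<in> f j ` gasket \<beta>"
      using mem[OF i j ne] mem[OF j i ne[symmetric]] C by blast
  next
    assume "z \<in> f i ` gasket \<beta> \<and> z \<in> f j ` gasket \<beta>"
    then show "z \<in> Cset \<beta> i j"
      using gasket_fmap_bary[OF _ z] gasket_fmap_hole i j C by blast
  qed
qed

lemma gasket_not_triple:
  assumes "z \<in> gasket \<beta>" "z \<in> f 0 ` gasket \<beta>" "z \<in> f 1 ` gasket \<beta>"
  shows "z \<notin> f 2 ` gasket \<beta>"
proof
  assume "z \<in> f 2 ` gasket \<beta>"
  then have "1 / \<beta> \<le> bc 2 z" using gasket_fmap_bary assms(1) by blast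
  moreover have "1 / \<beta> \<le> bc 0 z" "1 / \<beta> \<le> bc 1 z" using gasket_fmap_bary assms by blast+
  ultimately show False using not_triple[of 0 1 2 z] by simp
qed

text \<open>An open part of the switch region. The threshold \<open>1/\<beta>^3\<close> keeps
  coordinate 2 above the mixed holes of the digits 0 and 1, where it stays below
  \<open>1/\<beta>^(n+2)\<close> with \<open>n \<ge> 1\<close>.\<close>

definition "switch_core = {z. 1 / \<beta> < bc 0 z \<and> 1 / \<beta> < bc 1 z \<and> 1 / \<beta>^3 < bc 2 z}"

lemma switch_core_subset: "switch_core \<subseteq> gasket \<beta> \<inter> Cset \<beta> 0 1"
proof
  fix z assume z: "z \<in> switch_core"
  have pos: "1 / \<beta> > 0" "1 / \<beta>^3 > 0" using beta_pos by auto
  then have "bc 0 z \<ge> 0" "bc 1 z \<ge> 0" "bc 2 z \<ge> 0"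
    using z unfolding switch_core_def mem_Collect_eq by linarith+
  then have tri: "z \<in> triangle \<beta>" by (simp add: triangle_def)
  have nh: "z \<notin> hole \<beta> i n" if i: "i \<in> dig3" for i n
  proof
    assume h: "z \<in> hole \<beta> i n"
    obtain k where k: "k \<in> {0, 1}" "k \<noteq> i" by auto
    have "bc k z < 1 / \<beta>^(n+1)" using hole_bary(2)[OF h i, of k] k by auto
    also have "\<dots> \<le> 1 / \<beta>^1" by (rule inverse_power_mono) simp
    finally show False using z k by (auto simp: switch_core_def)
  qed
  then have g: "z \<in> gasket \<beta>" using tri by (simp add: gasket_def)
  have out: "z \<notin> f a ` hole \<beta> b n" if "a \<in> {0, 1}" "b \<in> {0, 1}" "a \<noteq> b" "n \<ge> 1" for a b n
  proof
    assume h: "z \<in> f a ` hole \<beta> b n"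
    have "bc 2 z < 1 / \<beta>^(n+2)" using fmap_hole_bary(2)[OF h, of 2] that by auto
    also have "\<dots> \<le> 1 / \<beta>^3" using that by (intro inverse_power_mono) simp
    finally show False using z by (auto simp: switch_core_def)
  qed
  have "z \<in> Ct \<beta> 0 1" using Ct_iff[OF tri, of 0 1] z by (auto simp: switch_core_def)
  then have "z \<in> Cset \<beta> 0 1"
    using out[of 0 1] out[of 1 0] unfolding Cset_def hole_def by auto
  then show "z \<in> gasket \<beta> \<inter> Cset \<beta> 0 1" using g by blast
qed

lemma open_switch_core: "open switch_core"
  unfolding switch_core_def bary_def
  by (intro open_Collect_conj open_Collect_less) (auto intro!: continuous_intros)

lemma switch_core_nonempty: "switch_core \<noteq> {}"
proof -
  define h c where "h = 1 / (\<beta> - 1) - 2 / \<beta>" and "c = 1 / \<beta>^3"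
  \<comment> \<open>The total exceeds the three thresholds by \<open>h - c > 0\<close>; each
    coordinate receives a third of this surplus.\<close>
  define d where "d = (h - c) / 3"
  have "2 * c \<le> h" "c > 0" using height_ge beta_pos by (simp_all add: h_def c_def)
  then have "d > 0" by (simp add: d_def)
  have "1 / (\<beta> - 1) = h + (1 / \<beta> + 1 / \<beta>)" by (simp add: h_def)
  moreover have "h - c = 3 * d" by (simp add: d_def)
  ultimately have "1 / \<beta> < 1 / (\<beta> - 1) - (1 / \<beta> + d) - (c + d)" using \<open>d > 0\<close> by linarith
  then have "(1 / \<beta> + d, c + d) \<in> switch_core"
    using \<open>d > 0\<close> by (simp add: switch_core_def bary_def c_def)
  then show ?thesis by blast
qed

section \<open>Compactness of the gasket\<close>

lemma open_Hset: "open (Hset \<beta>)"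
proof -
  have "Hset \<beta> = {z. fst z < 1 / \<beta> \<and> snd z < 1 / \<beta> \<and> 1 / (\<beta> * (\<beta> - 1)) < fst z + snd z}"
    by (auto simp: Hset_def)
  then show ?thesis
    by (auto intro!: open_Collect_conj open_Collect_less continuous_intros)
qed

lemma fmap_image_eq_vimage: "f i ` A = (\<lambda>z. \<beta> *\<^sub>R z - qv i) -` A"
  using fmap_image_iff by blast

lemma open_hole: "open (hole \<beta> i n)"
proof (induction n)
  case (Suc n)
  then show ?case
    unfolding hole_Suc fmap_image_eq_vimage by (intro open_vimage) (auto intro!: continuous_intros)
qed (simp add: hole_0 open_Hset)

lemma compact_gasket: "compact (gasket \<beta>)"
proof -
  let ?B = "{0..1/(\<beta>-1)} \<times> {0..1/(\<beta>-1)}"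
  have cp: "compact ?B" by (intro compact_Times) auto
  have "triangle \<beta> = {z. 0 \<le> 1 / (\<beta> - 1) - fst z - snd z} \<inter> {z. 0 \<le> fst z} \<inter> {z. 0 \<le> snd z}"
    by (auto simp: triangle_def bary_def)
  then have "closed (triangle \<beta>)"
    by (auto intro!: closed_Int closed_Collect_le continuous_intros)
  then have cl: "closed (gasket \<beta>)"
    unfolding gasket_def by (intro closed_Diff open_UN ballI open_hole)
  have "compact (?B \<inter> gasket \<beta>)" by (rule compact_Int_closed[OF cp cl])
  moreover have "?B \<inter> gasket \<beta> = gasket \<beta>"
    by (auto simp: gasket_def triangle_def bary_def)
  ultimately show ?thesis by simp
qed

end

section \<open>Digit sequences and the coding map\<close>

definition ups :: "(nat \<Rightarrow> nat) set" where
  "ups = {b. \<forall>n. b n \<in> dig3}"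

definition pival :: "real \<Rightarrow> (nat \<Rightarrow> nat) \<Rightarrow> real \<times> real" where
  "pival \<beta> b = (\<Sum>n. fst (qv (b n)) / \<beta>^(n+1), \<Sum>n. snd (qv (b n)) / \<beta>^(n+1))"

lemma funpow_shift: "(shift ^^ n) b k = b (n + k)"
  by (induction n arbitrary: k) (simp_all add: shift_def)

lemma shift_ups: "b \<in> ups \<Longrightarrow> shift b \<in> ups"
  by (simp add: ups_def shift_def)

lemma funpow_shift_ups: "b \<in> ups \<Longrightarrow> (shift ^^ n) b \<in> ups"
  by (simp add: ups_def funpow_shift)

lemma space_Omega_M: "space Omega_M = {w. \<forall>n. w n \<in> {0, 1}}"
  by (auto simp: Omega_M_def space_PiM PiE_def extensional_def Pi_def)

lemma space_Ups_P: "space Ups_P = ups"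
  by (auto simp: Ups_P_def space_PiM space_uniform_count_measure PiE_def extensional_def Pi_def ups_def)

context fat_gasket
begin

section \<open>Digit expansions and uniqueness of the attractor\<close>

lemma qv_bounds: "0 \<le> fst (qv i)" "fst (qv i) \<le> 1" "0 \<le> snd (qv i)" "snd (qv i) \<le> 1"
  by (auto simp: qv_def)

lemma sums_inverse_powers: "(\<lambda>n. 1 / \<beta>^(n+1)) sums (1 / (\<beta> - 1))"
proof -
  have "(\<lambda>n. (1 / \<beta>) * (1 / \<beta>)^n) sums ((1 / \<beta>) * (1 / (1 - 1 / \<beta>)))"
    using beta_pos by (intro sums_mult geometric_sums) simp
  moreover have "(1 / \<beta>) * (1 / (1 - 1 / \<beta>)) = 1 / (\<beta> - 1)"
    using beta_pos by (simp add: field_simps)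
  ultimately show ?thesis by (simp add: power_divide)
qed

lemma digit_series:
  fixes c :: "nat \<Rightarrow> real"
  assumes c: "\<And>n. 0 \<le> c n" "\<And>n. c n \<le> 1"
  shows "summable (\<lambda>n. c n / \<beta>^(n+1))" "0 \<le> (\<Sum>n. c n / \<beta>^(n+1))" "(\<Sum>n. c n / \<beta>^(n+1)) \<le> 1 / (\<beta> - 1)"
    "(\<Sum>n. c n / \<beta>^(n+1)) = (c 0 + (\<Sum>n. c (Suc n) / \<beta>^(n+1))) / \<beta>"
proof -
  have le: "c n / \<beta>^(n+1) \<le> 1 / \<beta>^(n+1)" for n
    using c beta_pos by (intro divide_right_mono) auto
  have nn: "0 \<le> c n / \<beta>^(n+1)" for n using c beta_pos by simp
  show sm: "summable (\<lambda>n. c n / \<beta>^(n+1))"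
  proof (rule summable_comparison_test'[OF sums_summable[OF sums_inverse_powers], of 0])
    show "norm (c n / \<beta>^(n+1)) \<le> 1 / \<beta>^(n+1)" for n
      using le[of n] nn[of n] by (simp only: real_norm_def abs_of_nonneg)
  qed
  show "0 \<le> (\<Sum>n. c n / \<beta>^(n+1))" by (rule suminf_nonneg[OF sm nn])
  show "(\<Sum>n. c n / \<beta>^(n+1)) \<le> 1 / (\<beta> - 1)"
    using suminf_le[OF le sm sums_summable[OF sums_inverse_powers]] sums_unique[OF sums_inverse_powers]
    by simp
  have "summable (\<lambda>n. c (Suc n) / \<beta>^(n+1))"
  proof (rule summable_comparison_test'[OF sums_summable[OF sums_inverse_powers], of 0])
    fix n
    have "c (Suc n) / \<beta>^(n+1) \<le> 1 / \<beta>^(n+1)" "0 \<le> c (Suc n) / \<beta>^(n+1)"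
      using c beta_pos by (auto intro!: divide_right_mono)
    then show "norm (c (Suc n) / \<beta>^(n+1)) \<le> 1 / \<beta>^(n+1)" by (simp only: real_norm_def abs_of_nonneg)
  qed
  from suminf_mult[OF this, of "1 / \<beta>"]
  have "(\<Sum>n. c (Suc n) / \<beta>^(Suc n+1)) = (\<Sum>n. c (Suc n) / \<beta>^(n+1)) / \<beta>" by simp
  then show "(\<Sum>n. c n / \<beta>^(n+1)) = (c 0 + (\<Sum>n. c (Suc n) / \<beta>^(n+1))) / \<beta>"
    using suminf_split_head[OF sm] by (simp add: add_divide_distrib)
qed

lemma pival_shift: "pival \<beta> b = f (b 0) (pival \<beta> (shift b))"
  using digit_series(4)[of "\<lambda>n. fst (qv (b n))"] digit_series(4)[of "\<lambda>n. snd (qv (b n))"]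
  by (simp add: pival_def fmap_def shift_def qv_bounds add.commute prod_eq_iff)

lemma norm_pival_le: "norm (pival \<beta> b) \<le> 2 / (\<beta> - 1)"
proof -
  have "norm (pival \<beta> b) \<le> norm (fst (pival \<beta> b)) + norm (snd (pival \<beta> b))"
    by (metis norm_Pair_le prod.collapse)
  also have "\<dots> \<le> 1 / (\<beta> - 1) + 1 / (\<beta> - 1)"
    using digit_series(2,3)[of "\<lambda>n. fst (qv (b n))"] digit_series(2,3)[of "\<lambda>n. snd (qv (b n))"] qv_bounds
    by (intro add_mono) (simp_all add: pival_def)
  finally show ?thesis by simp
qed

lemma norm_fmap_diff: "norm (f i z - f i w) = norm (z - w) / \<beta>"
proof -
  have "f i z - f i w = (1 / \<beta>) *\<^sub>R (z - w)" by (simp add: fmap_def algebra_simps)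
  then show ?thesis using beta_pos by simp
qed

text \<open>Both \<open>z\<close> and the values of the shifted expansions obey the recursion
  \<open>x n = f (b n) (x (Suc n))\<close>, and every \<open>f i\<close> contracts by
  \<open>1/\<beta>\<close>. For bounded \<open>z\<close> this will identify \<open>z 0\<close> with
  the value of the expansion.\<close>

lemma orbit_pival_close:
  assumes step: "\<And>n. n < N \<Longrightarrow> z n = f (b n) (z (Suc n))"
  shows "norm (z 0 - pival \<beta> b) = norm (z N - pival \<beta> ((shift ^^ N) b)) / \<beta>^N"
  using step
proof (induction N)
  case (Suc N)
  have "pival \<beta> ((shift ^^ N) b) = f (b N) (pival \<beta> ((shift ^^ Suc N) b))"
    using pival_shift[of "(shift ^^ N) b"] by (simp add: funpow_shift)
  then have "norm (z N - pival \<beta> ((shift ^^ N) b)) = norm (z (Suc N) - pival \<beta> ((shift ^^ Suc N) b)) / \<beta>"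
    using Suc.prems[of N] by (simp only: norm_fmap_diff lessI)
  then show ?case using Suc by (simp add: mult.commute)
qed simp

lemma orbit_pival_le:
  assumes step: "\<And>n. n < N \<Longrightarrow> z n = f (b n) (z (Suc n))" and bd: "norm (z N) \<le> B"
  shows "norm (z 0 - pival \<beta> b) \<le> (B + 2 / (\<beta> - 1)) / \<beta>^N"
proof -
  have "norm (z N - pival \<beta> ((shift ^^ N) b)) \<le> B + 2 / (\<beta> - 1)"
    using norm_triangle_ineq4[of "z N" "pival \<beta> ((shift ^^ N) b)"] bd norm_pival_le[of "(shift ^^ N) b"]
    by linarith
  then show ?thesis
    using orbit_pival_close[of N z b] step beta_pos by (simp add: divide_right_mono)
qed

lemma tendsto_div_beta_power: "(\<lambda>n. c / \<beta>^n) \<longlonglongrightarrow> 0"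
proof -
  have "(\<lambda>n. c * (1 / \<beta>)^n) \<longlonglongrightarrow> c * 0"
    using beta_pos by (intro tendsto_mult tendsto_const LIMSEQ_power_zero) simp
  then show ?thesis by (simp add: power_divide)
qed

lemma orbit_pival:
  assumes step: "\<And>n. z n = f (b n) (z (Suc n))" and bd: "\<And>n. norm (z n) \<le> B"
  shows "z 0 = pival \<beta> b"
proof -
  have "norm (z 0 - pival \<beta> b) \<le> 0"
    by (rule LIMSEQ_le_const[OF tendsto_div_beta_power])
       (use orbit_pival_le[of _ z b B] step bd in blast)
  then show ?thesis by simp
qed

text \<open>A point of \<open>S\<close> gets an expansion by choosing preimages forever inside the
  bounded set \<open>S\<close>. Conversely, prepending the first \<open>n\<close> digits of
  \<open>b\<close> to a point of \<open>S\<close> gives points of \<open>S\<close> that converge to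
  the value of \<open>b\<close>, and \<open>S\<close> is closed. As the right-hand side does not
  mention \<open>S\<close>, the description of \<open>S_attr\<close> by \<open>THE\<close> has at
  most one solution.\<close>

lemma attractor_eq_pival:
  assumes S: "compact S" "S \<noteq> {}" "S = (\<Union>i\<in>dig3. f i ` S)"
  shows "S = pival \<beta> ` ups"
proof (intro equalityI subsetI)
  fix z assume z: "z \<in> S"
  have "\<exists>i\<in>dig3. \<exists>y\<in>S. z = f i y" if "z \<in> S" for z
  proof -
    have "z \<in> (\<Union>i\<in>dig3. f i ` S)" using that by (subst (asm) S(3))
    then show ?thesis by blast
  qed
  then obtain d g where dg: "\<And>z. z \<in> S \<Longrightarrow> d z \<in> dig3 \<and> g z \<in> S \<and> z = f (d z) (g z)" by metis
  have inS: "(g ^^ n) z \<in> S" for n by (induction n) (use z dg in auto)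
  obtain B where B: "\<And>x. x \<in> S \<Longrightarrow> norm x \<le> B" using compact_imp_bounded[OF S(1)] by (auto simp: bounded_iff)
  have "(g ^^ 0) z = pival \<beta> (\<lambda>n. d ((g ^^ n) z))"
  proof (rule orbit_pival)
    show "(g ^^ n) z = f (d ((g ^^ n) z)) ((g ^^ Suc n) z)" for n using dg[OF inS[of n]] by simp
    show "norm ((g ^^ n) z) \<le> B" for n using B inS by blast
  qed
  moreover have "(\<lambda>n. d ((g ^^ n) z)) \<in> ups" using dg inS by (auto simp: ups_def)
  ultimately show "z \<in> pival \<beta> ` ups" by auto
next
  fix x assume "x \<in> pival \<beta> ` ups"
  then obtain b where b: "b \<in> ups" "x = pival \<beta> b" by auto
  obtain s where s: "s \<in> S" using S by auto
  obtain B where B: "\<And>x. x \<in> S \<Longrightarrow> norm x \<le> B" using compact_imp_bounded[OF S(1)] by (auto simp: bounded_iff)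
  have inv: "f i y \<in> S" if "i \<in> dig3" "y \<in> S" for i y
    by (subst S(3)) (use that in blast)
  have "\<exists>y\<in>S. norm (y - pival \<beta> b) \<le> (B + 2 / (\<beta> - 1)) / \<beta>^n" if "b \<in> ups" for b n
    using that
  proof (induction n arbitrary: b)
    case 0
    have "norm (s - pival \<beta> b) \<le> B + 2 / (\<beta> - 1)"
      using norm_triangle_ineq4[of s "pival \<beta> b"] B[OF s] norm_pival_le[of b] by linarith
    then show ?case using s by auto
  next
    case (Suc n)
    obtain y where y: "y \<in> S" "norm (y - pival \<beta> (shift b)) \<le> (B + 2 / (\<beta> - 1)) / \<beta>^n"
      using Suc.IH[OF shift_ups[OF Suc.prems]] by blast
    have "norm (f (b 0) y - pival \<beta> b) = norm (y - pival \<beta> (shift b)) / \<beta>"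
      by (subst pival_shift) (rule norm_fmap_diff)
    also have "\<dots> \<le> (B + 2 / (\<beta> - 1)) / \<beta>^n / \<beta>"
      using y beta_pos by (intro divide_right_mono) auto
    finally have "norm (f (b 0) y - pival \<beta> b) \<le> (B + 2 / (\<beta> - 1)) / \<beta>^Suc n" by (simp add: mult.commute)
    moreover have "f (b 0) y \<in> S" using inv y Suc.prems by (simp add: ups_def)
    ultimately show ?case by blast
  qed
  then obtain y where y: "\<And>n. y n \<in> S" "\<And>n. norm (y n - x) \<le> (B + 2 / (\<beta> - 1)) / \<beta>^n"
    using b by metis
  have "(\<lambda>n. y n - x) \<longlonglongrightarrow> 0"
    using y(2) by (intro Lim_null_comparison[OF _ tendsto_div_beta_power] always_eventually) blast
  then have "y \<longlonglongrightarrow> x" by (simp add: LIM_zero_iff)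
  then show "x \<in> S" using closed_sequentially[OF compact_imp_closed[OF S(1)]] y(1) by blast
qed

lemma gasket_nonempty: "gasket \<beta> \<noteq> {}"
  using switch_core_nonempty switch_core_subset by blast

lemma gasket_eq_pival: "gasket \<beta> = pival \<beta> ` ups"
  using attractor_eq_pival[OF compact_gasket gasket_nonempty gasket_self_similar] .

lemma S_attr_eq_gasket: "S_attr \<beta> = gasket \<beta>"
  unfolding S_attr_def
proof (rule the_equality)
  show "compact (gasket \<beta>) \<and> gasket \<beta> \<noteq> {} \<and> gasket \<beta> = (\<Union>i\<in>dig3. f i ` gasket \<beta>)"
    using compact_gasket gasket_nonempty gasket_self_similar by blast
  fix S assume "compact S \<and> S \<noteq> {} \<and> S = (\<Union>i\<in>dig3. f i ` S)"
  then have "S = pival \<beta> ` ups" by (intro attractor_eq_pival) (elim conjE, assumption)+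
  then show "S = gasket \<beta>" using gasket_eq_pival by simp
qed

lemma pival_in_gasket: "b \<in> ups \<Longrightarrow> pival \<beta> b \<in> gasket \<beta>"
  by (simp add: gasket_eq_pival)

lemma gasket_bounded: "z \<in> gasket \<beta> \<Longrightarrow> norm z \<le> 2 / (\<beta> - 1)"
  using norm_pival_le by (auto simp: gasket_eq_pival)

text \<open>\<open>kdig\<close> looks at the first coin only, so constant coin sequences probe both
  choices at \<open>z\<close>.\<close>

definition lo :: "real \<times> real \<Rightarrow> nat" where "lo z = kdig \<beta> (\<lambda>_. 0, z)"
definition hi :: "real \<times> real \<Rightarrow> nat" where "hi z = kdig \<beta> (\<lambda>_. 1, z)"

lemma kdig_eq: "kdig \<beta> (w, z) = (if w 0 = 0 then lo z else hi z)"
  by (simp add: lo_def hi_def kdig_def Let_def)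

text \<open>In the pairs 01, 12, 02 coin 0 selects the smaller digit, so \<open>lo\<close> and
  \<open>hi\<close> are the smallest and the largest admissible digit at \<open>z\<close>. As at
  most two are admissible, they list all of them.\<close>

lemma lo_hi:
  assumes z: "z \<in> gasket \<beta>"
  shows "lo z \<in> dig3" "hi z \<in> dig3"
    and "i \<in> dig3 \<Longrightarrow> z \<in> f i ` gasket \<beta> \<longleftrightarrow> i = lo z \<or> i = hi z"
    and "z \<in> Call \<beta> \<longleftrightarrow> lo z \<noteq> hi z"
    and lo_hi_eq: "lo z = (if z \<in> f 0 ` gasket \<beta> then 0 else if z \<in> f 1 ` gasket \<beta> then 1 else 2)"
      "hi z = (if z \<in> f 2 ` gasket \<beta> then 2 else if z \<in> f 1 ` gasket \<beta> then 1 else 0)"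
    and Call_not_Eset: "z \<in> Call \<beta> \<Longrightarrow> z \<notin> Eset \<beta> 0 \<and> z \<notin> Eset \<beta> 1 \<and> z \<notin> Eset \<beta> 2"
proof -
  define a where "a i \<longleftrightarrow> z \<in> f i ` gasket \<beta>" for i
  have d: "0 \<in> dig3" "1 \<in> dig3" "2 \<in> dig3" by auto
  have c: "(0, 1) \<in> {(0,1), (1,2), (0,2::nat)}" "(1, 2) \<in> {(0,1), (1,2), (0,2::nat)}"
    "(0, 2) \<in> {(0,1), (1,2), (0,2::nat)}" by auto
  have ball: "(\<forall>j\<in>dig3 - {0}. P j) \<longleftrightarrow> P 1 \<and> P 2" "(\<forall>j\<in>dig3 - {1}. P j) \<longleftrightarrow> P 0 \<and> P 2"
    "(\<forall>j\<in>dig3 - {2}. P j) \<longleftrightarrow> P 0 \<and> P 1" for P by auto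
  have E: "z \<in> Eset \<beta> 0 \<longleftrightarrow> a 0 \<and> \<not> a 1 \<and> \<not> a 2" "z \<in> Eset \<beta> 1 \<longleftrightarrow> a 1 \<and> \<not> a 0 \<and> \<not> a 2"
    "z \<in> Eset \<beta> 2 \<longleftrightarrow> a 2 \<and> \<not> a 0 \<and> \<not> a 1"
    using Eset_iff[OF z d(1)] Eset_iff[OF z d(2)] Eset_iff[OF z d(3)] unfolding ball a_def by blast+
  have C: "z \<in> Cset \<beta> 0 1 \<longleftrightarrow> a 0 \<and> a 1" "z \<in> Cset \<beta> 1 2 \<longleftrightarrow> a 1 \<and> a 2" "z \<in> Cset \<beta> 0 2 \<longleftrightarrow> a 0 \<and> a 2"
    using Cset_iff[OF z c(1)] Cset_iff[OF z c(2)] Cset_iff[OF z c(3)] unfolding a_def by blast+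
  have some: "a 0 \<or> a 1 \<or> a 2"
    using gasket_cover[OF z] unfolding a_def by (metis insertE singletonD)
  have notall: "\<not> (a 0 \<and> a 1 \<and> a 2)"
    using gasket_not_triple[OF z] unfolding a_def by blast
  have lohi: "lo z = (if a 0 then 0 else if a 1 then 1 else 2)" "hi z = (if a 2 then 2 else if a 1 then 1 else 0)"
    unfolding lo_def hi_def kdig_def Let_def fst_conv snd_conv E C
    using some notall by (auto simp del: One_nat_def)
  show "lo z = (if z \<in> f 0 ` gasket \<beta> then 0 else if z \<in> f 1 ` gasket \<beta> then 1 else 2)"
      "hi z = (if z \<in> f 2 ` gasket \<beta> then 2 else if z \<in> f 1 ` gasket \<beta> then 1 else 0)"
    using lohi unfolding a_def .
  show "lo z \<in> dig3" "hi z \<in> dig3" by (simp_all add: lohi)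
  show "z \<in> f i ` gasket \<beta> \<longleftrightarrow> i = lo z \<or> i = hi z" if "i \<in> dig3"
  proof -
    have "i = 0 \<or> i = 1 \<or> i = 2" using that by auto
    then show ?thesis using some notall unfolding lohi a_def[symmetric] by (auto simp del: One_nat_def)
  qed
  show "z \<in> Call \<beta> \<longleftrightarrow> lo z \<noteq> hi z"
    unfolding lohi Call_def Un_iff C using some notall by auto
  show "z \<in> Call \<beta> \<Longrightarrow> z \<notin> Eset \<beta> 0 \<and> z \<notin> Eset \<beta> 1 \<and> z \<notin> Eset \<beta> 2"
    unfolding Call_def Un_iff C E by blast
qed

section \<open>The random map on the gasket and its digit sequences\<close>

definition "KX = space Omega_M \<times> gasket \<beta>"

lemma kdig_gasket:
  assumes "z \<in> gasket \<beta>"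
  shows "kdig \<beta> (w, z) \<in> dig3" "z \<in> f (kdig \<beta> (w, z)) ` gasket \<beta>"
proof -
  have "kdig \<beta> (w, z) = lo z \<or> kdig \<beta> (w, z) = hi z" by (simp add: kdig_eq)
  then show "kdig \<beta> (w, z) \<in> dig3" "z \<in> f (kdig \<beta> (w, z)) ` gasket \<beta>"
    using lo_hi(1-3)[OF assms] by metis+
qed

lemma Kmap_eq:
  assumes "z \<in> gasket \<beta>"
  shows "Kmap \<beta> (w, z) = (if z \<in> Call \<beta> then shift w else w, \<beta> *\<^sub>R z - qv (kdig \<beta> (w, z)))"
  using Call_not_Eset[OF assms] by (simp add: Kmap_def)

lemma Kmap_snd:
  assumes "snd p \<in> gasket \<beta>"
  shows "snd p = f (kdig \<beta> p) (snd (Kmap \<beta> p))"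
  using assms beta_pos by (cases p) (simp add: Kmap_eq fmap_def)

lemma Kmap_KX: "p \<in> KX \<Longrightarrow> Kmap \<beta> p \<in> KX"
proof -
  assume p: "p \<in> KX"
  obtain w z where wz: "p = (w, z)" by (cases p)
  have z: "z \<in> gasket \<beta>" using p by (simp add: KX_def wz)
  have "\<beta> *\<^sub>R z - qv (kdig \<beta> (w, z)) \<in> gasket \<beta>"
    using kdig_gasket(2)[OF z, of w] by (simp only: fmap_image_iff)
  then show ?thesis
    using p by (auto simp: wz Kmap_eq[OF z] KX_def space_Omega_M shift_def)
qed

lemma Kmap_pow_KX: "p \<in> KX \<Longrightarrow> (Kmap \<beta> ^^ n) p \<in> KX"
  by (induction n) (auto simp: Kmap_KX)

lemma KX_snd: "p \<in> KX \<Longrightarrow> snd p \<in> gasket \<beta>"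
  by (auto simp: KX_def)

lemma phi_Kmap: "phi \<beta> (Kmap \<beta> p) = shift (phi \<beta> p)"
  by (simp add: phi_def shift_def funpow_swap1)

lemma phi_Kmap_pow: "phi \<beta> ((Kmap \<beta> ^^ n) p) = (shift ^^ n) (phi \<beta> p)"
  by (induction n) (simp_all add: phi_Kmap)

lemma phi_ups: "p \<in> KX \<Longrightarrow> phi \<beta> p \<in> ups"
proof -
  assume p: "p \<in> KX"
  have "kdig \<beta> q \<in> dig3" if "q \<in> KX" for q
    using kdig_gasket(1)[OF KX_snd[OF that], of "fst q"] by (simp only: prod.collapse)
  from this[OF Kmap_pow_KX[OF p]] show ?thesis unfolding ups_def phi_def mem_Collect_eq by (rule allI)
qed

lemma pival_phi:
  assumes "p \<in> KX"
  shows "pival \<beta> (phi \<beta> p) = snd p"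
proof -
  have "snd ((Kmap \<beta> ^^ 0) p) = pival \<beta> (phi \<beta> p)"
  proof (rule orbit_pival)
    show "snd ((Kmap \<beta> ^^ n) p) = f (phi \<beta> p n) (snd ((Kmap \<beta> ^^ Suc n) p))" for n
      using Kmap_snd[OF KX_snd[OF Kmap_pow_KX[OF assms]], of n] by (simp add: phi_def)
    show "norm (snd ((Kmap \<beta> ^^ n) p)) \<le> 2 / (\<beta> - 1)" for n
      using gasket_bounded KX_snd Kmap_pow_KX assms by blast
  qed
  then show ?thesis by simp
qed

section \<open>Recovering the coins from a digit sequence\<close>

definition visit :: "(nat \<Rightarrow> nat) \<Rightarrow> nat \<Rightarrow> bool" where
  "visit b n \<longleftrightarrow> pival \<beta> ((shift ^^ n) b) \<in> Call \<beta>"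

definition nvisits :: "(nat \<Rightarrow> nat) \<Rightarrow> nat \<Rightarrow> nat" where
  "nvisits b n = (\<Sum>m<n. of_bool (visit b m))"

definition upper :: "(nat \<Rightarrow> nat) \<Rightarrow> nat \<Rightarrow> bool" where
  "upper b n \<longleftrightarrow> b n \<noteq> lo (pival \<beta> ((shift ^^ n) b))"

text \<open>The coin of index \<open>k\<close> is spent at the visit preceded by exactly
  \<open>k\<close> visits, and it is 1 iff the larger digit was taken there. Coins that are never
  spent get the default 0, so \<open>rho\<close> is defined on all digit sequences.\<close>

definition coins :: "(nat \<Rightarrow> nat) \<Rightarrow> nat \<Rightarrow> nat" where
  "coins b k = of_bool (\<exists>n. visit b n \<and> nvisits b n = k \<and> upper b n)"

definition rho :: "(nat \<Rightarrow> nat) \<Rightarrow> (nat \<Rightarrow> nat) \<times> (real \<times> real)" where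
  "rho b = (coins b, pival \<beta> b)"

lemma visit_shift: "visit (shift b) n = visit b (Suc n)"
  by (simp add: visit_def funpow_swap1)

lemma upper_shift: "upper (shift b) n = upper b (Suc n)"
  by (simp add: upper_def funpow_swap1) (simp add: shift_def)

lemma nvisits_Suc_shift: "nvisits b (Suc n) = of_bool (visit b 0) + nvisits (shift b) n"
  by (simp only: nvisits_def sum.lessThan_Suc_shift visit_shift)

lemma nvisits_0 [simp]: "nvisits b 0 = 0"
  by (simp add: nvisits_def)

lemma nvisits_Suc: "nvisits b (Suc n) = nvisits b n + of_bool (visit b n)"
  by (simp add: nvisits_def)

lemma coins_0:
  assumes "visit b 0"
  shows "coins b 0 = of_bool (upper b 0)"
proof -
  have "n = 0" if "nvisits b n = 0" for n
    using that assms nvisits_Suc_shift[of b "n - 1"] by (cases n) auto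
  then have "(\<exists>n. visit b n \<and> nvisits b n = 0 \<and> upper b n) \<longleftrightarrow> upper b 0"
    using assms nvisits_0 by metis
  then show ?thesis by (simp add: coins_def)
qed

lemma coins_shift: "coins (shift b) k = coins b (k + of_bool (visit b 0))"
proof -
  have "(\<exists>n. visit (shift b) n \<and> nvisits (shift b) n = k \<and> upper (shift b) n) \<longleftrightarrow>
    (\<exists>n. visit b n \<and> nvisits b n = k + of_bool (visit b 0) \<and> upper b n)" (is "(\<exists>n. ?L n) \<longleftrightarrow> (\<exists>n. ?R n)")
  proof -
    have "?L n \<longleftrightarrow> ?R (Suc n)" for n
      unfolding visit_shift upper_shift nvisits_Suc_shift by auto
    moreover have "\<not> ?R 0" by auto
    ultimately show ?thesis by (metis not0_implies_Suc)
  qed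
  then show ?thesis by (simp add: coins_def)
qed

lemma digit_lo_hi:
  assumes "b \<in> ups"
  shows "b 0 = lo (pival \<beta> b) \<or> b 0 = hi (pival \<beta> b)"
proof -
  have "pival \<beta> b \<in> f (b 0) ` gasket \<beta>"
    using pival_shift pival_in_gasket[OF shift_ups[OF assms]] by blast
  then show ?thesis
    using lo_hi(3)[OF pival_in_gasket[OF assms], of "b 0"] assms by (simp add: ups_def)
qed

lemma kdig_rho:
  assumes b: "b \<in> ups"
  shows "kdig \<beta> (rho b) = b 0"
proof (cases "visit b 0")
  case True
  then show ?thesis
    using digit_lo_hi[OF b] by (auto simp: rho_def kdig_eq coins_0 upper_def)
next
  case False
  then have "lo (pival \<beta> b) = hi (pival \<beta> b)"
    using lo_hi(4)[OF pival_in_gasket[OF b]] by (simp add: visit_def)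
  then show ?thesis using digit_lo_hi[OF b] by (simp add: rho_def kdig_eq)
qed

lemma Kmap_rho:
  assumes b: "b \<in> ups"
  shows "Kmap \<beta> (rho b) = rho (shift b)"
proof -
  have "Kmap \<beta> (rho b) = (if visit b 0 then shift (coins b) else coins b, \<beta> *\<^sub>R pival \<beta> b - qv (b 0))"
    using kdig_rho[OF b] Kmap_eq[OF pival_in_gasket[OF b]] by (simp add: rho_def visit_def)
  also have "\<beta> *\<^sub>R pival \<beta> b - qv (b 0) = pival \<beta> (shift b)"
    by (subst pival_shift) (rule fmap_inverse)
  also have "(if visit b 0 then shift (coins b) else coins b) = coins (shift b)"
  proof (rule ext)
    fix k
    show "(if visit b 0 then shift (coins b) else coins b) k = coins (shift b) k"
      unfolding coins_shift by (simp add: shift_def)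
  qed
  finally show ?thesis by (simp add: rho_def)
qed

lemma rho_KX: "b \<in> ups \<Longrightarrow> rho b \<in> KX"
  by (simp add: rho_def KX_def space_Omega_M coins_def pival_in_gasket)

text \<open>\<open>rho\<close> intertwines the shift with \<open>Kmap\<close>, and the digit used at
  \<open>rho b\<close> is \<open>b 0\<close>. This holds for every digit sequence, so
  \<open>rho\<close> is a section of \<open>phi\<close> even where unspent coins make
  \<open>phi\<close> non-injective.\<close>

lemma phi_rho:
  assumes b: "b \<in> ups"
  shows "phi \<beta> (rho b) = b"
proof
  fix n
  have "(Kmap \<beta> ^^ n) (rho b) = rho ((shift ^^ n) b)"
    by (induction n) (simp_all add: Kmap_rho funpow_shift_ups[OF b])
  then show "phi \<beta> (rho b) n = b n"
    using kdig_rho[OF funpow_shift_ups[OF b, of n]] by (simp add: phi_def funpow_shift)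
qed

lemma visit_phi:
  assumes "p \<in> KX"
  shows "visit (phi \<beta> p) n \<longleftrightarrow> snd ((Kmap \<beta> ^^ n) p) \<in> Call \<beta>"
  unfolding visit_def phi_Kmap_pow[symmetric] by (simp add: pival_phi[OF Kmap_pow_KX[OF assms]])

lemma fst_Kmap_pow:
  assumes "p \<in> KX"
  shows "fst ((Kmap \<beta> ^^ n) p) k = fst p (k + nvisits (phi \<beta> p) n)"
proof (induction n arbitrary: k)
  case (Suc n)
  let ?q = "(Kmap \<beta> ^^ n) p"
  have "fst (Kmap \<beta> ?q) = (if snd ?q \<in> Call \<beta> then shift (fst ?q) else fst ?q)"
    using Kmap_eq[OF KX_snd[OF Kmap_pow_KX[OF assms]], of "fst ?q" n] by simp
  then show ?case
    using Suc visit_phi[OF assms, of n] by (simp add: nvisits_Suc shift_def)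
qed simp

text \<open>At a visit \<open>lo\<close> and \<open>hi\<close> differ, so the chosen digit reveals
  the current coin; by \<open>fst_Kmap_pow\<close> this is the original coin whose index is the
  number of earlier visits.\<close>

lemma upper_phi:
  assumes p: "p \<in> KX" and v: "visit (phi \<beta> p) n"
  shows "of_bool (upper (phi \<beta> p) n) = fst p (nvisits (phi \<beta> p) n)"
proof -
  let ?q = "(Kmap \<beta> ^^ n) p"
  have q: "?q \<in> KX" by (rule Kmap_pow_KX[OF p])
  have z: "pival \<beta> ((shift ^^ n) (phi \<beta> p)) = snd ?q"
    unfolding phi_Kmap_pow[symmetric] by (rule pival_phi[OF q])
  have "lo (snd ?q) \<noteq> hi (snd ?q)"
    using lo_hi(4)[OF KX_snd[OF q]] visit_phi[OF p] v by blast
  moreover have "phi \<beta> p n = (if fst ?q 0 = 0 then lo (snd ?q) else hi (snd ?q))"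
    using kdig_eq[of "fst ?q" "snd ?q"] by (simp add: phi_def)
  ultimately have "upper (phi \<beta> p) n \<longleftrightarrow> fst ?q 0 \<noteq> 0"
    unfolding upper_def z by auto
  moreover have "fst ?q 0 \<in> {0, 1}" using q by (auto simp: KX_def space_Omega_M)
  ultimately show ?thesis using fst_Kmap_pow[OF p, of n 0] by auto
qed

text \<open>The count grows by at most one per step and is unbounded, so no value is skipped; the
  witness is the step before it first exceeds \<open>k\<close>.\<close>

lemma nvisits_surj:
  assumes "infinite {n. visit b n}"
  obtains n where "visit b n" "nvisits b n = k"
proof -
  have card: "nvisits b n = card {m. m < n \<and> visit b m}" for n
    unfolding nvisits_def by (subst sum_of_bool_eq) (auto intro: arg_cong[where f = card])
  obtain F where F: "F \<subseteq> {n. visit b n}" "finite F" "card F = Suc k"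
    using infinite_arbitrarily_large[OF assms] by blast
  define N where "N = Suc (Max F)"
  have "F \<subseteq> {m. m < N \<and> visit b m}" using F by (auto simp: N_def less_Suc_eq_le)
  then have "card F \<le> nvisits b N" unfolding card by (intro card_mono) auto
  then have ex: "k < nvisits b N" using F by simp
  define n where "n = (LEAST n. k < nvisits b n)"
  have n: "k < nvisits b n" unfolding n_def using ex by (rule LeastI)
  then obtain n' where n': "n = Suc n'" by (cases n) auto
  have "\<not> k < nvisits b n'" using not_less_Least[of n' "\<lambda>n. k < nvisits b n"] n' by (simp add: n_def)
  then have "visit b n'" "nvisits b n' = k" using n unfolding n' nvisits_Suc by (auto split: if_splits simp: of_bool_def)
  then show thesis using that by blast
qed

lemma coins_phi:
  assumes p: "p \<in> KX" and inf: "infinite {n. visit (phi \<beta> p) n}"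
  shows "coins (phi \<beta> p) = fst p"
proof
  fix k
  obtain n where n: "visit (phi \<beta> p) n" "nvisits (phi \<beta> p) n = k" by (rule nvisits_surj[OF inf])
  have up: "upper (phi \<beta> p) m \<longleftrightarrow> fst p k = 1"
    if "visit (phi \<beta> p) m" "nvisits (phi \<beta> p) m = k" for m
    using upper_phi[OF p that(1)] unfolding that(2) by (metis of_bool_eq_1_iff)
  have "(\<exists>n. visit (phi \<beta> p) n \<and> nvisits (phi \<beta> p) n = k \<and> upper (phi \<beta> p) n) \<longleftrightarrow> fst p k = 1"
    using up n by blast
  moreover have "fst p k \<in> {0, 1}" using p by (auto simp: KX_def space_Omega_M)
  ultimately show "coins (phi \<beta> p) k = fst p k" by (auto simp: coins_def)
qed

definition "Zcode = {b \<in> ups. infinite {n. visit b n}}"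

lemma Zset_iff: "p \<in> Zset \<beta> \<longleftrightarrow> p \<in> KX \<and> phi \<beta> p \<in> Zcode"
proof (cases "p \<in> KX")
  case True
  have "(Kmap \<beta> ^^ n) p \<in> space Omega_M \<times> Call \<beta> \<longleftrightarrow> visit (phi \<beta> p) n" for n
    using Kmap_pow_KX[OF True, of n] by (auto simp: visit_phi[OF True] KX_def mem_Times_iff)
  then show ?thesis using True phi_ups[OF True]
    by (simp add: Zset_def Zcode_def S_attr_eq_gasket KX_def)
next
  case False
  then show ?thesis by (simp add: Zset_def S_attr_eq_gasket KX_def)
qed

lemma rho_phi: "p \<in> Zset \<beta> \<Longrightarrow> rho (phi \<beta> p) = p"
  unfolding Zset_iff by (simp add: rho_def coins_phi pival_phi Zcode_def prod_eq_iff)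

lemma rho_Zset: "b \<in> Zcode \<Longrightarrow> rho b \<in> Zset \<beta>"
  by (simp add: Zset_iff rho_KX phi_rho Zcode_def)

lemma shift_Zcode:
  assumes "b \<in> Zcode"
  shows "shift b \<in> Zcode"
proof -
  have "\<not> finite {n. visit (shift b) n}"
  proof
    assume fin: "finite {n. visit (shift b) n}"
    have "{n. visit b n} \<subseteq> insert 0 (Suc ` {n. visit (shift b) n})"
      unfolding visit_shift by (auto simp: image_iff) (metis not0_implies_Suc)
    then have "finite {n. visit b n}" using fin by (metis finite_imageI finite_insert finite_subset)
    then show False using assms by (simp add: Zcode_def)
  qed
  then show ?thesis using assms by (simp add: Zcode_def shift_ups)
qed

lemma Kmap_Zset:
  assumes "p \<in> Zset \<beta>"
  shows "Kmap \<beta> p \<in> Zset \<beta>"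
proof -
  have "p \<in> KX" and "phi \<beta> p \<in> Zcode" using assms by (auto simp: Zset_iff)
  then show ?thesis
    using shift_Zcode by (simp add: Zset_iff Kmap_KX phi_Kmap)
qed

end

section \<open>The coded measure\<close>

lemma pred_neq_nat:
  fixes F G :: "'a \<Rightarrow> nat"
  assumes F: "F \<in> measurable N (count_space UNIV)" and G: "G \<in> measurable N (count_space UNIV)"
  shows "Measurable.pred N (\<lambda>x. F x \<noteq> G x)"
proof -
  have "{x \<in> space N. F x \<noteq> G x} = space N - (\<Union>n. (F -` {n} \<inter> space N) \<inter> (G -` {n} \<inter> space N))"
    by auto
  also have "\<dots> \<in> sets N"
    by (intro sets.Diff sets.top sets.countable_UN image_subsetI sets.Int measurable_sets[OF F] measurable_sets[OF G])
       simp_all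
  finally show ?thesis by (simp only: pred_def)
qed

lemma measurable_coin [measurable]: "(\<lambda>w. w i) \<in> measurable Omega_M (count_space UNIV)"
proof -
  have "(\<lambda>w. w i) \<in> measurable Omega_M (count_space {0, 1})"
    unfolding Omega_M_def by (rule measurable_component_singleton) simp
  then show ?thesis by (rule measurable_compose) simp
qed

lemma measurable_into_Omega_M:
  assumes F: "\<And>i. (\<lambda>x. F x i) \<in> measurable N (count_space UNIV)" and "\<And>x. x \<in> space N \<Longrightarrow> F x \<in> space Omega_M"
  shows "F \<in> measurable N Omega_M"
proof -
  have "(\<lambda>x. F x i) \<in> measurable N (count_space {0, 1})" for i
    using measurable_sets[OF F[of i]] assms(2) by (intro measurableI) (auto simp: space_Omega_M)
  then have "(\<lambda>x i. F x i) \<in> measurable N Omega_M"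
    unfolding Omega_M_def
    by (rule measurable_PiM_single') (use assms(2) in \<open>auto simp: Omega_M_def space_PiM\<close>)
  then show ?thesis by simp
qed

lemma measurable_digit [measurable]: "(\<lambda>b. b i) \<in> measurable Ups_P (count_space UNIV)"
proof -
  have "(\<lambda>b. b i) \<in> measurable Ups_P (uniform_count_measure dig3)"
    unfolding Ups_P_def by (rule measurable_component_singleton) simp
  moreover have "(\<lambda>x. x) \<in> measurable (uniform_count_measure dig3) (count_space UNIV)"
    by (simp add: measurable_def sets_uniform_count_measure space_uniform_count_measure)
  ultimately show ?thesis by (rule measurable_compose)
qed

lemma measurable_into_Ups_P:
  assumes F: "\<And>i. (\<lambda>x. F x i) \<in> measurable N (count_space UNIV)" and ups: "\<And>x. x \<in> space N \<Longrightarrow> F x \<in> ups"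
  shows "F \<in> measurable N Ups_P"
proof -
  have "(\<lambda>x. F x i) \<in> measurable N (uniform_count_measure dig3)" for i
  proof (rule measurableI)
    show "F x i \<in> space (uniform_count_measure dig3)" if "x \<in> space N" for x
      using ups[OF that] by (simp only: space_uniform_count_measure ups_def mem_Collect_eq)
    show "(\<lambda>x. F x i) -` A \<inter> space N \<in> sets N" for A
      by (rule measurable_sets[OF F]) simp
  qed
  then have "(\<lambda>x i. F x i) \<in> measurable N Ups_P"
    unfolding Ups_P_def
  proof (rule measurable_PiM_single')
    show "(\<lambda>\<omega> i. F \<omega> i) \<in> space N \<rightarrow> (\<Pi>\<^sub>E i\<in>UNIV. space (uniform_count_measure dig3))"
      using ups space_Ups_P unfolding Ups_P_def space_PiM by blast
  qed
  then show ?thesis by simp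
qed

lemma measurable_shift [measurable]: "shift \<in> measurable Ups_P Ups_P"
  by (rule measurable_into_Ups_P) (auto simp: shift_def space_Ups_P shift_ups[unfolded shift_def])

lemma measurable_shift_pow [measurable]: "(shift ^^ n) \<in> measurable Ups_P Ups_P"
  by (induction n) auto

section \<open>Independence and shift invariance of uniform digits\<close>

interpretation digits: sequence_space "uniform_count_measure dig3"
  unfolding sequence_space_def product_prob_space_def product_prob_space_axioms_def product_sigma_finite_def
  using prob_space_uniform_count_measure[of dig3] prob_space_imp_sigma_finite by auto

interpretation Ups: prob_space Ups_P
  unfolding Ups_P_def by (rule digits.P.prob_space_axioms)

lemma shift_case_nat [simp]: "shift (case_nat s b) = b"
  by (simp add: shift_def)

lemma case_nat_ups_iff: "case_nat s b \<in> ups \<longleftrightarrow> s \<in> dig3 \<and> b \<in> ups"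
proof
  assume "case_nat s b \<in> ups"
  then have "case_nat s b n \<in> dig3" for n unfolding ups_def by blast
  from this[of 0] this[of "Suc _"] show "s \<in> dig3 \<and> b \<in> ups"
    unfolding ups_def by simp
qed (auto simp: ups_def split: nat.split)

text \<open>The product measure is the image of the product of one digit and a whole sequence under
  prepending, so the first digit is independent of the tail.\<close>

lemma prob_first_digit:
  assumes a: "a \<in> dig3" and B: "B \<in> sets Ups_P"
  shows "measure Ups_P {b \<in> ups. b 0 = a \<and> shift b \<in> B} = measure Ups_P B / 3"
proof -
  let ?U = "uniform_count_measure dig3"
  have Bs: "B \<subseteq> ups" using sets.sets_into_space[OF B] by (simp add: space_Ups_P)
  have C: "{b \<in> ups. b 0 = a \<and> shift b \<in> B} \<in> sets Ups_P"
  proof -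
    have "{b \<in> space Ups_P. b 0 = a \<and> shift b \<in> B} \<in> sets Ups_P" using B by measurable
    then show ?thesis by (simp add: space_Ups_P)
  qed
  have meas: "(\<lambda>(s, \<omega>). case_nat s \<omega>) \<in> measurable (?U \<Otimes>\<^sub>M Ups_P) Ups_P"
    unfolding Ups_P_def split_beta' by measurable
  have "emeasure Ups_P {b \<in> ups. b 0 = a \<and> shift b \<in> B} =
    emeasure (distr (?U \<Otimes>\<^sub>M Ups_P) Ups_P (\<lambda>(s, \<omega>). case_nat s \<omega>)) {b \<in> ups. b 0 = a \<and> shift b \<in> B}"
    unfolding Ups_P_def by (simp only: digits.PiM_iter)
  also have "\<dots> = emeasure (?U \<Otimes>\<^sub>M Ups_P)
      ((\<lambda>(s, \<omega>). case_nat s \<omega>) -` {b \<in> ups. b 0 = a \<and> shift b \<in> B} \<inter> space (?U \<Otimes>\<^sub>M Ups_P))"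
    by (rule emeasure_distr[OF meas C])
  also have "(\<lambda>(s, \<omega>). case_nat s \<omega>) -` {b \<in> ups. b 0 = a \<and> shift b \<in> B} \<inter> space (?U \<Otimes>\<^sub>M Ups_P)
      = {a} \<times> B"
    using a Bs by (auto simp: space_pair_measure space_Ups_P space_uniform_count_measure case_nat_ups_iff
        simp del: insert_iff)
  also have "emeasure (?U \<Otimes>\<^sub>M Ups_P) ({a} \<times> B) = emeasure ?U {a} * emeasure Ups_P B"
    using a B by (intro Ups.emeasure_pair_measure_Times) (auto simp: sets_uniform_count_measure)
  also have "emeasure ?U {a} = ennreal (1 / 3)"
    using a by (subst emeasure_uniform_count_measure) auto
  finally have "emeasure Ups_P {b \<in> ups. b 0 = a \<and> shift b \<in> B} = ennreal (1 / 3) * emeasure Ups_P B" .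
  then show ?thesis
    by (simp add: measure_def enn2real_mult)
qed

lemma prob_word:
  assumes a: "\<And>i. i < m \<Longrightarrow> a i \<in> dig3" and B: "B \<in> sets Ups_P"
  shows "measure Ups_P {b \<in> ups. (\<forall>i<m. b i = a i) \<and> (shift ^^ m) b \<in> B} = measure Ups_P B / 3^m"
  using a
proof (induction m arbitrary: a)
  case 0
  have "{b \<in> ups. b \<in> B} = B" using sets.sets_into_space[OF B] by (auto simp: space_Ups_P)
  then show ?case by simp
next
  case (Suc m)
  let ?B = "{b \<in> ups. (\<forall>i<m. b i = a (Suc i)) \<and> (shift ^^ m) b \<in> B}"
  have "{b \<in> space Ups_P. (\<forall>i<m. b i = a (Suc i)) \<and> (shift ^^ m) b \<in> B} \<in> sets Ups_P"
    using B by measurable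
  then have meas: "?B \<in> sets Ups_P" by (simp only: space_Ups_P)
  have "{b \<in> ups. (\<forall>i<Suc m. b i = a i) \<and> (shift ^^ Suc m) b \<in> B} =
      {b \<in> ups. b 0 = a 0 \<and> shift b \<in> ?B}"
    by (auto simp: All_less_Suc2 shift_ups funpow_swap1) (simp_all add: shift_def)
  then show ?case
    using prob_first_digit[OF Suc.prems[of 0] meas] Suc.IH[of "\<lambda>i. a (Suc i)"] Suc.prems by simp
qed

lemma prob_shift:
  assumes B: "B \<in> sets Ups_P"
  shows "measure Ups_P {b \<in> ups. shift b \<in> B} = measure Ups_P B"
proof -
  have sets: "{b \<in> ups. b 0 = a \<and> shift b \<in> B} \<in> sets Ups_P" for a
  proof -
    have "{b \<in> space Ups_P. b 0 = a \<and> shift b \<in> B} \<in> sets Ups_P" using B by measurable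
    then show ?thesis by (simp only: space_Ups_P)
  qed
  have "{b \<in> ups. shift b \<in> B} = (\<Union>a\<in>dig3. {b \<in> ups. b 0 = a \<and> shift b \<in> B})"
    unfolding ups_def by blast
  then have "measure Ups_P {b \<in> ups. shift b \<in> B} =
      (\<Sum>a\<in>dig3. measure Ups_P {b \<in> ups. b 0 = a \<and> shift b \<in> B})"
    using sets by (simp only:) (intro Ups.finite_measure_finite_Union, auto simp: disjoint_family_on_def)
  also have "\<dots> = (\<Sum>a\<in>dig3. measure Ups_P B / 3)"
    by (rule sum.cong[OF refl]) (rule prob_first_digit[OF _ B])
  finally show ?thesis by simp
qed

lemma prob_shift_pow:
  assumes B: "B \<in> sets Ups_P"
  shows "measure Ups_P {b \<in> ups. (shift ^^ n) b \<in> B} = measure Ups_P B"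
proof (induction n)
  case 0
  have "{b \<in> ups. b \<in> B} = B" using sets.sets_into_space[OF B] by (auto simp: space_Ups_P)
  then show ?case by simp
next
  case (Suc n)
  have "{b \<in> space Ups_P. (shift ^^ n) b \<in> B} \<in> sets Ups_P" using B by measurable
  then have "{b \<in> ups. (shift ^^ n) b \<in> B} \<in> sets Ups_P" by (simp only: space_Ups_P)
  from prob_shift[OF this] have "measure Ups_P {b \<in> ups. shift b \<in> {b \<in> ups. (shift ^^ n) b \<in> B}} = measure Ups_P B"
    using Suc by simp
  moreover have "{b \<in> ups. shift b \<in> {b \<in> ups. (shift ^^ n) b \<in> B}} = {b \<in> ups. (shift ^^ Suc n) b \<in> B}"
    by (auto simp: shift_ups funpow_swap1)
  ultimately show ?case by simp
qed

section \<open>Measurability of the coding map and of its inverse\<close>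

context fat_gasket
begin

lemma closed_fmap_gasket: "closed (f i ` gasket \<beta>)"
proof -
  have "continuous_on (gasket \<beta>) (f i)"
    unfolding fmap_def by (intro continuous_intros)
  then show ?thesis using compact_continuous_image compact_gasket compact_imp_closed by blast
qed

abbreviation "SM \<equiv> restrict_space borel (gasket \<beta>)"

lemma measurable_lo_hi [measurable]:
  "lo \<in> measurable SM (count_space UNIV)" "hi \<in> measurable SM (count_space UNIV)"
proof -
  let ?lo = "\<lambda>z. if z \<in> f 0 ` gasket \<beta> then 0 else if z \<in> f 1 ` gasket \<beta> then 1 else 2::nat"
  let ?hi = "\<lambda>z. if z \<in> f 2 ` gasket \<beta> then 2 else if z \<in> f 1 ` gasket \<beta> then 1 else 0::nat"
  have [measurable]: "f i ` gasket \<beta> \<in> sets borel" for i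
    using closed_fmap_gasket by (rule borel_closed)
  have "?lo \<in> measurable borel (count_space UNIV)" "?hi \<in> measurable borel (count_space UNIV)"
    by measurable
  then have *: "?lo \<in> measurable SM (count_space UNIV)" "?hi \<in> measurable SM (count_space UNIV)"
    by (simp_all only: measurable_restrict_space1)
  have eq: "lo z = ?lo z" "hi z = ?hi z" if "z \<in> space SM" for z
    using that lo_hi_eq by (simp_all add: space_restrict_space)
  show "lo \<in> measurable SM (count_space UNIV)" "hi \<in> measurable SM (count_space UNIV)"
    using * measurable_cong[of SM lo ?lo "count_space UNIV"] measurable_cong[of SM hi ?hi "count_space UNIV"] eq
    by simp_all
qed

lemma XM_eq: "XM \<beta> = Omega_M \<Otimes>\<^sub>M SM"
  by (simp add: XM_def S_attr_eq_gasket)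

lemma space_XM: "space (XM \<beta>) = KX"
  by (simp add: XM_eq space_pair_measure space_restrict_space KX_def)

lemma measurable_kdig [measurable]: "kdig \<beta> \<in> measurable (XM \<beta>) (count_space UNIV)"
proof -
  have "(\<lambda>p. if fst p 0 = 0 then lo (snd p) else hi (snd p)) \<in> measurable (XM \<beta>) (count_space UNIV)"
    unfolding XM_eq by measurable
  moreover have "kdig \<beta> = (\<lambda>p. if fst p 0 = 0 then lo (snd p) else hi (snd p))"
    by (auto simp: kdig_eq)
  ultimately show ?thesis by simp
qed

lemma measurable_Kmap [measurable]: "Kmap \<beta> \<in> measurable (XM \<beta>) (XM \<beta>)"
proof -
  \<comment> \<open>\<open>lo \<noteq> hi\<close> replaces membership in
    \<open>Call \<beta>\<close>, and the shift is written coordinatewise; the two maps agree on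
    \<open>KX\<close>, which is all that measurability sees.\<close>
  let ?K = "\<lambda>p. ((\<lambda>i. if lo (snd p) \<noteq> hi (snd p) then fst p (Suc i) else fst p i),
      \<beta> *\<^sub>R snd p - qv (kdig \<beta> p))"
  have K: "Kmap \<beta> p = ?K p" if "p \<in> KX" for p
  proof -
    have "snd p \<in> gasket \<beta>" using that by (rule KX_snd)
    then show ?thesis
      using Kmap_eq[of "snd p" "fst p"] lo_hi(4)[of "snd p"] by (auto simp: shift_def)
  qed
  have sp: "?K p \<in> KX" if "p \<in> space (XM \<beta>)" for p
    using K[of p] Kmap_KX[of p] that by (simp only: space_XM)
  have "?K \<in> measurable (XM \<beta>) (Omega_M \<Otimes>\<^sub>M SM)"
  proof (rule measurable_Pair)
    show "(\<lambda>p i. if lo (snd p) \<noteq> hi (snd p) then fst p (Suc i) else fst p i) \<in> measurable (XM \<beta>) Omega_M"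
    proof (rule measurable_into_Omega_M)
      show "(\<lambda>p. if lo (snd p) \<noteq> hi (snd p) then fst p (Suc i) else fst p i) \<in> measurable (XM \<beta>) (count_space UNIV)" for i
      proof -
        have coin: "(\<lambda>p. fst p j) \<in> measurable (Omega_M \<Otimes>\<^sub>M SM) (count_space UNIV)" for j
          by (rule measurable_compose[OF measurable_fst measurable_coin])
        have "Measurable.pred (Omega_M \<Otimes>\<^sub>M SM) (\<lambda>p. lo (snd p) \<noteq> hi (snd p))"
          by (intro pred_neq_nat measurable_compose[OF measurable_snd] measurable_lo_hi)
        then show ?thesis unfolding XM_eq pred_def by (rule measurable_If[OF coin coin])
      qed
    qed (use sp in \<open>simp add: KX_def\<close>)
    have q: "(\<lambda>p. qv (kdig \<beta> p)) \<in> measurable (XM \<beta>) borel"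
      by (rule measurable_compose[OF measurable_kdig]) simp
    have "snd \<in> measurable (XM \<beta>) borel"
      unfolding XM_eq by (rule measurable_compose[OF measurable_snd]) (simp add: measurable_restrict_space1)
    then have "(\<lambda>p. \<beta> *\<^sub>R snd p - qv (kdig \<beta> p)) \<in> borel_measurable (XM \<beta>)"
      using q by (intro borel_measurable_diff borel_measurable_scaleR) auto
    then show "(\<lambda>p. \<beta> *\<^sub>R snd p - qv (kdig \<beta> p)) \<in> measurable (XM \<beta>) SM"
      using sp by (intro measurable_restrict_space2) (auto simp: KX_def)
  qed
  then have "?K \<in> measurable (XM \<beta>) (XM \<beta>)" by (simp only: XM_eq)
  then show ?thesis using measurable_cong[of "XM \<beta>" "Kmap \<beta>" ?K "XM \<beta>"] K by (simp only: space_XM)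
qed

lemma measurable_Kmap_pow [measurable]: "(Kmap \<beta> ^^ n) \<in> measurable (XM \<beta>) (XM \<beta>)"
  by (induction n) auto

lemma measurable_phi_digit [measurable]: "(\<lambda>p. phi \<beta> p n) \<in> measurable (XM \<beta>) (count_space UNIV)"
  unfolding phi_def by measurable

lemma measurable_phi [measurable]: "phi \<beta> \<in> measurable (XM \<beta>) Ups_P"
  by (rule measurable_into_Ups_P) (auto simp: space_XM phi_ups)

lemma measurable_pival [measurable]: "pival \<beta> \<in> measurable Ups_P SM"
proof (rule measurable_restrict_space2)
  show "pival \<beta> \<in> space Ups_P \<rightarrow> gasket \<beta>" by (simp add: space_Ups_P pival_in_gasket)
  have [measurable]: "(\<lambda>b. fst (qv (b n))) \<in> borel_measurable Ups_P" "(\<lambda>b. snd (qv (b n))) \<in> borel_measurable Ups_P" for n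
    by (rule measurable_compose[OF measurable_digit], simp)+
  show "pival \<beta> \<in> borel_measurable Ups_P"
    unfolding pival_def[abs_def] by (intro borel_measurable_Pair) measurable
qed

lemma measurable_lo_hi_pival [measurable]:
  "(\<lambda>b. lo (pival \<beta> ((shift ^^ n) b))) \<in> measurable Ups_P (count_space UNIV)"
  "(\<lambda>b. hi (pival \<beta> ((shift ^^ n) b))) \<in> measurable Ups_P (count_space UNIV)"
  by (rule measurable_compose[OF measurable_compose[OF measurable_shift_pow measurable_pival]],
      rule measurable_lo_hi)+

lemma measurable_visit [measurable]: "Measurable.pred Ups_P (\<lambda>b. visit b n)"
proof -
  have "Measurable.pred Ups_P (\<lambda>b. lo (pival \<beta> ((shift ^^ n) b)) \<noteq> hi (pival \<beta> ((shift ^^ n) b)))"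
    by (intro pred_neq_nat measurable_lo_hi_pival)
  then show ?thesis
  proof (rule measurable_cong[THEN iffD1, rotated])
    fix b assume b: "b \<in> space Ups_P"
    show "lo (pival \<beta> ((shift ^^ n) b)) \<noteq> hi (pival \<beta> ((shift ^^ n) b)) \<longleftrightarrow> visit b n"
      unfolding visit_def by (intro lo_hi(4)[symmetric] pival_in_gasket funpow_shift_ups) (use b in \<open>simp add: space_Ups_P\<close>)
  qed
qed

lemma measurable_upper [measurable]: "Measurable.pred Ups_P (\<lambda>b. upper b n)"
  unfolding upper_def by (intro pred_neq_nat measurable_digit measurable_lo_hi_pival)

lemma measurable_nvisits [measurable]: "(\<lambda>b. nvisits b n) \<in> measurable Ups_P (count_space UNIV)"
proof (induction n)
  case (Suc n)
  have "(\<lambda>b. Suc (nvisits b n)) \<in> measurable Ups_P (count_space UNIV)"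
    by (rule measurable_compose[OF Suc]) simp
  then have "(\<lambda>b. if visit b n then Suc (nvisits b n) else nvisits b n) \<in> measurable Ups_P (count_space UNIV)"
    by (rule measurable_If[OF _ Suc]) (rule measurable_visit[unfolded pred_def])
  moreover have "nvisits b (Suc n) = (if visit b n then Suc (nvisits b n) else nvisits b n)" for b
    by (simp add: nvisits_Suc)
  ultimately show ?case by simp
qed simp

lemma measurable_rho [measurable]: "rho \<in> measurable Ups_P (XM \<beta>)"
  unfolding XM_eq rho_def[abs_def]
proof (rule measurable_Pair[OF measurable_into_Omega_M measurable_pival])
  show "(\<lambda>b. coins b k) \<in> measurable Ups_P (count_space UNIV)" for k
    unfolding coins_def of_bool_def by measurable
qed (simp add: coins_def space_Omega_M)

lemma Zcode_sets [measurable]: "Zcode \<in> sets Ups_P"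
proof -
  have "{b \<in> space Ups_P. \<forall>N. \<exists>n\<ge>N. visit b n} \<in> sets Ups_P" by measurable
  moreover have "{b \<in> space Ups_P. \<forall>N. \<exists>n\<ge>N. visit b n} = Zcode"
    by (simp add: Zcode_def space_Ups_P infinite_nat_iff_unbounded_le)
  ultimately show ?thesis by simp
qed

text \<open>The core is open and an expansion depends continuously on its digits, so a long enough
  prefix of an expansion of one core point forces every sequence with that prefix into the
  core.\<close>

lemma visiting_word:
  obtains m a where "\<And>i. i < m \<Longrightarrow> a i \<in> dig3" "\<And>b. b \<in> ups \<Longrightarrow> \<forall>i<m. b i = a i \<Longrightarrow> visit b 0"
proof -
  obtain z where z: "z \<in> switch_core" using switch_core_nonempty by blast
  then have "z \<in> gasket \<beta>" using switch_core_subset by blast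
  then obtain a where a: "a \<in> ups" "z = pival \<beta> a" by (auto simp: gasket_eq_pival)
  obtain e where e: "e > 0" "ball z e \<subseteq> switch_core"
    using open_switch_core z by (meson open_contains_ball)
  \<comment> \<open>\<open>2/(\<beta>-1)\<close> bounds every expansion value, so points that share
    \<open>m\<close> digits are at distance at most \<open>c / \<beta>^m\<close>.\<close>
  define c where "c = 2 / (\<beta> - 1) + 2 / (\<beta> - 1)"
  have "\<forall>\<^sub>F n in sequentially. dist (c / \<beta>^n) 0 < e"
    using tendsto_div_beta_power e(1) by (rule tendstoD)
  then obtain m where m: "dist (c / \<beta>^m) 0 < e" by (auto simp: eventually_sequentially)
  have "visit b 0" if b: "b \<in> ups" "\<forall>i<m. b i = a i" for b
  proof -
    have "norm (pival \<beta> ((shift ^^ 0) b) - pival \<beta> a) \<le> c / \<beta>^m"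
      unfolding c_def
    proof (rule orbit_pival_le)
      show "pival \<beta> ((shift ^^ n) b) = f (a n) (pival \<beta> ((shift ^^ Suc n) b))" if "n < m" for n
        using pival_shift[of "(shift ^^ n) b"] b(2) that by (simp add: funpow_shift)
    qed (rule norm_pival_le)
    moreover have "c / \<beta>^m < e"
      using m abs_ge_self[of "c / \<beta>^m"] unfolding dist_real_def by linarith
    ultimately have "dist z (pival \<beta> b) < e" using a by (simp add: dist_norm norm_minus_commute)
    then have "pival \<beta> b \<in> switch_core" using e(2) by auto
    then have "pival \<beta> b \<in> Call \<beta>" using switch_core_subset by (auto simp: Call_def)
    then show ?thesis by (simp add: visit_def)
  qed
  then show thesis using that[of m a] a(1) by (auto simp: ups_def)
qed

text \<open>A sequence without visits avoids the visiting word and so does its tail, which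
  is independent of the first digits.\<close>
lemma prob_no_visit: "measure Ups_P {b \<in> ups. \<forall>n. \<not> visit b n} = 0"
proof -
  let ?F = "{b \<in> ups. \<forall>n. \<not> visit b n}"
  obtain m a where a: "\<And>i. i < m \<Longrightarrow> a i \<in> dig3"
    and v: "\<And>b. b \<in> ups \<Longrightarrow> \<forall>i<m. b i = a i \<Longrightarrow> visit b 0"
    using visiting_word by blast
  have "{b \<in> space Ups_P. \<forall>n. \<not> visit b n} \<in> sets Ups_P" by measurable
  then have F [measurable]: "?F \<in> sets Ups_P" by (simp only: space_Ups_P)
  let ?G = "{b \<in> ups. (shift ^^ m) b \<in> ?F}"
  let ?W = "{b \<in> ups. (\<forall>i<m. b i = a i) \<and> (shift ^^ m) b \<in> ?F}"
  have "{b \<in> space Ups_P. (shift ^^ m) b \<in> ?F} \<in> sets Ups_P"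
    "{b \<in> space Ups_P. (\<forall>i<m. b i = a i) \<and> (shift ^^ m) b \<in> ?F} \<in> sets Ups_P"
    by measurable
  then have sets: "?G \<in> sets Ups_P" "?W \<in> sets Ups_P" by (simp_all only: space_Ups_P)
  have "visit ((shift ^^ m) b) n \<longleftrightarrow> visit b (m + n)" for b n
    unfolding visit_def by (metis add.commute comp_apply funpow_add)
  then have "?F \<subseteq> ?G - ?W" using v by (auto simp: funpow_shift_ups)
  then have "measure Ups_P ?F \<le> measure Ups_P (?G - ?W)"
    by (rule Ups.finite_measure_mono) (rule sets.Diff[OF sets])
  also have "\<dots> = measure Ups_P ?G - measure Ups_P ?W"
    by (rule Ups.finite_measure_Diff[OF sets]) blast
  also have "\<dots> = measure Ups_P ?F - measure Ups_P ?F / 3^m"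
    using prob_shift_pow[OF F, of m] prob_word[OF a F] by (simp only:)
  finally have "measure Ups_P ?F / 3^m \<le> 0" by simp
  moreover have "\<not> (3::real)^m \<le> 0" by (simp add: not_le)
  ultimately show ?thesis by (simp add: divide_le_0_iff measure_le_0_iff)
qed

text \<open>A sequence with finitely many visits has a tail without any; this covers the complement
  by countably many shift preimages of one null set.\<close>

lemma emeasure_compl_Zcode: "emeasure Ups_P (ups - Zcode) = 0"
proof -
  let ?F = "{b \<in> ups. \<forall>n. \<not> visit b n}"
  have "{b \<in> space Ups_P. \<forall>n. \<not> visit b n} \<in> sets Ups_P" by measurable
  then have F [measurable]: "?F \<in> sets Ups_P" by (simp only: space_Ups_P)
  have "{b \<in> space Ups_P. (shift ^^ n) b \<in> ?F} \<in> sets Ups_P" for n by measurable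
  then have sets: "{b \<in> ups. (shift ^^ n) b \<in> ?F} \<in> sets Ups_P" for n by (simp only: space_Ups_P)
  have "{b \<in> ups. (shift ^^ n) b \<in> ?F} \<in> null_sets Ups_P" for n
    using prob_shift_pow[OF F, of n] prob_no_visit sets[of n]
    by (intro null_setsI) (simp_all add: Ups.emeasure_eq_measure)
  then have null: "(\<Union>n. {b \<in> ups. (shift ^^ n) b \<in> ?F}) \<in> null_sets Ups_P" by blast
  have "ups - Zcode \<subseteq> (\<Union>n. {b \<in> ups. (shift ^^ n) b \<in> ?F})"
  proof
    fix b assume b: "b \<in> ups - Zcode"
    then obtain N where "\<And>n. n \<ge> N \<Longrightarrow> \<not> visit b n"
      by (auto simp: Zcode_def finite_nat_set_iff_bounded) (meson leD)
    moreover have "visit ((shift ^^ N) b) n \<longleftrightarrow> visit b (N + n)" for n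
      unfolding visit_def by (metis add.commute comp_apply funpow_add)
    ultimately have "(shift ^^ N) b \<in> ?F" using b by (simp add: funpow_shift_ups)
    then show "b \<in> (\<Union>n. {b \<in> ups. (shift ^^ n) b \<in> ?F})" using b by blast
  qed
  moreover have "ups - Zcode \<in> sets Ups_P"
    using Zcode_sets sets.compl_sets[of Zcode Ups_P] by (simp only: space_Ups_P)
  ultimately show ?thesis using null null_sets_subset by blast
qed

lemma emeasure_Int_Zcode:
  assumes A: "A \<in> sets Ups_P"
  shows "emeasure Ups_P (A \<inter> Zcode) = emeasure Ups_P A"
proof (rule antisym)
  show "emeasure Ups_P (A \<inter> Zcode) \<le> emeasure Ups_P A" using A by (intro emeasure_mono) auto
  have c: "ups - Zcode \<in> sets Ups_P"
    using Zcode_sets sets.compl_sets[of Zcode Ups_P] by (simp only: space_Ups_P)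
  have "A \<subseteq> (A \<inter> Zcode) \<union> (ups - Zcode)" using sets.sets_into_space[OF A] by (auto simp: space_Ups_P)
  then have "emeasure Ups_P A \<le> emeasure Ups_P ((A \<inter> Zcode) \<union> (ups - Zcode))"
    using A c by (intro emeasure_mono) auto
  also have "\<dots> \<le> emeasure Ups_P (A \<inter> Zcode) + emeasure Ups_P (ups - Zcode)"
    using A c by (intro emeasure_subadditive) auto
  finally show "emeasure Ups_P A \<le> emeasure Ups_P (A \<inter> Zcode)" by (simp add: emeasure_compl_Zcode)
qed

section \<open>The measure \<open>nu\<close> as an image measure, its invariance and the
  isomorphism\<close>

lemma phi_image_Zset: "phi \<beta> ` (Zset \<beta> \<inter> A) = rho -` A \<inter> Zcode"
proof (intro equalityI subsetI)
  fix b assume "b \<in> phi \<beta> ` (Zset \<beta> \<inter> A)"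
  then obtain p where "p \<in> Zset \<beta>" "p \<in> A" "b = phi \<beta> p" by auto
  then show "b \<in> rho -` A \<inter> Zcode" using rho_phi[of p] by (simp add: Zset_iff)
next
  fix b assume b: "b \<in> rho -` A \<inter> Zcode"
  then have "b = phi \<beta> (rho b)" "rho b \<in> Zset \<beta> \<inter> A"
    using phi_rho rho_Zset by (auto simp: Zcode_def)
  then show "b \<in> phi \<beta> ` (Zset \<beta> \<inter> A)" by blast
qed

text \<open>\<open>measure_of\<close> yields the zero measure unless the set function is countably
  additive. Images under \<open>phi\<close> within \<open>Zset\<close> are preimages under
  \<open>rho\<close>, cut down to the set \<open>Zcode\<close> of full measure, so the set function
  is that of an image measure.\<close>

lemma nu_eq_distr: "nu \<beta> = distr Ups_P (XM \<beta>) rho"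
proof -
  have "nu \<beta> = measure_of (space (XM \<beta>)) (sets (XM \<beta>)) (emeasure (distr Ups_P (XM \<beta>) rho))"
    unfolding nu_def
  proof (rule measure_of_eq)
    fix A assume "A \<in> sigma_sets (space (XM \<beta>)) (sets (XM \<beta>))"
    then have A: "A \<in> sets (XM \<beta>)" by (simp add: sets.sigma_sets_eq)
    have "rho -` A \<inter> Zcode = rho -` A \<inter> space Ups_P \<inter> Zcode"
      by (auto simp: Zcode_def space_Ups_P)
    then show "emeasure Ups_P (phi \<beta> ` (Zset \<beta> \<inter> A)) = emeasure (distr Ups_P (XM \<beta>) rho) A"
      using A by (simp add: phi_image_Zset emeasure_distr emeasure_Int_Zcode measurable_sets)
  qed (rule sets.space_closed)
  also have "\<dots> = distr Ups_P (XM \<beta>) rho"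
    using measure_of_of_measure[of "distr Ups_P (XM \<beta>) rho"] by simp
  finally show ?thesis .
qed

lemma sets_nu [simp]: "sets (nu \<beta>) = sets (XM \<beta>)"
  by (simp add: nu_eq_distr)

lemma space_nu: "space (nu \<beta>) = KX"
  by (simp add: nu_eq_distr space_XM)

lemma emeasure_nu: "A \<in> sets (XM \<beta>) \<Longrightarrow> emeasure (nu \<beta>) A = emeasure Ups_P (rho -` A \<inter> ups)"
  by (simp add: nu_eq_distr emeasure_distr space_Ups_P)

lemma Zset_sets: "Zset \<beta> \<in> sets (XM \<beta>)"
proof -
  have "phi \<beta> -` Zcode \<inter> space (XM \<beta>) \<in> sets (XM \<beta>)" by measurable
  moreover have "phi \<beta> -` Zcode \<inter> space (XM \<beta>) = Zset \<beta>"
    by (auto simp: Zset_iff space_XM)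
  ultimately show ?thesis by simp
qed

lemma invariant_nu: "invariant_prob (XM \<beta>) (Kmap \<beta>) (nu \<beta>)"
  unfolding invariant_prob_def
proof (intro conjI ballI)
  show "sets (nu \<beta>) = sets (XM \<beta>)" by simp
  show "prob_space (nu \<beta>)" unfolding nu_eq_distr by (rule Ups.prob_space_distr) measurable
  show "Kmap \<beta> \<in> measurable (XM \<beta>) (XM \<beta>)" by measurable
  fix A assume A: "A \<in> sets (XM \<beta>)"
  have "rho -` A \<inter> space Ups_P \<in> sets Ups_P" using A by measurable
  then have B: "rho -` A \<inter> ups \<in> sets Ups_P" by (simp only: space_Ups_P)
  have pre: "Kmap \<beta> -` A \<inter> space (XM \<beta>) \<in> sets (XM \<beta>)" using A by measurable
  have "rho -` (Kmap \<beta> -` A \<inter> space (XM \<beta>)) \<inter> ups = {b \<in> ups. shift b \<in> rho -` A \<inter> ups}"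
  proof (rule set_eqI)
    fix b
    show "b \<in> rho -` (Kmap \<beta> -` A \<inter> space (XM \<beta>)) \<inter> ups \<longleftrightarrow> b \<in> {b \<in> ups. shift b \<in> rho -` A \<inter> ups}"
      by (cases "b \<in> ups") (simp_all add: space_XM rho_KX Kmap_rho shift_ups)
  qed
  then show "emeasure (nu \<beta>) (Kmap \<beta> -` A \<inter> space (XM \<beta>)) = emeasure (nu \<beta>) A"
    using A pre prob_shift[OF B] by (simp add: emeasure_nu Ups.emeasure_eq_measure)
qed

lemma isomorphic_nu: "isomorphic_sys (nu \<beta>) (Kmap \<beta>) Ups_P shift"
  unfolding isomorphic_sys_def
proof (intro exI conjI ballI)
  let ?N = "KX - Zset \<beta>" and ?N' = "ups - Zcode"
  have Zc: "Zset \<beta> \<subseteq> KX" by (auto simp: Zset_iff)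
  have Zs: "Zcode \<subseteq> ups" by (auto simp: Zcode_def)
  have D: "space (nu \<beta>) - ?N = Zset \<beta>" using Zc by (auto simp: space_nu)
  have D': "space Ups_P - ?N' = Zcode" using Zs by (auto simp: space_Ups_P)
  have rhoZ: "rho -` Zset \<beta> \<inter> ups = Zcode" 
  proof (rule set_eqI)
    fix b
    show "b \<in> rho -` Zset \<beta> \<inter> ups \<longleftrightarrow> b \<in> Zcode"
    proof (cases "b \<in> ups")
      case True
      then show ?thesis by (simp only: Int_iff vimage_eq Zset_iff phi_rho rho_KX simp_thms)
    next
      case False
      then show ?thesis using Zs by blast
    qed
  qed
  show N: "?N \<in> sets (nu \<beta>)" using Zset_sets sets.compl_sets[of "Zset \<beta>" "XM \<beta>"] by (simp add: space_XM)
  have "rho -` ?N \<inter> ups = ups - Zcode" using rhoZ rho_KX by blast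
  then show "emeasure (nu \<beta>) ?N = 0" using N by (simp add: emeasure_nu emeasure_compl_Zcode)
  show "?N' \<in> sets Ups_P"
    using Zcode_sets sets.compl_sets[of Zcode Ups_P] by (simp only: space_Ups_P)
  show "emeasure Ups_P ?N' = 0" by (rule emeasure_compl_Zcode)
  show "Kmap \<beta> x \<in> space (nu \<beta>) - ?N" if "x \<in> space (nu \<beta>) - ?N" for x
    using that unfolding D by (rule Kmap_Zset)
  show "shift y \<in> space Ups_P - ?N'" if "y \<in> space Ups_P - ?N'" for y
    using that unfolding D' by (rule shift_Zcode)
  have bij: "bij_betw (phi \<beta>) (Zset \<beta>) Zcode"
    by (rule bij_betwI[of _ _ _ rho]) (auto simp: rho_phi rho_Zset phi_rho rho_KX Zset_iff Zcode_def)
  then show "bij_betw (phi \<beta>) (space (nu \<beta>) - ?N) (space Ups_P - ?N')" unfolding D D' .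
  have "phi \<beta> \<in> measurable (nu \<beta>) Ups_P"
    using measurable_phi measurable_cong_sets[OF sets_nu refl] by blast
  then show "phi \<beta> \<in> measurable (restrict_space (nu \<beta>) (space (nu \<beta>) - ?N)) Ups_P"
    by (rule measurable_restrict_space1)
  have "rho \<in> measurable (restrict_space Ups_P Zcode) (XM \<beta>)"
    using measurable_rho by (rule measurable_restrict_space1)
  moreover have "the_inv_into (Zset \<beta>) (phi \<beta>) b = rho b" if "b \<in> space (restrict_space Ups_P Zcode)" for b
  proof (rule the_inv_into_f_eq)
    have b: "b \<in> Zcode" using that by (simp add: space_restrict_space)
    show "inj_on (phi \<beta>) (Zset \<beta>)" using bij by (rule bij_betw_imp_inj_on)
    show "phi \<beta> (rho b) = b" using b phi_rho by (simp add: Zcode_def)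
    show "rho b \<in> Zset \<beta>" using b by (rule rho_Zset)
  qed
  ultimately have "the_inv_into (Zset \<beta>) (phi \<beta>) \<in> measurable (restrict_space Ups_P Zcode) (XM \<beta>)"
    using measurable_cong[of "restrict_space Ups_P Zcode" "the_inv_into (Zset \<beta>) (phi \<beta>)" rho "XM \<beta>"] by blast
  then show "the_inv_into (space (nu \<beta>) - ?N) (phi \<beta>) \<in> measurable (restrict_space Ups_P (space Ups_P - ?N')) (nu \<beta>)"
    unfolding D D' using measurable_cong_sets[OF refl sets_nu] by blast
  show "emeasure (nu \<beta>) (phi \<beta> -` B \<inter> (space (nu \<beta>) - ?N)) = emeasure Ups_P B" if B: "B \<in> sets Ups_P" for B
  proof -
    have "phi \<beta> -` B \<inter> space (XM \<beta>) \<in> sets (XM \<beta>)" using B by measurable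
    then have "phi \<beta> -` B \<inter> space (XM \<beta>) \<inter> Zset \<beta> \<in> sets (XM \<beta>)" using Zset_sets by auto
    moreover have "phi \<beta> -` B \<inter> space (XM \<beta>) \<inter> Zset \<beta> = phi \<beta> -` B \<inter> Zset \<beta>" using Zc by (auto simp: space_XM)
    moreover have "rho -` (phi \<beta> -` B \<inter> Zset \<beta>) \<inter> ups = B \<inter> Zcode"
    proof (rule set_eqI)
      fix b
      show "b \<in> rho -` (phi \<beta> -` B \<inter> Zset \<beta>) \<inter> ups \<longleftrightarrow> b \<in> B \<inter> Zcode"
        unfolding rhoZ[symmetric] by (cases "b \<in> ups") (simp_all add: phi_rho)
    qed
    ultimately show ?thesis unfolding D using emeasure_Int_Zcode[OF B] by (simp add: emeasure_nu)
  qed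
  show "phi \<beta> (Kmap \<beta> x) = shift (phi \<beta> x)" for x by (rule phi_Kmap)
qed

end

section \<open>Entropy of invariant measures\<close>

definition dig_words :: "nat \<Rightarrow> nat list set" where
  "dig_words n = {l. set l \<subseteq> dig3 \<and> length l = n}"

lemma card_dig_words: "card (dig_words n) = 3^n"
proof -
  have "card dig3 = 3" by simp
  then show ?thesis
    using card_lists_length_eq[of dig3 n] unfolding dig_words_def by (simp only: finite_insert finite.emptyI)
qed

lemma finite_dig_words: "finite (dig_words n)"
  unfolding dig_words_def by (rule finite_lists_length_eq) simp

lemma word_in_dig_words:
  assumes "b \<in> ups"
  shows "map b [0..<n] \<in> dig_words n"
proof -
  have "b i \<in> dig3" for i using assms unfolding ups_def by blast
  then have "set (map b [0..<n]) \<subseteq> dig3" unfolding set_map by (rule image_subsetI)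
  then show ?thesis unfolding dig_words_def by simp
qed

lemma word_sets: "{b \<in> ups. map b [0..<n] = l} \<in> sets Ups_P"
proof -
  have "{b \<in> space Ups_P. length l = n \<and> (\<forall>i<n. b i = l ! i)} \<in> sets Ups_P" by measurable
  moreover have "{b \<in> space Ups_P. length l = n \<and> (\<forall>i<n. b i = l ! i)} = {b \<in> ups. map b [0..<n] = l}"
    by (auto simp: space_Ups_P list_eq_iff_nth_eq)
  ultimately show ?thesis by simp
qed

lemma prob_word_list:
  assumes l: "l \<in> dig_words n"
  shows "measure Ups_P {b \<in> ups. map b [0..<n] = l} = 1 / 3^n"
proof -
  have "{b \<in> ups. map b [0..<n] = l} = {b \<in> ups. (\<forall>i<n. b i = l ! i) \<and> (shift ^^ n) b \<in> ups}"
    using l by (auto simp: list_eq_iff_nth_eq funpow_shift_ups dig_words_def)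
  moreover have "l ! i \<in> dig3" if "i < n" for i
    using l that nth_mem[of i l] unfolding dig_words_def by blast
  moreover have "ups \<in> sets Ups_P" "measure Ups_P ups = 1"
    using sets.top[of Ups_P] Ups.prob_space by (simp_all add: space_Ups_P)
  ultimately show ?thesis using prob_word[of n "\<lambda>i. l ! i" ups] by simp
qed

text \<open>Every cylinder over a finite index set \<open>J\<close> is a finite disjoint union of
  word cylinders of length \<open>n\<close>, for any \<open>n\<close> with
  \<open>J \<subseteq> {..<n}\<close>, and cylinders over finite index sets determine a measure on
  the product.\<close>

lemma Ups_P_eqI:
  assumes D: "prob_space D" "sets D = sets Ups_P"
    and word: "\<And>n l. l \<in> dig_words n \<Longrightarrow> measure D {b \<in> ups. map b [0..<n] = l} = 1 / 3^n"
  shows "D = Ups_P"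
proof -
  interpret D: prob_space D by fact
  let ?U = "\<lambda>_::nat. uniform_count_measure dig3"
  show ?thesis
  proof (rule measure_eqI_PiM_infinite)
    show "sets D = sets (PiM UNIV ?U)" "sets Ups_P = sets (PiM UNIV ?U)"
      using D by (simp_all add: Ups_P_def)
    show "finite_measure D" by unfold_locales
    fix A :: "nat \<Rightarrow> nat set" and J :: "nat set"
    assume J: "finite J" "\<And>i. i \<in> J \<Longrightarrow> A i \<in> sets (uniform_count_measure dig3)"
    define C where "C = prod_emb UNIV ?U J (Pi\<^sub>E J A)"
    have C: "C = {b \<in> ups. \<forall>i\<in>J. b i \<in> A i}"
      using space_Ups_P by (auto simp: C_def prod_emb_def Ups_P_def space_PiM)
    obtain n where n: "J \<subseteq> {..<n}" using J(1) finite_nat_iff_bounded by blast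
    define L where "L = (\<lambda>b. map b [0..<n]) ` C"
    have L: "L \<subseteq> dig_words n"
      using word_in_dig_words by (auto simp only: L_def C)
    then have finL: "finite L" using finite_dig_words finite_subset by blast
    have CU: "C = (\<Union>l\<in>L. {b \<in> ups. map b [0..<n] = l})"
    proof (intro equalityI subsetI)
      fix b assume "b \<in> C"
      then show "b \<in> (\<Union>l\<in>L. {b \<in> ups. map b [0..<n] = l})" by (auto simp: L_def C)
    next
      fix b assume "b \<in> (\<Union>l\<in>L. {b \<in> ups. map b [0..<n] = l})"
      then obtain c where c: "b \<in> ups" "c \<in> C" "map b [0..<n] = map c [0..<n]" by (auto simp: L_def)
      then have "b i = c i" if "i \<in> J" for i using n that by auto
      then show "b \<in> C" using c by (simp add: C)
    qed
    have disj: "disjoint_family_on (\<lambda>l. {b \<in> ups. map b [0..<n] = l}) L"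
      by (auto simp: disjoint_family_on_def)
    have "measure D C = (\<Sum>l\<in>L. measure D {b \<in> ups. map b [0..<n] = l})"
      unfolding CU by (rule D.finite_measure_finite_Union[OF finL _ disj]) (auto simp: D(2) word_sets)
    also have "\<dots> = (\<Sum>l\<in>L. measure Ups_P {b \<in> ups. map b [0..<n] = l})"
    proof (rule sum.cong[OF refl])
      fix l assume "l \<in> L"
      then have "l \<in> dig_words n" using L by blast
      then show "measure D {b \<in> ups. map b [0..<n] = l} = measure Ups_P {b \<in> ups. map b [0..<n] = l}"
        by (simp only: word prob_word_list)
    qed
    also have "\<dots> = measure Ups_P C"
      unfolding CU by (rule Ups.finite_measure_finite_Union[OF finL _ disj, symmetric]) (auto simp: word_sets)
    finally show "emeasure D (prod_emb UNIV ?U J (Pi\<^sub>E J A)) = emeasure Ups_P (prod_emb UNIV ?U J (Pi\<^sub>E J A))"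
      unfolding C_def[symmetric] by (simp add: D.emeasure_eq_measure Ups.emeasure_eq_measure)
  qed
qed

lemma (in prob_space) observation_prefix:
  assumes "\<And>i. simple_function M (Y i)"
  shows "observation M (\<lambda>m x. map (\<lambda>i. Y i x) [0..<m])"
proof (intro observation.intro observation_axioms.intro)
  show "prob_space M" by unfold_locales
  show "simple_function M (\<lambda>x. map (\<lambda>i. Y i x) [0..<m])" for m
  proof (induction m)
    case (Suc m)
    have "simple_function M (\<lambda>x. (\<lambda>(l, a). l @ [a]) (map (\<lambda>i. Y i x) [0..<m], Y m x))"
      by (intro simple_function_compose1[where g = "\<lambda>(l, a). l @ [a]"] simple_function_Pair Suc assms)
    then show ?case by simp
  qed simp
qed auto

section \<open>The spent coin and the finite states\<close>

context fat_gasket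
begin

lemma KX_coin: "p \<in> KX \<Longrightarrow> fst p i \<in> {0, 1}"
proof -
  assume "p \<in> KX"
  then have "fst p \<in> {w. \<forall>n. w n \<in> {0, 1}}" by (simp only: KX_def mem_Times_iff space_Omega_M)
  then show ?thesis unfolding mem_Collect_eq by (rule spec)
qed

lemma KX_phi: "p \<in> KX \<Longrightarrow> phi \<beta> p i \<in> dig3"
proof -
  assume "p \<in> KX"
  from phi_ups[OF this] show ?thesis unfolding ups_def mem_Collect_eq by (rule spec)
qed

text \<open>The coin spent at \<open>p\<close>; \<open>None\<close> records that no coin is spent,
  which tells whether the coin sequence gets shifted.\<close>

definition coin :: "(nat \<Rightarrow> nat) \<times> (real \<times> real) \<Rightarrow> nat option" where
  "coin p = (if snd p \<in> Call \<beta> then Some (fst p 0) else None)"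

lemma coin_Kmap:
  assumes "p \<in> KX"
  shows "fst p j = (case coin p of None \<Rightarrow> fst (Kmap \<beta> p) j
    | Some c \<Rightarrow> (case j of 0 \<Rightarrow> c | Suc i \<Rightarrow> fst (Kmap \<beta> p) i))"
  using Kmap_eq[of "snd p" "fst p"] KX_snd[OF assms] by (simp add: coin_def shift_def split: nat.split)

lemma coin_phi:
  assumes p: "p \<in> KX"
  shows "coin p = (if visit (phi \<beta> p) 0 then Some (of_bool (upper (phi \<beta> p) 0)) else None)"
  using visit_phi[OF p, of 0] upper_phi[OF p, of 0] by (simp add: coin_def)

text \<open>The position is not recorded, since the digits determine it in the limit.\<close>

definition state :: "nat \<Rightarrow> (nat \<Rightarrow> nat) \<times> (real \<times> real) \<Rightarrow> (nat \<times> nat) list" where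
  "state m p = map (\<lambda>i. (fst p i, phi \<beta> p i)) [0..<m]"

definition word :: "nat \<Rightarrow> (nat \<Rightarrow> nat) \<times> (real \<times> real) \<Rightarrow> nat list" where
  "word m p = map (\<lambda>i. phi \<beta> p i) [0..<m]"

text \<open>Going backwards prepends a digit, and prepends a coin or leaves the coins alone; in
  either case \<open>m\<close> entries at the next time suffice for \<open>m\<close> entries now.
  Going forwards, an entry would be lost at each step.\<close>

lemma state_pullback:
  assumes "p \<in> KX" "q \<in> KX" "kdig \<beta> p = kdig \<beta> q" "coin p = coin q"
    and eq: "state m (Kmap \<beta> p) = state m (Kmap \<beta> q)"
  shows "state m p = state m q"
proof -
  have e: "fst (Kmap \<beta> p) i = fst (Kmap \<beta> q) i \<and> phi \<beta> p (Suc i) = phi \<beta> q (Suc i)" if "i < m" for i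
    using eq that by (auto simp: state_def phi_Kmap shift_def)
  have "phi \<beta> p 0 = phi \<beta> q 0" using assms(3) by (simp add: phi_def)
  then have "phi \<beta> p i = phi \<beta> q i" if "i < m" for i using e that by (cases i) auto
  moreover have "fst p i = fst q i" if "i < m" for i
    unfolding coin_Kmap[OF assms(1), of i] coin_Kmap[OF assms(2), of i] assms(4)
    using e that by (auto split: option.split nat.split)
  ultimately show ?thesis by (simp add: state_def)
qed

text \<open>Repeated pullback from time \<open>n\<close>: the final state is a boundary term, and
  each earlier step contributes just a digit and possibly a coin.\<close>

lemma itin_state_eq:
  assumes p: "p \<in> KX" and q: "q \<in> KX"
    and eq: "itin (Kmap \<beta>) (\<lambda>x. (kdig \<beta> x, coin x)) n p = itin (Kmap \<beta>) (\<lambda>x. (kdig \<beta> x, coin x)) n q"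
    and last: "state m ((Kmap \<beta> ^^ n) p) = state m ((Kmap \<beta> ^^ n) q)"
  shows "itin (Kmap \<beta>) (state m) n p = itin (Kmap \<beta>) (state m) n q"
proof -
  have "state m ((Kmap \<beta> ^^ i) p) = state m ((Kmap \<beta> ^^ i) q)" if "i \<le> n" for i
    using that
  proof (induction rule: inc_induct)
    case (step i)
    show ?case
    proof (rule state_pullback[OF Kmap_pow_KX[OF p] Kmap_pow_KX[OF q]])
      show "kdig \<beta> ((Kmap \<beta> ^^ i) p) = kdig \<beta> ((Kmap \<beta> ^^ i) q)" "coin ((Kmap \<beta> ^^ i) p) = coin ((Kmap \<beta> ^^ i) q)"
        using eq step by (auto simp: itin_eq_iff)
      show "state m (Kmap \<beta> ((Kmap \<beta> ^^ i) p)) = state m (Kmap \<beta> ((Kmap \<beta> ^^ i) q))"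
        using step by simp
    qed
  qed (rule last)
  then show ?thesis by (simp add: itin_eq_iff)
qed

lemma itin_kdig: "itin (Kmap \<beta>) (kdig \<beta>) n p = word n p"
  by (simp add: itin_def word_def phi_def)

lemma word_phi: "word n p = map (phi \<beta> p) [0..<n]"
  by (simp add: word_def)

end

section \<open>Upper bound and equality case for an arbitrary invariant measure\<close>

locale invariant_measure = fat_gasket +
  fixes \<mu> :: "((nat \<Rightarrow> nat) \<times> (real \<times> real)) measure"
  assumes inv: "invariant_prob (XM \<beta>) (Kmap \<beta>) \<mu>"
begin

lemma sets_mu [measurable_cong]: "sets \<mu> = sets (XM \<beta>)"
  using inv by (simp add: invariant_prob_def)

lemma space_mu: "space \<mu> = KX"
  using sets_eq_imp_space_eq[OF sets_mu] by (simp add: space_XM)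

sublocale measure_preserving_system \<mu> "Kmap \<beta>"
proof (intro measure_preserving_system.intro measure_preserving_system_axioms.intro)
  show "prob_space \<mu>" using inv by (simp add: invariant_prob_def)
  show "Kmap \<beta> \<in> measurable \<mu> \<mu>" using measurable_Kmap measurable_cong_sets[OF sets_mu sets_mu] by blast
  fix A assume "A \<in> sets \<mu>"
  then have "emeasure \<mu> (Kmap \<beta> -` A \<inter> space (XM \<beta>)) = emeasure \<mu> A"
    using inv by (simp add: invariant_prob_def)
  then show "measure \<mu> (Kmap \<beta> -` A \<inter> space \<mu>) = measure \<mu> A"
    by (simp add: measure_def space_XM space_mu)
qed

lemma simple_function_mu:
  fixes F :: "_ \<Rightarrow> nat"
  assumes "F \<in> measurable (XM \<beta>) (count_space UNIV)" "F ` KX \<subseteq> R" "finite R"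
  shows "simple_function \<mu> F"
  unfolding simple_function_def space_mu
proof safe
  show "finite (F ` KX)" using assms finite_subset by blast
  show "F -` {F x} \<inter> KX \<in> sets \<mu>" for x
    using measurable_sets[OF assms(1), of "{F x}"] by (simp add: sets_mu space_XM)
qed

lemma simple_phi: "simple_function \<mu> (\<lambda>p. phi \<beta> p i)"
proof (rule simple_function_mu[of _ dig3])
  show "(\<lambda>p. phi \<beta> p i) ` KX \<subseteq> dig3"
    using KX_phi by (rule image_subsetI)
qed (simp_all add: measurable_phi_digit)

lemma simple_kdig: "simple_function \<mu> (kdig \<beta>)"
  using simple_phi[of 0] by (simp add: phi_def)

lemma simple_fst: "simple_function \<mu> (\<lambda>p. fst p i)"
proof (rule simple_function_mu[of _ "{0, 1}"])
  show "(\<lambda>p. fst p i) \<in> measurable (XM \<beta>) (count_space UNIV)"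
    unfolding XM_eq by (rule measurable_compose[OF measurable_fst measurable_coin])
  show "(\<lambda>p. fst p i) ` KX \<subseteq> {0, 1}"
    using KX_coin by (rule image_subsetI)
qed simp

sublocale states: observation \<mu> state
  unfolding state_def[abs_def] by (intro observation_prefix simple_function_Pair simple_fst simple_phi)

sublocale words: observation \<mu> word
  unfolding word_def[abs_def] by (intro observation_prefix simple_phi)

lemma approximable_sigma:
  assumes "sigma_algebra (space \<mu>) A"
  shows "space (sigma KX A) = KX" "sets (sigma KX A) = A"
  using sigma_algebra.sigma_sets_eq[OF assms] assms sigma_algebra_iff2[of KX A]
  by (auto simp: space_mu space_measure_of_conv)

lemma measurable_phi_approximable: "phi \<beta> \<in> measurable (sigma KX (approximable \<mu> word)) Ups_P"
proof (rule measurable_into_Ups_P)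
  note sig = approximable_sigma[OF words.sigma_algebra_approximable]
  show "phi \<beta> p \<in> ups" if "p \<in> space (sigma KX (approximable \<mu> word))" for p
    using that by (simp add: sig phi_ups)
  show "(\<lambda>p. phi \<beta> p i) \<in> measurable (sigma KX (approximable \<mu> word)) (count_space UNIV)" for i
  proof (rule measurableI)
    fix A
    have "(\<lambda>p. phi \<beta> p i) -` A \<inter> KX \<in> saturated \<mu> (word (Suc i))"
      by (auto simp: saturated_def space_mu word_def)
    then show "(\<lambda>p. phi \<beta> p i) -` A \<inter> space (sigma KX (approximable \<mu> word)) \<in> sets (sigma KX (approximable \<mu> word))"
      unfolding sig by (rule words.saturated_approximable)
  qed simp
qed

text \<open>Whether a coin is spent and which one are measurable functions of the infinite digit
  sequence by \<open>coin_phi\<close>, and \<open>phi\<close> is measurable from the sigma-algebra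
  of events approximable by words.\<close>

lemma coin_approximable: "coin -` {v} \<inter> space \<mu> \<in> approximable \<mu> word"
proof -
  note sig = approximable_sigma[OF words.sigma_algebra_approximable]
  define c where "c b = (if visit b 0 then Some (of_bool (upper b 0) :: nat) else None)" for b
  have c: "{b \<in> space Ups_P. c b = v} \<in> sets Ups_P"
  proof (cases v)
    case None
    have "{b \<in> space Ups_P. \<not> visit b 0} \<in> sets Ups_P" by measurable
    moreover have "{b \<in> space Ups_P. \<not> visit b 0} = {b \<in> space Ups_P. c b = v}" by (auto simp: c_def None)
    ultimately show ?thesis by simp
  next
    case (Some a)
    have "{b \<in> space Ups_P. visit b 0 \<and> (upper b 0 \<and> a = 1 \<or> \<not> upper b 0 \<and> a = 0)} \<in> sets Ups_P" by measurable
    moreover have "{b \<in> space Ups_P. visit b 0 \<and> (upper b 0 \<and> a = 1 \<or> \<not> upper b 0 \<and> a = 0)} =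
        {b \<in> space Ups_P. c b = v}" by (auto simp: c_def Some)
    ultimately show ?thesis by (simp only:)
  qed
  have "phi \<beta> -` {b \<in> space Ups_P. c b = v} \<inter> KX \<in> approximable \<mu> word"
    using measurable_sets[OF measurable_phi_approximable c] by (simp only: sig)
  moreover have "phi \<beta> -` {b \<in> space Ups_P. c b = v} \<inter> KX = coin -` {v} \<inter> space \<mu>"
    using coin_phi phi_ups by (auto simp: space_mu space_Ups_P c_def)
  ultimately show ?thesis by simp
qed

lemma simple_coin: "simple_function \<mu> coin"
  unfolding simple_function_def
proof safe
  have "coin ` space \<mu> \<subseteq> {None, Some 0, Some 1}"
    unfolding space_mu
  proof (rule image_subsetI)
    fix p assume "p \<in> KX"
    then have "fst p 0 = 0 \<or> fst p 0 = 1" using KX_coin[of p 0] by blast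
    then show "coin p \<in> {None, Some 0, Some 1}" by (auto simp: coin_def)
  qed
  then show "finite (coin ` space \<mu>)" using finite_subset by blast
  show "coin -` {coin p} \<inter> space \<mu> \<in> sets \<mu>" for p
    using coin_approximable[of "coin p"] by (simp add: approximable_def)
qed

text \<open>The map sending \<open>p\<close> to
  \<open>(fst p, pival \<beta> (phi \<beta> p))\<close> is the identity on \<open>KX\<close>, and
  both components are measurable for the approximable sets because finite states determine single
  coins and digits.\<close>

lemma sets_subset_approximable: "sets \<mu> \<subseteq> approximable \<mu> state"
proof
  note sig = approximable_sigma[OF states.sigma_algebra_approximable]
  let ?N = "sigma KX (approximable \<mu> state)"
  have digit: "(\<lambda>p. F (fst p i) (phi \<beta> p i)) \<in> measurable ?N (count_space UNIV)" for F :: "nat \<Rightarrow> nat \<Rightarrow> nat" and i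
  proof (rule measurableI)
    fix A
    have "(\<lambda>p. F (fst p i) (phi \<beta> p i)) -` A \<inter> KX \<in> saturated \<mu> (state (Suc i))"
      by (auto simp: saturated_def space_mu state_def)
    then show "(\<lambda>p. F (fst p i) (phi \<beta> p i)) -` A \<inter> space ?N \<in> sets ?N"
      unfolding sig by (rule states.saturated_approximable)
  qed simp
  have KX_fst: "fst p \<in> space Omega_M" if "p \<in> KX" for p using that by (auto simp: KX_def)
  have "fst \<in> measurable ?N Omega_M"
    using digit[of "\<lambda>a b. a"] KX_fst by (intro measurable_into_Omega_M) (simp_all add: sig)
  moreover have "phi \<beta> \<in> measurable ?N Ups_P"
    using digit[of "\<lambda>a b. b"] by (intro measurable_into_Ups_P) (auto simp: sig phi_ups)
  then have "(\<lambda>p. pival \<beta> (phi \<beta> p)) \<in> measurable ?N SM"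
    by (rule measurable_compose) (rule measurable_pival)
  ultimately have id: "(\<lambda>p. (fst p, pival \<beta> (phi \<beta> p))) \<in> measurable ?N (XM \<beta>)"
    unfolding XM_eq by (rule measurable_Pair)
  fix A assume A: "A \<in> sets \<mu>"
  then have "(\<lambda>p. (fst p, pival \<beta> (phi \<beta> p))) -` A \<inter> KX \<in> approximable \<mu> state"
    using measurable_sets[OF id, of A] by (simp only: sets_mu sig)
  moreover have "(\<lambda>p. (fst p, pival \<beta> (phi \<beta> p))) -` A \<inter> KX = A"
    using sets.sets_into_space[OF A] by (auto simp: space_mu pival_phi)
  ultimately show "A \<in> approximable \<mu> state" by simp
qed

text \<open>Both the coin tosses and, up to boundary terms, all of phase space are coded by the digits,
  so the digit partition carries the full entropy although it does not separate points.\<close>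
lemma entropy_rate_le_digits:
  fixes F :: "(nat \<Rightarrow> nat) \<times> (real \<times> real) \<Rightarrow> 'c"
  assumes F: "simple_function \<mu> F"
  shows "entropy_rate F \<le> entropy_rate (kdig \<beta>)"
proof (rule entropy_rate_le[OF F simple_kdig])
  fix e :: real assume "e > 0"
  then have e2: "e / 2 > 0" by simp
  have appr: "F -` {v} \<inter> space \<mu> \<in> approximable \<mu> state" for v
    using simple_functionD(2)[OF F] sets_subset_approximable by blast
  obtain m and e1 :: "_ \<Rightarrow> 'c option" where e1: "simple_function \<mu> e1" "sentropy \<mu> e1 \<le> e / 2"
    "\<And>x y. \<lbrakk>x \<in> space \<mu>; y \<in> space \<mu>; state m x = state m y; e1 x = e1 y\<rbrakk> \<Longrightarrow> F x = F y"
    by (rule states.approximable_code[OF F appr e2]) (rule that; assumption)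
  obtain k and ec :: "_ \<Rightarrow> nat option option" where ec: "simple_function \<mu> ec" "sentropy \<mu> ec \<le> e / 2"
    "\<And>x y. \<lbrakk>x \<in> space \<mu>; y \<in> space \<mu>; word k x = word k y; ec x = ec y\<rbrakk> \<Longrightarrow> coin x = coin y"
    by (rule words.approximable_code[OF simple_coin coin_approximable e2]) (rule that; assumption)
  let ?K = "Kmap \<beta>" and ?G = "\<lambda>x. (kdig \<beta> x, coin x)"
  have G: "simple_function \<mu> ?G" by (intro simple_function_Pair simple_kdig simple_coin)
  have "sentropy \<mu> (itin ?K F n) \<le> sentropy \<mu> (itin ?K (kdig \<beta>) n) + real n * e +
      (sentropy \<mu> (state m) + sentropy \<mu> (itin ?K (kdig \<beta>) (Suc k)))" for n
  proof -
    have "sentropy \<mu> (itin ?K F n) \<le> sentropy \<mu> (itin ?K (state m) n) + n * sentropy \<mu> e1"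
      by (rule sentropy_itin_determined[OF F states.sf_g e1(1) e1(3)])
    also have "sentropy \<mu> (itin ?K (state m) n) \<le> sentropy \<mu> (\<lambda>x. (itin ?K ?G n x, state m ((?K ^^ n) x)))"
      by (intro sentropy_mono simple_function_Pair simple_function_itin G simple_function_comp_T states.sf_g)
         (auto intro: itin_state_eq simp: space_mu)
    also have "\<dots> \<le> sentropy \<mu> (itin ?K ?G n) + sentropy \<mu> (\<lambda>x. state m ((?K ^^ n) x))"
      by (intro sentropy_Pair_le simple_function_itin G simple_function_comp_T states.sf_g)
    also have "sentropy \<mu> (\<lambda>x. state m ((?K ^^ n) x)) = sentropy \<mu> (state m)"
      by (rule sentropy_comp_T[OF states.sf_g])
    \<comment> \<open>The window has length \<open>Suc k\<close>, so that it contains the current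
      digit even for \<open>k = 0\<close>.\<close>
    also have "sentropy \<mu> (itin ?K ?G n) \<le> sentropy \<mu> (itin ?K (word (Suc k)) n) + n * sentropy \<mu> ec"
    proof (rule sentropy_itin_determined[OF G words.sf_g ec(1)])
      fix x y assume xy: "x \<in> space \<mu>" "y \<in> space \<mu>" "word (Suc k) x = word (Suc k) y" "ec x = ec y"
      have wk: "word k x = word k y" using words.finer[of k "Suc k" x y] xy by simp
      have "kdig \<beta> x = kdig \<beta> y"
        using words.finer[of "Suc 0" "Suc k" x y] xy by (simp add: word_def phi_def)
      moreover have "coin x = coin y" by (rule ec(3)[OF xy(1,2) wk xy(4)])
      ultimately show "?G x = ?G y" by simp
    qed
    \<comment> \<open>Windows of length \<open>Suc k\<close> at the times below \<open>n\<close> see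
      only digits of index below \<open>n + Suc k\<close>; the surplus of \<open>Suc k\<close>
      digits goes into the constant.\<close>
    also have "sentropy \<mu> (itin ?K (word (Suc k)) n) \<le> sentropy \<mu> (itin ?K (kdig \<beta>) (n + Suc k))"
    proof (intro sentropy_mono simple_function_itin words.sf_g simple_kdig)
      fix x y assume "itin ?K (kdig \<beta>) (n + Suc k) x = itin ?K (kdig \<beta>) (n + Suc k) y"
      then have "\<forall>i\<in>{0..<n + Suc k}. phi \<beta> x i = phi \<beta> y i"
        unfolding itin_kdig word_def map_eq_conv set_upt .
      then have *: "phi \<beta> x i = phi \<beta> y i" if "i < n + Suc k" for i
        by (rule bspec) (use that in simp)
      show "itin ?K (word (Suc k)) n x = itin ?K (word (Suc k)) n y"
        by (auto simp: itin_eq_iff word_def phi_Kmap_pow funpow_shift intro!: *)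
    qed
    also have "\<dots> \<le> sentropy \<mu> (itin ?K (kdig \<beta>) n) + sentropy \<mu> (itin ?K (kdig \<beta>) (Suc k))"
      by (rule sentropy_itin_add[OF simple_kdig])
    finally have "sentropy \<mu> (itin ?K F n) \<le> sentropy \<mu> (itin ?K (kdig \<beta>) n) + sentropy \<mu> (itin ?K (kdig \<beta>) (Suc k))
        + n * sentropy \<mu> ec + sentropy \<mu> (state m) + n * sentropy \<mu> e1" by simp
    moreover have "n * sentropy \<mu> ec \<le> n * (e / 2)" "n * sentropy \<mu> e1 \<le> n * (e / 2)"
      by (rule mult_left_mono, rule ec(2) e1(2), simp)+
    ultimately show ?thesis by (simp add: algebra_simps)
  qed
  then show "\<exists>c. \<forall>n. sentropy \<mu> (itin ?K F n) \<le> sentropy \<mu> (itin ?K (kdig \<beta>) n) + real n * e + c" by blast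
qed

lemma ks_entropy_eq: "ks_entropy \<mu> (Kmap \<beta>) = ereal (entropy_rate (kdig \<beta>))"
  using ks_entropy_le[OF entropy_rate_le_digits] entropy_rate_le_ks_entropy[OF simple_kdig]
  by (rule antisym)

lemma words_range: "itin (Kmap \<beta>) (kdig \<beta>) n ` space \<mu> \<subseteq> dig_words n"
  using word_in_dig_words[OF phi_ups] unfolding itin_kdig word_phi space_mu by blast

lemma entropy_rate_digits_le: "entropy_rate (kdig \<beta>) \<le> ln 3"
proof -
  have "entropy_rate (kdig \<beta>) \<le> sentropy \<mu> (itin (Kmap \<beta>) (kdig \<beta>) 1) / real 1"
    using entropy_rate(2)[OF simple_kdig, of 1] by simp
  also have "\<dots> \<le> ln 3"
    using sentropy_le_card[OF simple_function_itin[OF simple_kdig] words_range[of 1] finite_dig_words]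
    by (simp add: card_dig_words)
  finally show ?thesis .
qed

lemma prob_phi_word:
  "measure \<mu> (itin (Kmap \<beta>) (kdig \<beta>) n -` {l} \<inter> space \<mu>) = measure (distr \<mu> Ups_P (phi \<beta>)) {b \<in> ups. map b [0..<n] = l}"
proof -
  have "phi \<beta> \<in> measurable \<mu> Ups_P" using measurable_phi measurable_cong_sets[OF sets_mu refl] by blast
  then have "measure (distr \<mu> Ups_P (phi \<beta>)) {b \<in> ups. map b [0..<n] = l} =
      measure \<mu> (phi \<beta> -` {b \<in> ups. map b [0..<n] = l} \<inter> space \<mu>)"
    by (rule measure_distr) (rule word_sets)
  moreover have "phi \<beta> -` {b \<in> ups. map b [0..<n] = l} \<inter> space \<mu> = itin (Kmap \<beta>) (kdig \<beta>) n -` {l} \<inter> space \<mu>"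
    using phi_ups by (auto simp: itin_kdig word_phi space_mu)
  ultimately show ?thesis by simp
qed

text \<open>The entropy rate is an infimum, so every block of length \<open>n\<close> has entropy at
  least \<open>n ln 3\<close>, the logarithm of the number of words; equality in the uniform bound
  then fixes all word probabilities.\<close>

lemma distr_phi_if_max:
  assumes "entropy_rate (kdig \<beta>) = ln 3"
  shows "distr \<mu> Ups_P (phi \<beta>) = Ups_P"
proof (rule Ups_P_eqI)
  have "phi \<beta> \<in> measurable \<mu> Ups_P" using measurable_phi measurable_cong_sets[OF sets_mu refl] by blast
  then show "prob_space (distr \<mu> Ups_P (phi \<beta>))" by (rule prob_space_distr)
  fix n l assume l: "l \<in> dig_words n"
  have "n * ln 3 \<le> sentropy \<mu> (itin (Kmap \<beta>) (kdig \<beta>) n)"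
  proof (cases "n = 0")
    case False
    then have "ln 3 \<le> sentropy \<mu> (itin (Kmap \<beta>) (kdig \<beta>) n) / n"
      using entropy_rate(2)[OF simple_kdig, of n] assms by simp
    then show ?thesis using False by (simp add: field_simps)
  qed (simp add: sentropy_itin_0)
  then have "ln (card (dig_words n)) \<le> sentropy \<mu> (itin (Kmap \<beta>) (kdig \<beta>) n)"
    by (simp add: card_dig_words ln_realpow)
  from uniform_if_sentropy_max[OF simple_function_itin[OF simple_kdig] words_range finite_dig_words this l]
  show "measure (distr \<mu> Ups_P (phi \<beta>)) {b \<in> ups. map b [0..<n] = l} = 1 / 3^n"
    by (simp add: prob_phi_word card_dig_words)
qed simp

text \<open>The complement of \<open>Zset\<close> is the \<open>phi\<close>-preimage of a null set,
  so \<mu>-almost every point lies in \<open>Zset\<close>, where \<open>rho\<close> undoes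
  \<open>phi\<close>. Points with unspent coins thus have measure zero.\<close>

lemma eq_nu_if_distr_phi:
  assumes D: "distr \<mu> Ups_P (phi \<beta>) = Ups_P"
  shows "\<mu> = nu \<beta>"
proof (rule measure_eqI)
  show "sets \<mu> = sets (nu \<beta>)" by (simp add: sets_mu)
  have phi: "phi \<beta> \<in> measurable \<mu> Ups_P" using measurable_phi measurable_cong_sets[OF sets_mu refl] by blast
  fix A assume "A \<in> sets \<mu>"
  then have A: "A \<in> sets (XM \<beta>)" by (simp add: sets_mu)
  have "rho -` A \<inter> space Ups_P \<in> sets Ups_P" using A by measurable
  then have RA: "rho -` A \<inter> ups \<in> sets Ups_P" by (simp only: space_Ups_P)
  have pull: "emeasure Ups_P B = emeasure \<mu> (phi \<beta> -` B \<inter> KX)" if "B \<in> sets Ups_P" for B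
    using emeasure_distr[OF phi that] by (simp add: D space_mu)
  have "ups - Zcode \<in> sets Ups_P"
    using Zcode_sets sets.compl_sets[of Zcode Ups_P] by (simp only: space_Ups_P)
  from pull[OF this] have "emeasure \<mu> (phi \<beta> -` (ups - Zcode) \<inter> KX) = 0"
    by (simp add: emeasure_compl_Zcode)
  moreover have "phi \<beta> -` (ups - Zcode) \<inter> KX = KX - Zset \<beta>"
    using phi_ups by (auto simp: Zset_iff)
  moreover have "KX - Zset \<beta> \<in> sets \<mu>"
    using Zset_sets sets.compl_sets[of "Zset \<beta>" "XM \<beta>"] by (simp add: space_XM sets_mu)
  ultimately have AE: "AE p in \<mu>. p \<in> Zset \<beta>"
    by (intro AE_I[of _ _ "KX - Zset \<beta>"]) (auto simp: space_mu)
  have "emeasure (nu \<beta>) A = emeasure \<mu> (phi \<beta> -` (rho -` A \<inter> ups) \<inter> KX)"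
    using A pull[OF RA] by (simp add: emeasure_nu)
  also have "\<dots> = emeasure \<mu> A"
  proof (rule emeasure_eq_AE)
    show "AE p in \<mu>. p \<in> phi \<beta> -` (rho -` A \<inter> ups) \<inter> KX \<longleftrightarrow> p \<in> A"
      using AE
    proof eventually_elim
      case (elim p)
      then show ?case using rho_phi[of p] phi_ups[of p] by (simp add: Zset_iff)
    qed
    show "phi \<beta> -` (rho -` A \<inter> ups) \<inter> KX \<in> sets \<mu>"
      using measurable_sets[OF phi RA] by (simp only: space_mu)
    show "A \<in> sets \<mu>" by fact
  qed
  finally show "emeasure \<mu> A = emeasure (nu \<beta>) A" by simp
qed

end

section \<open>The entropy of \<open>nu\<close>\<close>

context fat_gasket
begin

lemma invariant_measure_nu: "invariant_measure \<beta> (nu \<beta>)"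
  by (intro invariant_measure.intro invariant_measure_axioms.intro fat_gasket_axioms invariant_nu)

lemma distr_phi_nu: "distr (nu \<beta>) Ups_P (phi \<beta>) = Ups_P"
proof -
  have "distr (nu \<beta>) Ups_P (phi \<beta>) = distr Ups_P Ups_P (phi \<beta> \<circ> rho)"
    unfolding nu_eq_distr by (rule distr_distr) measurable
  also have "\<dots> = distr Ups_P Ups_P (\<lambda>b. b)"
    by (rule distr_cong) (simp_all add: phi_rho space_Ups_P)
  finally show ?thesis by (simp add: distr_id)
qed

lemma ks_entropy_nu: "ks_entropy (nu \<beta>) (Kmap \<beta>) = ereal (ln 3)"
proof -
  interpret nu: invariant_measure \<beta> "nu \<beta>" by (rule invariant_measure_nu)
  have "sentropy (nu \<beta>) (itin (Kmap \<beta>) (kdig \<beta>) n) / n = ln 3" if "n > 0" for n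
  proof -
    let ?F = "itin (Kmap \<beta>) (kdig \<beta>) n"
    have p: "measure (nu \<beta>) (?F -` {l} \<inter> space (nu \<beta>)) = 1 / 3^n" if "l \<in> ?F ` space (nu \<beta>)" for l
      using nu.prob_phi_word[of n l] prob_word_list[of l n] nu.words_range[of n] that
      unfolding distr_phi_nu by auto
    have "(\<Sum>l\<in>?F ` space (nu \<beta>). measure (nu \<beta>) (?F -` {l} \<inter> space (nu \<beta>))) = 1"
      using nu.simple_distributed_sum_space[OF nu.simple_distributedI[OF nu.simple_function_itin[OF nu.simple_kdig] measure_nonneg refl]] .
    then have "(\<Sum>l\<in>?F ` space (nu \<beta>). 1 / 3^n) = (1::real)" by (simp only: p cong: sum.cong)
    moreover have "sentropy (nu \<beta>) ?F = - (\<Sum>l\<in>?F ` space (nu \<beta>). 1 / 3^n * ln (1 / 3^n))"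
      unfolding sentropy_def by (simp only: p cong: sum.cong)
    \<comment> \<open>All words that occur have the same probability, so the logarithm factors out
      and the total mass 1 remains, with no count of the occurring words.\<close>
    ultimately have "sentropy (nu \<beta>) ?F = - ln (1 / 3^n)"
      by (simp only: sum_distrib_right[symmetric] mult_1)
    then show ?thesis using that by (simp add: ln_div ln_realpow)
  qed
  then have "(\<lambda>n. sentropy (nu \<beta>) (itin (Kmap \<beta>) (kdig \<beta>) n) / n) \<longlonglongrightarrow> ln 3"
    by (intro tendsto_eventually eventually_sequentiallyI[of 1]) simp
  then have "nu.entropy_rate (kdig \<beta>) = ln 3"
    using nu.entropy_rate(1)[OF nu.simple_kdig] LIMSEQ_unique by blast
  then show ?thesis using nu.ks_entropy_eq by simp
qed

end

theorem theorem6p9: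
  fixes \<beta> :: real
  assumes "3/2 < \<beta>" and "\<beta> \<le> beta_star"
  shows "isomorphic_sys (nu \<beta>) (Kmap \<beta>) Ups_P shift
       \<and> invariant_prob (XM \<beta>) (Kmap \<beta>) (nu \<beta>)
       \<and> (\<forall>\<mu>. invariant_prob (XM \<beta>) (Kmap \<beta>) \<mu> \<longrightarrow> ks_entropy \<mu> (Kmap \<beta>) \<le> ks_entropy (nu \<beta>) (Kmap \<beta>))
       \<and> (\<forall>\<mu>. invariant_prob (XM \<beta>) (Kmap \<beta>) \<mu> \<and> ks_entropy \<mu> (Kmap \<beta>) = ks_entropy (nu \<beta>) (Kmap \<beta>) \<longrightarrow> \<mu> = nu \<beta>)"
proof -
  interpret fat_gasket \<beta> by unfold_locales (fact assms)+
  have inv: "invariant_measure \<beta> \<mu>" if "invariant_prob (XM \<beta>) (Kmap \<beta>) \<mu>" for \<mu>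
    by (intro invariant_measure.intro invariant_measure_axioms.intro fat_gasket_axioms that)
  have "ks_entropy \<mu> (Kmap \<beta>) \<le> ks_entropy (nu \<beta>) (Kmap \<beta>)"
    and "ks_entropy \<mu> (Kmap \<beta>) = ks_entropy (nu \<beta>) (Kmap \<beta>) \<Longrightarrow> \<mu> = nu \<beta>"
    if "invariant_prob (XM \<beta>) (Kmap \<beta>) \<mu>" for \<mu>
  proof -
    interpret mu: invariant_measure \<beta> \<mu> by (rule inv[OF that])
    show "ks_entropy \<mu> (Kmap \<beta>) \<le> ks_entropy (nu \<beta>) (Kmap \<beta>)"
      using mu.entropy_rate_digits_le by (simp add: mu.ks_entropy_eq ks_entropy_nu)
    assume "ks_entropy \<mu> (Kmap \<beta>) = ks_entropy (nu \<beta>) (Kmap \<beta>)"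
    then show "\<mu> = nu \<beta>"
      by (intro mu.eq_nu_if_distr_phi mu.distr_phi_if_max) (simp add: mu.ks_entropy_eq ks_entropy_nu)
  qed
  then show ?thesis using isomorphic_nu invariant_nu by blast
qed

end
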